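(* For every $n\in\mathbb{N}$ (with $n\ge 1$) there exists $\hat K(n)>0$ such that for every $K\ge\hat K(n)$ and every $\mu\in(0,1)$, setting $$C=3\mu+K(1-\mu)^{2/3},$$ there exist four $n$-ejection-collision orbits ($n$-EC orbits) of the primary $P_1$ with Jacobi constant $C$ in the planar circular restricted three-body problem with mass parameter $\mu$, which can be characterized by: (i) two of them are $n$-EC orbits each of which is symmetric with respect to the $x$ axis; (ii) the other two are $n$-EC orbits that are symmetric one of the other with respect to the $x$ axis. The respective families are labelled $\alpha_n,\gamma_n$ (those in (i)) and $\beta_n,\delta_n$ (those in (ii)).
   Context: Planar circular restricted three-body problem (RTBP) with mass parameter $\mu\in(0,1)$, in rotating (synodical) coordinates: the primaries $P_1=(\mu,0)$ (mass $1-\mu$) and $P_2=(\mu-1,0)$ (mass $\mu$) are fixed and the massless particle $(x(t),y(t))$ satisfies $$\ddot x-2\dot y=\Omega_x(x,y),\qquad \ddot y+2\dot x=\Omega_y(x,y),$$ $$\Omega(x,y)=\tfrac12(x^2+y^2)+\frac{1-\mu}{r_1}+\frac{\mu}{r_2}+\tfrac12\mu(1-\mu),\quad r_1=\sqrt{(x-\mu)^2+y^2},\quad r_2=\sqrt{(x-\mu+1)^2+y^2}.$$ The Jacobi constant $C=2\Omega(x,y)-\dot x^2-\dot y^2$ is a first integral. Collisions with $P_1$ are regularized by the Levi-Civita change $x=\mu+u^2-v^2$, $y=2uv$, $dt/ds=4(u^2+v^2)$. For a fixed value of $C$ the regularized equations are smooth at $u=v=0$ ($'=d/ds$): $$u''-8(u^2+v^2)v'=\partial_u\big(4(u^2+v^2)\,\mathcal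 U\big),\qquad v''+8(u^2+v^2)u'=\partial_v\big(4(u^2+v^2)\,\mathcal U\big),\qquad \mathcal U=\Omega-\tfrac{C}{2},$$ with $\Omega$ expressed in $(u,v)$, and $u'^2+v'^2=8(u^2+v^2)\,\mathcal U$, so that $u'^2+v'^2=8(1-\mu)$ at $u=v=0$. The ejection orbits from $P_1$ are the solutions with $(u,v,u',v')(0)=(0,0,2\sqrt{2(1-\mu)}\cos\theta_0,2\sqrt{2(1-\mu)}\sin\theta_0)$; since $(u,v)$ and $(-u,-v)$ represent the same point of the $(x,y)$ plane, it suffices to take $\theta_0\in[0,\pi)$. An $n$-ejection-collision orbit ($n$-EC orbit) of $P_1$ is the orbit described by a particle that ejects from $P_1$ (starts at collision with $P_1$) and whose distance to $P_1$ reaches $n$ times a relative maximum before the particle collides with $P_1$. Symmetry of orbits with respect to the $x$ axis refers to their projections to the $(x,y)$ plane. *)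

theory Defs
  imports "HOL-Analysis.Analysis"
begin

section \<open>Synodical coordinates\<close>

definition r1 :: "real \<Rightarrow> real \<times> real \<Rightarrow> real" where
  "r1 \<mu> = (\<lambda>(x, y). sqrt ((x - \<mu>)\<^sup>2 + y\<^sup>2))"

definition r2 :: "real \<Rightarrow> real \<times> real \<Rightarrow> real" where
  "r2 \<mu> = (\<lambda>(x, y). sqrt ((x - \<mu> + 1)\<^sup>2 + y\<^sup>2))"

definition Omega :: "real \<Rightarrow> real \<times> real \<Rightarrow> real" where
  "Omega \<mu> = (\<lambda>(x, y). (x\<^sup>2 + y\<^sup>2) / 2 + (1 - \<mu>) / r1 \<mu> (x, y) + \<mu> / r2 \<mu> (x, y)
      + \<mu> * (1 - \<mu>) / 2)"

section \<open>Levi-Civita regularization at the first primary\<close>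

definition LC :: "real \<Rightarrow> real \<Rightarrow> real \<Rightarrow> real \<times> real" where
  "LC \<mu> u v = (\<mu> + u\<^sup>2 - v\<^sup>2, 2 * u * v)"

text \<open>The smooth extension to \<open>u = v = 0\<close> of \<open>4 (u\<^sup>2 + v\<^sup>2) (\<Omega> - C / 2)\<close>.
  Since \<open>r1 = u\<^sup>2 + v\<^sup>2\<close>, the term \<open>(1 - \<mu>) / r1\<close> contributes the constant \<open>4 (1 - \<mu>)\<close>;
  cancelling it by hand matters because division by zero is \<open>0\<close> in HOL.
  See \<open>reg_potential_eq\<close> below.\<close>

definition reg_potential :: "real \<Rightarrow> real \<Rightarrow> real \<Rightarrow> real \<Rightarrow> real" where
  "reg_potential \<mu> C u v =
     4 * (1 - \<mu>) + 4 * (u\<^sup>2 + v\<^sup>2) *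
       (((fst (LC \<mu> u v))\<^sup>2 + (snd (LC \<mu> u v))\<^sup>2) / 2 + \<mu> / r2 \<mu> (LC \<mu> u v)
         + \<mu> * (1 - \<mu>) / 2 - C / 2)"

lemma r1_LC: "r1 \<mu> (LC \<mu> u v) = u\<^sup>2 + v\<^sup>2"
proof -
  have "(u\<^sup>2 - v\<^sup>2)\<^sup>2 + (2 * u * v)\<^sup>2 = (u\<^sup>2 + v\<^sup>2)\<^sup>2"
    by algebra
  then show ?thesis
    by (simp add: r1_def LC_def)
qed

lemma reg_potential_eq:
  assumes "(u, v) \<noteq> (0, 0)"
  shows "reg_potential \<mu> C u v = 4 * (u\<^sup>2 + v\<^sup>2) * (Omega \<mu> (LC \<mu> u v) - C / 2)"
proof -
  define \<rho> where "\<rho> = u\<^sup>2 + v\<^sup>2"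
  have "\<rho> \<noteq> 0"
    using assms by (simp add: \<rho>_def sum_power2_eq_zero_iff)
  then have "4 * \<rho> * ((1 - \<mu>) / \<rho>) = 4 * (1 - \<mu>)"
    by simp
  then show ?thesis
    unfolding reg_potential_def Omega_def case_prod_beta prod.collapse r1_LC \<rho>_def[symmetric]
    by (simp only: distrib_left right_diff_distrib)
qed

text \<open>An arc of finite duration in the regularized phase space, as a function of the
  regularized time \<open>s \<in> [0, duration]\<close>; values outside this interval are irrelevant.\<close>

record lc_arc =
  duration :: real
  pos_u :: "real \<Rightarrow> real"
  pos_v :: "real \<Rightarrow> real"
  vel_u :: "real \<Rightarrow> real"
  vel_v :: "real \<Rightarrow> real"

text \<open>The vector field is singular at the second primary \<open>(\<mu> - 1, 0)\<close>, so solutions are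
  required to avoid it. The last conjunct is the Jacobi integral in regularized variables
  (see \<open>jacobi_constant_LC\<close> below).\<close>

definition reg_solution :: "real \<Rightarrow> real \<Rightarrow> lc_arc \<Rightarrow> bool" where
  "reg_solution \<mu> C a \<longleftrightarrow> 0 < duration a \<and>
    (\<forall>s\<in>{0..duration a}.
      let u = pos_u a s; v = pos_v a s; u' = vel_u a s; v' = vel_v a s in
      LC \<mu> u v \<noteq> (\<mu> - 1, 0) \<and>
      (pos_u a has_real_derivative u') (at s within {0..duration a}) \<and>
      (pos_v a has_real_derivative v') (at s within {0..duration a}) \<and>
      (vel_u a has_real_derivative
         8 * (u\<^sup>2 + v\<^sup>2) * v' + deriv (\<lambda>z. reg_potential \<mu> C z v) u)
        (at s within {0..duration a}) \<and>
      (vel_v a has_real_derivative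
         - 8 * (u\<^sup>2 + v\<^sup>2) * u' + deriv (\<lambda>z. reg_potential \<mu> C u z) v)
        (at s within {0..duration a}) \<and>
      u'\<^sup>2 + v'\<^sup>2 = 2 * reg_potential \<mu> C u v)"

text \<open>With \<open>dt/ds = 4 (u\<^sup>2 + v\<^sup>2)\<close>, the synodical velocity is \<open>(xd, yd)\<close> below.\<close>

lemma jacobi_constant_LC:
  fixes u v u' v' :: real
  defines "xd \<equiv> 2 * (u * u' - v * v') / (4 * (u\<^sup>2 + v\<^sup>2))"
    and "yd \<equiv> 2 * (u' * v + u * v') / (4 * (u\<^sup>2 + v\<^sup>2))"
  assumes nz: "(u, v) \<noteq> (0, 0)"
  shows "u'\<^sup>2 + v'\<^sup>2 = 2 * reg_potential \<mu> C u v \<longleftrightarrow>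
    C = 2 * Omega \<mu> (LC \<mu> u v) - xd\<^sup>2 - yd\<^sup>2"
proof -
  define \<rho> where "\<rho> = u\<^sup>2 + v\<^sup>2"
  have \<rho>: "\<rho> \<noteq> 0"
    using nz by (simp add: \<rho>_def sum_power2_eq_zero_iff)
  have "xd\<^sup>2 + yd\<^sup>2 = ((2 * (u * u' - v * v'))\<^sup>2 + (2 * (u' * v + u * v'))\<^sup>2) / (4 * \<rho>)\<^sup>2"
    unfolding xd_def yd_def \<rho>_def power_divide add_divide_distrib ..
  also have "(2 * (u * u' - v * v'))\<^sup>2 + (2 * (u' * v + u * v'))\<^sup>2 = 4 * \<rho> * (u'\<^sup>2 + v'\<^sup>2)"
    unfolding \<rho>_def by algebra
  also have "4 * \<rho> * (u'\<^sup>2 + v'\<^sup>2) / (4 * \<rho>)\<^sup>2 = (u'\<^sup>2 + v'\<^sup>2) / (4 * \<rho>)"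
    using \<rho> by (simp add: power2_eq_square field_simps)
  finally have *: "xd\<^sup>2 + yd\<^sup>2 = (u'\<^sup>2 + v'\<^sup>2) / (4 * \<rho>)" .
  have "u'\<^sup>2 + v'\<^sup>2 = 2 * reg_potential \<mu> C u v \<longleftrightarrow>
      (u'\<^sup>2 + v'\<^sup>2) / (4 * \<rho>) = 2 * Omega \<mu> (LC \<mu> u v) - C"
    unfolding reg_potential_eq[OF nz] \<rho>_def[symmetric] using \<rho> by (auto simp: field_simps)
  then show ?thesis
    using * by auto
qed

section \<open>Ejection-collision orbits of the first primary\<close>

definition ejection_orbit :: "real \<Rightarrow> real \<Rightarrow> lc_arc \<Rightarrow> bool" where
  "ejection_orbit \<mu> C a \<longleftrightarrow> reg_solution \<mu> C a \<and>
    pos_u a 0 = 0 \<and> pos_v a 0 = 0 \<and>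
    (\<exists>\<theta>\<in>{0..<pi}. vel_u a 0 = 2 * sqrt (2 * (1 - \<mu>)) * cos \<theta> \<and>
                 vel_v a 0 = 2 * sqrt (2 * (1 - \<mu>)) * sin \<theta>)"

definition synodic :: "real \<Rightarrow> lc_arc \<Rightarrow> real \<Rightarrow> real \<times> real" where
  "synodic \<mu> a s = LC \<mu> (pos_u a s) (pos_v a s)"

definition rel_max_at :: "(real \<Rightarrow> real) \<Rightarrow> real \<Rightarrow> bool" where
  "rel_max_at f s \<longleftrightarrow> (\<forall>\<^sub>F t in at s. f t \<le> f s)"

text \<open>The arc runs from ejection to the first subsequent collision. For \<open>n \<ge> 1\<close> the
  cardinality condition entails that the set of relative maxima is finite.\<close>

definition n_EC_orbit :: "real \<Rightarrow> real \<Rightarrow> nat \<Rightarrow> lc_arc \<Rightarrow> bool" where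
  "n_EC_orbit \<mu> C n a \<longleftrightarrow> ejection_orbit \<mu> C a \<and>
    synodic \<mu> a (duration a) = (\<mu>, 0) \<and>
    (\<forall>s\<in>{0<..<duration a}. synodic \<mu> a s \<noteq> (\<mu>, 0)) \<and>
    card {s \<in> {0<..<duration a}. rel_max_at (\<lambda>t. r1 \<mu> (synodic \<mu> a t)) s} = n"

definition projection :: "real \<Rightarrow> lc_arc \<Rightarrow> (real \<times> real) set" where
  "projection \<mu> a = synodic \<mu> a ` {0..duration a}"

text \<open>Reflected orbits are traversed backwards in time, so symmetry is a relation between
  the projected point sets.\<close>

definition x_symmetric_to :: "real \<Rightarrow> lc_arc \<Rightarrow> lc_arc \<Rightarrow> bool" where
  "x_symmetric_to \<mu> a b \<longleftrightarrow> projection \<mu> b = (\<lambda>(x, y). (x, - y)) ` projection \<mu> a"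

end

theory Submission
  imports Defs
begin

text \<open>
  In rescaled Levi-Civita variables the equations are those of the planar harmonic oscillator seen
  from a rotating frame, plus a perturbation of order \<open>\<epsilon>\<^sup>2\<close> with \<open>\<epsilon> = K powr (- 3 / 2)\<close>, uniformly in
  \<open>\<mu>\<close>. The rotating Kepler problem is integrable and all its ejection orbits collide; the distance
  to the primary has one maximum between consecutive close encounters. The inertial angular
  momentum changes only through the torque of the second primary, which is \<open>\<epsilon>\<^sup>2 * \<mu>\<close> times a function
  close to \<open>- 12 * \<bar>z\<bar> ^ 6 * sin (4 * arg z)\<close>, and a close encounter is a collision iff the
  angular momentum vanishes there. Hence \<open>n\<close>-EC orbits sit near the four zeros \<open>\<theta> = j * pi / 4\<close> of the
  torque: near the diagonals the total torque changes sign, which yields \<open>\<beta>\<close> and its reflection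
  \<open>\<delta>\<close>; near the axes one shoots for a state that is symmetric at the middle of the orbit, which
  yields \<open>\<alpha>\<close> and \<open>\<gamma>\<close>. No earlier collision occurs, because the frame rotates
  by \<open>\<epsilon> * pi\<close> per passage, so that the torques of successive passages are strictly monotone: if
  they add up to zero, no proper partial sum vanishes.
\<close>

section \<open>Ordinary differential equations with Lipschitz right-hand side\<close>

text \<open>The angular momentum at a close encounter is of order
  \<open>\<epsilon>\<^sup>2 * \<mu>\<close>, no larger than the error
  \<open>C * \<epsilon>\<^sup>2\<close> of the Kepler approximation, so its zeros cannot be read off
  the approximate orbit. The balance law \<open>angmom_eq\<close> is exact and factors
  \<open>\<epsilon>\<^sup>2 * \<mu>\<close> out; only the accumulated torque is approximated, with
  error at most \<epsilon> against a difference of at least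
  \<open>2 * pi * (\<epsilon> * pi)\<close> between successive passages. For this margin the
  comparison orbit has to contain the rotation of the frame exactly. Uniformity in \<mu> has two
  ends. As \<mu> tends to 0 the torque fades, but the factor \<mu> has been divided out. As \<mu>
  tends to 1 the mass at the collision fades; then \<nu>, the square of the length unit, tends to 0
  while \<epsilon> stays fixed. Hence \<nu> is treated as a parameter independent of \<epsilon>, and
  the bounds on the vector field hold down to \<open>\<nu> = 0\<close>.\<close>

lemma gronwall_bound:
  fixes y :: "real \<Rightarrow> 'a::banach"
  assumes ab: "a \<le> b" and L: "0 \<le> L" and c: "0 \<le> c"
    and der: "\<And>t. t \<in> {a..b} \<Longrightarrow> (y has_vector_derivative y' t) (at t within {a..b})"
    and bnd: "\<And>t. t \<in> {a..b} \<Longrightarrow> norm (y' t) \<le> L * norm (y t) + c"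
  shows "norm (y b) \<le> (norm (y a) + c * (b - a)) * exp (L * (b - a))"
proof -
  define g where "g t = L * norm (y t) + c" for t
  \<comment> \<open>The norm of \<open>y\<close> need not be differentiable, so the estimate is run
    on this integral majorant of it.\<close>
  define v where "v t = norm (y a) + integral {a..t} g" for t
  have conty: "continuous_on {a..b} y"
    by (rule continuous_on_vector_derivative) (rule der)
  have contg: "continuous_on {a..b} g"
    unfolding g_def by (intro continuous_intros conty)
  have yv: "norm (y t) \<le> v t" if t: "t \<in> {a..b}" for t
  proof -
    have "(y' has_integral (y t - y a)) {a..t}"
    proof (rule fundamental_theorem_of_calculus)
      fix x assume "x \<in> {a..t}"
      then show "(y has_vector_derivative y' x) (at x within {a..t})"
        using t by (intro has_vector_derivative_within_subset[OF der]) auto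
    qed (use t in auto)
    moreover have "g integrable_on {a..t}"
      using t by (intro integrable_continuous_real continuous_on_subset[OF contg]) auto
    ultimately have "norm (y t - y a) \<le> integral {a..t} g"
      using integral_norm_bound_integral[of y' "{a..t}" g] bnd t
      by (auto simp: g_def has_integral_integrable integral_unique)
    then show ?thesis
      unfolding v_def using norm_triangle_ineq2[of "y t" "y a"] by linarith
  qed
  have vder: "(v has_real_derivative g t) (at t within {a..b})" if "t \<in> {a..b}" for t
    unfolding v_def
    by (rule derivative_eq_intros integral_has_real_derivative contg that refl)+ simp
  \<comment> \<open>The exponential factor absorbs the linear growth, after which \<open>v\<close>
    can rise at rate at most \<open>c\<close>; subtracting \<open>c * (t - a)\<close> makes the
    function nonincreasing.\<close>
  define w where "w t = exp (- L * (t - a)) * v t - c * (t - a)" for t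
  have wder: "(w has_real_derivative exp (- L * (t - a)) * (g t - L * v t) - c) (at t within {a..b})"
    if "t \<in> {a..b}" for t
    unfolding w_def
    by (rule derivative_eq_intros vder that refl)+ (simp add: algebra_simps)
  have "w b \<le> w a"
  proof (rule DERIV_nonpos_imp_decreasing_open[OF ab])
    show "continuous_on {a..b} w"
      by (rule DERIV_continuous_on) (rule wder)
  next
    fix t assume t: "a < t" "t < b"
    have "at t within {a..b} = at t"
      using t by (simp add: at_within_Icc_at)
    moreover have "exp (- L * (t - a)) * (g t - L * v t) - c \<le> 0"
    proof -
      have "L * norm (y t) \<le> L * v t"
        using yv[of t] t L by (intro mult_left_mono) auto
      then have "exp (- L * (t - a)) * (g t - L * v t) \<le> exp (- L * (t - a)) * c"
        by (intro mult_left_mono) (auto simp: g_def)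
      also have "\<dots> \<le> 1 * c"
        using L t c by (intro mult_right_mono) (auto simp: mult_nonneg_nonneg)
      finally show ?thesis by simp
    qed
    ultimately show "\<exists>D. DERIV w t :> D \<and> D \<le> 0"
      using wder[of t] t by auto
  qed
  then have "exp (- L * (b - a)) * v b \<le> norm (y a) + c * (b - a)"
    by (simp add: w_def v_def)
  then have "exp (L * (b - a)) * (exp (- L * (b - a)) * v b)
      \<le> exp (L * (b - a)) * (norm (y a) + c * (b - a))"
    by (intro mult_left_mono) auto
  also have "exp (L * (b - a)) * (exp (- L * (b - a)) * v b) = v b"
    by (simp add: mult.assoc[symmetric] exp_add[symmetric])
  finally show ?thesis
    using yv[of b] ab by (simp add: mult.commute)
qed

text \<open>Picard iteration in a weighted norm: \<open>H\<close> is the Picard operator acting on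
  \<open>exp (- (2 * L * t)) *\<^sub>R y t\<close>. With this weight it contracts by
  \<open>1/2\<close> on the whole interval, whatever its length, so no continuation of local
  solutions is needed.\<close>

lemma lipschitz_ode_solution_exists:
  fixes F :: "'a::banach \<Rightarrow> 'a"
  assumes lip: "\<And>x y. norm (F x - F y) \<le> L * norm (x - y)" and T: "0 \<le> T" and L: "0 < L"
  shows "\<exists>y. y 0 = y0 \<and>
    (\<forall>t\<in>{0..T}. (y has_vector_derivative F (y t)) (at t within {0..T}))"
proof -
  have contF: "continuous_on X F" for X
    by (rule lipschitz_on_continuous_on[of L])
      (use lip L in \<open>auto intro!: lipschitz_onI simp: dist_norm\<close>)
  define H where "H g t = exp (- (2 * L * t)) *\<^sub>R
      (y0 + integral {0..t} (\<lambda>s. F (exp (2 * L * s) *\<^sub>R g s)))" for g :: "real \<Rightarrow> 'a" and t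
  \<comment> \<open>Clamping the time turns continuous functions on the interval into bounded
    continuous functions on the line, which form the complete space for the fixed point
    theorem.\<close>
  define cl where "cl t = max 0 (min T t)" for t :: real
  have cl: "cl t \<in> {0..T}" for t using T by (auto simp: cl_def)
  have contcl: "continuous_on X cl" for X
    unfolding cl_def by (intro continuous_intros)
  have contF': "continuous_on X (\<lambda>s. F (exp (2 * L * s) *\<^sub>R g s))"
    if "continuous_on X g" for g :: "real \<Rightarrow> 'a" and X
    by (rule continuous_on_compose2[OF contF[of UNIV]]) (intro continuous_intros that, simp)
  have contH: "continuous_on {0..T} (H g)" if "continuous_on {0..T} g" for g
    unfolding H_def
    by (intro continuous_intros indefinite_integral_continuous_1 integrable_continuous_real
        contF' that)
  define Q :: "(real \<Rightarrow>\<^sub>C 'a) \<Rightarrow> (real \<Rightarrow>\<^sub>C 'a)" where "Q g = Bcontfun (\<lambda>t. H g (cl t))" for g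
  have Qin: "(\<lambda>t. H (apply_bcontfun g) (cl t)) \<in> bcontfun" for g :: "real \<Rightarrow>\<^sub>C 'a"
  proof -
    have "continuous_on UNIV (\<lambda>t. H g (cl t))"
      by (rule continuous_on_compose2[OF contH contcl]) (use cl in auto)
    moreover have "bounded (range (\<lambda>t. H g (cl t)))"
    proof (rule bounded_subset)
      show "bounded (H g ` {0..T})"
        by (intro compact_imp_bounded compact_continuous_image contH) auto
      show "range (\<lambda>t. H g (cl t)) \<subseteq> H g ` {0..T}"
        using cl by auto
    qed
    ultimately show ?thesis by (simp add: bcontfun_def)
  qed
  have Qapp: "apply_bcontfun (Q g) t = H g (cl t)" for g t
    using Bcontfun_inverse[OF Qin[of g]] by (simp add: Q_def)
  have contr: "norm (H g t - H h t) \<le> 1/2 * dist g h" if t: "t \<in> {0..T}"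
    for g h :: "real \<Rightarrow>\<^sub>C 'a" and t
  proof -
    define Ig where "Ig = (\<lambda>s. F (exp (2 * L * s) *\<^sub>R g s))"
    define Ih where "Ih = (\<lambda>s. F (exp (2 * L * s) *\<^sub>R h s))"
    have int: "Ig integrable_on {0..t}" "Ih integrable_on {0..t}"
      unfolding Ig_def Ih_def by (intro integrable_continuous_real contF'; simp)+
    have e: "((\<lambda>s. L * exp (2 * L * s) * dist g h) has_integral
        (exp (2 * L * t) / 2 * dist g h - exp (2 * L * 0) / 2 * dist g h)) {0..t}"
    proof (rule fundamental_theorem_of_calculus)
      show "0 \<le> t" using t by simp
      fix x
      show "((\<lambda>a. exp (2 * L * a) / 2 * dist g h) has_vector_derivative
          L * exp (2 * L * x) * dist g h) (at x within {0..t})"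
        unfolding has_real_derivative_iff_has_vector_derivative[symmetric]
        by (auto intro!: derivative_eq_intros)
    qed
    have "norm (Ig s - Ih s) \<le> L * exp (2 * L * s) * dist g h" for s
    proof -
      have "norm (Ig s - Ih s) \<le> L * norm (exp (2 * L * s) *\<^sub>R (g s - h s))"
        unfolding Ig_def Ih_def scaleR_diff_right by (rule lip)
      also have "\<dots> = L * exp (2 * L * s) * dist (g s) (h s)"
        by (simp add: dist_norm)
      also have "\<dots> \<le> L * exp (2 * L * s) * dist g h"
        using L by (intro mult_left_mono dist_bounded) auto
      finally show ?thesis .
    qed
    then have "norm (integral {0..t} (\<lambda>s. Ig s - Ih s))
        \<le> integral {0..t} (\<lambda>s. L * exp (2 * L * s) * dist g h)"
      using int e by (intro integral_norm_bound_integral integrable_diff) auto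
    also have "\<dots> = (exp (2 * L * t) - 1) / 2 * dist g h"
      using integral_unique[OF e] by (simp add: algebra_simps)
    also have "\<dots> \<le> exp (2 * L * t) / 2 * dist g h"
      by (intro mult_right_mono) auto
    finally have le: "norm (integral {0..t} (\<lambda>s. Ig s - Ih s)) \<le> exp (2 * L * t) / 2 * dist g h" .
    have "H g t - H h t = exp (- (2 * L * t)) *\<^sub>R integral {0..t} (\<lambda>s. Ig s - Ih s)"
      using int by (simp add: H_def Ig_def Ih_def scaleR_diff_right[symmetric] integral_diff)
    then have "norm (H g t - H h t) \<le> exp (- (2 * L * t)) * (exp (2 * L * t) / 2 * dist g h)"
      using mult_left_mono[OF le, of "exp (- (2 * L * t))"] by simp
    also have "\<dots> = 1/2 * dist g h"
      by (simp add: exp_minus field_simps)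
    finally show ?thesis .
  qed
  have "\<exists>!g. Q g = g"
  proof (rule banach_fix_type[of "1/2"])
    have "dist (apply_bcontfun (Q g) t) (apply_bcontfun (Q h) t) \<le> 1/2 * dist g h" for g h t
      unfolding Qapp dist_norm[of "H _ _"] by (rule contr[OF cl])
    then show "\<forall>g h. dist (Q g) (Q h) \<le> 1/2 * dist g h"
      by (intro allI dist_bound)
  qed auto
  then obtain g where g: "Q g = g" by auto
  define y where "y t = exp (2 * L * t) *\<^sub>R g t" for t
  have y: "y t = y0 + integral {0..t} (\<lambda>s. F (y s))" if "t \<in> {0..T}" for t
  proof -
    have "cl t = t" using that by (auto simp: cl_def)
    then have "g t = H g t" using Qapp[of g t] g by simp
    then show ?thesis
      unfolding y_def H_def by (simp add: exp_add[symmetric])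
  qed
  have conty: "continuous_on {0..T} (\<lambda>s. F (y s))"
    unfolding y_def by (intro contF') simp
  have "(y has_vector_derivative F (y t)) (at t within {0..T})" if t: "t \<in> {0..T}" for t
  proof (rule has_vector_derivative_transform[OF t])
    show "((\<lambda>t. y0 + integral {0..t} (\<lambda>s. F (y s))) has_vector_derivative F (y t)) (at t within {0..T})"
      using integral_has_vector_derivative[OF conty t]
      by (auto intro!: derivative_eq_intros)
  qed (use y in auto)
  moreover have "y 0 = y0" using y[of 0] T by simp
  ultimately show ?thesis by blast
qed

text \<open>The field is cut off by the nearest-point projection, which is \<open>1\<close>-Lipschitz.\<close>

lemma cutoff_ode_solution_exists:
  fixes F :: "'a::euclidean_space \<Rightarrow> 'a"
  assumes lip: "\<And>x y. x \<in> cball 0 R \<Longrightarrow> y \<in> cball 0 R \<Longrightarrow> norm (F x - F y) \<le> L * norm (x - y)"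
    and T: "0 \<le> T" and L: "0 < L" and R: "0 \<le> R"
  defines "P \<equiv> closest_point (cball 0 R)"
  shows "\<exists>y. y 0 = y0 \<and>
    (\<forall>t\<in>{0..T}. (y has_vector_derivative F (P (y t))) (at t within {0..T}))"
    and "\<And>x y. norm (F (P x) - F (P y)) \<le> L * norm (x - y)"
    and "\<And>x. x \<in> cball 0 R \<Longrightarrow> P x = x"
proof -
  have cb: "closed (cball (0::'a) R)" "convex (cball (0::'a) R)" "cball (0::'a) R \<noteq> {}"
    using R by auto
  show lipP: "norm (F (P x) - F (P y)) \<le> L * norm (x - y)" for x y
  proof -
    have "norm (F (P x) - F (P y)) \<le> L * norm (P x - P y)"
      unfolding P_def by (intro lip closest_point_in_set cb)
    also have "\<dots> \<le> L * norm (x - y)"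
      using closest_point_lipschitz[OF cb(2,1,3), of x y] L
      by (intro mult_left_mono) (auto simp: P_def dist_norm)
    finally show ?thesis .
  qed
  show "\<exists>y. y 0 = y0 \<and>
      (\<forall>t\<in>{0..T}. (y has_vector_derivative F (P (y t))) (at t within {0..T}))"
    using lipschitz_ode_solution_exists[of "\<lambda>x. F (P x)" L T y0] lipP T L by blast
  show "\<And>x. x \<in> cball 0 R \<Longrightarrow> P x = x"
    unfolding P_def by (simp add: closest_point_self)
qed

section \<open>Families of functions that are uniformly bounded and Lipschitz\<close>

text \<open>One constant serves all indices, which is how uniformity in the parameters is carried
  through the estimates. Boundedness is required along with the Lipschitz property so that the
  notion is closed under products.\<close>

definition ublip :: "'i set \<Rightarrow> 'a::real_normed_vector set \<Rightarrow> ('i \<Rightarrow> 'a \<Rightarrow> 'b::real_normed_vector) \<Rightarrow> bool" where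
  "ublip I S F \<longleftrightarrow> (\<exists>B>0. \<forall>i\<in>I. \<forall>x\<in>S. norm (F i x) \<le> B \<and>
     (\<forall>y\<in>S. norm (F i x - F i y) \<le> B * norm (x - y)))"

lemma ublipI:
  assumes "\<And>i x. i \<in> I \<Longrightarrow> x \<in> S \<Longrightarrow> norm (F i x) \<le> B"
    and "\<And>i x y. i \<in> I \<Longrightarrow> x \<in> S \<Longrightarrow> y \<in> S \<Longrightarrow> norm (F i x - F i y) \<le> L * norm (x - y)"
  shows "ublip I S F"
  unfolding ublip_def
proof (intro exI[of _ "max 1 (max B L)"] conjI ballI)
  fix i x y assume *: "i \<in> I" "x \<in> S" "y \<in> S"
  have "L * norm (x - y) \<le> max 1 (max B L) * norm (x - y)"
    by (intro mult_right_mono) auto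
  then show "norm (F i x - F i y) \<le> max 1 (max B L) * norm (x - y)"
    using assms(2)[OF *] by linarith
qed (use assms(1) in force)+

lemma ublipE:
  assumes "ublip I S F"
  obtains B where "B > 0" "\<And>i x. i \<in> I \<Longrightarrow> x \<in> S \<Longrightarrow> norm (F i x) \<le> B"
    "\<And>i x y. i \<in> I \<Longrightarrow> x \<in> S \<Longrightarrow> y \<in> S \<Longrightarrow> norm (F i x - F i y) \<le> B * norm (x - y)"
  using assms unfolding ublip_def by blast

lemma ublip_param: "(\<And>i. i \<in> I \<Longrightarrow> norm (c i) \<le> B) \<Longrightarrow> ublip I S (\<lambda>i x. c i)"
  by (rule ublipI[of _ _ _ B 0]) auto

lemma ublip_const: "ublip I S (\<lambda>i x. c)"
  by (rule ublip_param) auto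

lemma ublip_linear:
  assumes "bounded_linear f" "bounded S"
  shows "ublip I S (\<lambda>i x. f x)"
proof -
  obtain K where K: "K > 0" "\<And>x. norm (f x) \<le> norm x * K"
    using bounded_linear.pos_bounded[OF assms(1)] by blast
  obtain D where D: "\<And>x. x \<in> S \<Longrightarrow> norm x \<le> D"
    using assms(2) by (auto simp: bounded_iff)
  show ?thesis
  proof (rule ublipI)
    fix x y assume "x \<in> S"
    show "norm (f x) \<le> D * K"
      using K(2)[of x] D[OF \<open>x \<in> S\<close>] K(1) by (meson mult_right_mono less_imp_le order_trans)
    show "norm (f x - f y) \<le> K * norm (x - y)"
      using K(2)[of "x - y"] linear_diff[OF bounded_linear.linear[OF assms(1)], of x y] by (simp add: mult.commute)
  qed
qed

lemma ublip_add:
  assumes "ublip I S F" "ublip I S G"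
  shows "ublip I S (\<lambda>i x. F i x + G i x)"
proof -
  obtain B where B: "\<And>i x. i \<in> I \<Longrightarrow> x \<in> S \<Longrightarrow> norm (F i x) \<le> B"
    "\<And>i x y. i \<in> I \<Longrightarrow> x \<in> S \<Longrightarrow> y \<in> S \<Longrightarrow> norm (F i x - F i y) \<le> B * norm (x - y)"
    using assms(1) by (rule ublipE) blast
  obtain C where C: "\<And>i x. i \<in> I \<Longrightarrow> x \<in> S \<Longrightarrow> norm (G i x) \<le> C"
    "\<And>i x y. i \<in> I \<Longrightarrow> x \<in> S \<Longrightarrow> y \<in> S \<Longrightarrow> norm (G i x - G i y) \<le> C * norm (x - y)"
    using assms(2) by (rule ublipE) blast
  show ?thesis
  proof (rule ublipI)
    fix i x y assume *: "i \<in> I" "x \<in> S"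
    show "norm (F i x + G i x) \<le> B + C"
      using B(1)[OF *] C(1)[OF *] norm_triangle_ineq[of "F i x" "G i x"] by linarith
    assume y: "y \<in> S"
    have "norm (F i x + G i x - (F i y + G i y)) \<le> norm (F i x - F i y) + norm (G i x - G i y)"
      by (metis add_diff_add norm_triangle_ineq)
    then show "norm (F i x + G i x - (F i y + G i y)) \<le> (B + C) * norm (x - y)"
      using B(2)[OF * y] C(2)[OF * y] by (simp add: distrib_right)
  qed
qed

lemma ublip_mult:
  fixes F G :: "'i \<Rightarrow> 'a::real_normed_vector \<Rightarrow> 'b::real_normed_algebra"
  assumes "ublip I S F" "ublip I S G"
  shows "ublip I S (\<lambda>i x. F i x * G i x)"
proof -
  obtain B where B0: "B > 0" and B: "\<And>i x. i \<in> I \<Longrightarrow> x \<in> S \<Longrightarrow> norm (F i x) \<le> B"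
    "\<And>i x y. i \<in> I \<Longrightarrow> x \<in> S \<Longrightarrow> y \<in> S \<Longrightarrow> norm (F i x - F i y) \<le> B * norm (x - y)"
    using assms(1) by (rule ublipE) blast
  obtain C where C0: "C > 0" and C: "\<And>i x. i \<in> I \<Longrightarrow> x \<in> S \<Longrightarrow> norm (G i x) \<le> C"
    "\<And>i x y. i \<in> I \<Longrightarrow> x \<in> S \<Longrightarrow> y \<in> S \<Longrightarrow> norm (G i x - G i y) \<le> C * norm (x - y)"
    using assms(2) by (rule ublipE) blast
  show ?thesis
  proof (rule ublipI)
    fix i x y assume *: "i \<in> I" "x \<in> S"
    show "norm (F i x * G i x) \<le> B * C"
      using B(1)[OF *] C(1)[OF *] norm_mult_ineq[of "F i x" "G i x"] B0 C0
      by (meson mult_mono norm_ge_zero less_imp_le order_trans)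
    assume y: "y \<in> S"
    have "F i x * G i x - F i y * G i y = F i x * (G i x - G i y) + (F i x - F i y) * G i y"
      by (simp add: algebra_simps)
    then have "norm (F i x * G i x - F i y * G i y)
        \<le> norm (F i x) * norm (G i x - G i y) + norm (F i x - F i y) * norm (G i y)"
      by (metis norm_triangle_mono norm_mult_ineq)
    also have "\<dots> \<le> B * (C * norm (x - y)) + B * norm (x - y) * C"
      using B(1)[OF *] C(1)[OF *(1) y] B(2)[OF * y] C(2)[OF * y] B0 C0
      by (intro add_mono mult_mono) auto
    finally show "norm (F i x * G i x - F i y * G i y) \<le> (2 * B * C) * norm (x - y)"
      by (simp add: algebra_simps)
  qed
qed

lemma ublip_minus: "ublip I S F \<Longrightarrow> ublip I S (\<lambda>i x. - F i x)"
  by (auto simp: ublip_def norm_minus_commute minus_diff_commute)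

lemma ublip_diff: "ublip I S F \<Longrightarrow> ublip I S G \<Longrightarrow> ublip I S (\<lambda>i x. F i x - G i x)"
  using ublip_add[of I S F "\<lambda>i x. - G i x"] ublip_minus[of I S G] by simp

lemma ublip_power:
  fixes F :: "'i \<Rightarrow> 'a::real_normed_vector \<Rightarrow> 'b::real_normed_algebra_1"
  shows "ublip I S F \<Longrightarrow> ublip I S (\<lambda>i x. F i x ^ k)"
  by (induction k) (auto intro: ublip_const ublip_mult)

lemma ublip_inverse:
  fixes F :: "'i \<Rightarrow> 'a::real_normed_vector \<Rightarrow> 'b::real_normed_field"
  assumes "ublip I S F" and d: "0 < d" "\<And>i x. i \<in> I \<Longrightarrow> x \<in> S \<Longrightarrow> d \<le> norm (F i x)"
  shows "ublip I S (\<lambda>i x. inverse (F i x))"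
proof -
  obtain B where B0: "B > 0"
    and B: "\<And>i x y. i \<in> I \<Longrightarrow> x \<in> S \<Longrightarrow> y \<in> S \<Longrightarrow> norm (F i x - F i y) \<le> B * norm (x - y)"
    using assms(1) by (rule ublipE) blast
  have inv: "norm (inverse (F i x)) \<le> inverse d" if "i \<in> I" "x \<in> S" for i x
    using d(1) d(2)[OF that] by (simp add: norm_inverse le_imp_inverse_le)
  show ?thesis
  proof (rule ublipI)
    fix i x y assume *: "i \<in> I" "x \<in> S" and y: "y \<in> S"
    have nz: "F i x \<noteq> 0" "F i y \<noteq> 0"
      using d(1) d(2)[OF *] d(2)[OF *(1) y] by auto
    have "norm (inverse (F i x) - inverse (F i y))
        = norm (inverse (F i x)) * norm (F i x - F i y) * norm (inverse (F i y))"
      using inverse_diff_inverse[OF nz] by (simp add: norm_mult)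
    also have "\<dots> \<le> inverse d * (B * norm (x - y)) * inverse d"
      using inv[OF *] inv[OF *(1) y] B[OF * y] d(1) B0 by (intro mult_mono) auto
    finally show "norm (inverse (F i x) - inverse (F i y)) \<le> inverse d * B * inverse d * norm (x - y)"
      by (simp add: algebra_simps)
  qed (use inv in auto)
qed

lemma ublip_norm:
  assumes "ublip I S F"
  shows "ublip I S (\<lambda>i x. norm (F i x))"
proof -
  obtain B where B: "\<And>i x. i \<in> I \<Longrightarrow> x \<in> S \<Longrightarrow> norm (F i x) \<le> B"
    "\<And>i x y. i \<in> I \<Longrightarrow> x \<in> S \<Longrightarrow> y \<in> S \<Longrightarrow> norm (F i x - F i y) \<le> B * norm (x - y)"
    using assms(1) by (rule ublipE) blast
  show ?thesis
  proof (rule ublipI)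
    fix i x y assume *: "i \<in> I" "x \<in> S"
    show "norm (norm (F i x)) \<le> B" using B(1)[OF *] by simp
    assume y: "y \<in> S"
    show "norm (norm (F i x) - norm (F i y)) \<le> B * norm (x - y)"
      using B(2)[OF * y] norm_triangle_ineq3[of "F i x" "F i y"] by simp
  qed
qed

lemma ublip_bounded_linear:
  assumes "bounded_linear f" "ublip I S F"
  shows "ublip I S (\<lambda>i x. f (F i x))"
proof -
  obtain K where K: "K > 0" "\<And>x. norm (f x) \<le> norm x * K"
    using bounded_linear.pos_bounded[OF assms(1)] by blast
  obtain B where B: "\<And>i x. i \<in> I \<Longrightarrow> x \<in> S \<Longrightarrow> norm (F i x) \<le> B"
    "\<And>i x y. i \<in> I \<Longrightarrow> x \<in> S \<Longrightarrow> y \<in> S \<Longrightarrow> norm (F i x - F i y) \<le> B * norm (x - y)"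
    using assms(2) by (rule ublipE) blast
  show ?thesis
  proof (rule ublipI)
    fix i x y assume *: "i \<in> I" "x \<in> S"
    show "norm (f (F i x)) \<le> B * K"
      using K(2)[of "F i x"] B(1)[OF *] K(1) by (meson mult_right_mono less_imp_le order_trans)
    assume y: "y \<in> S"
    have "norm (f (F i x) - f (F i y)) \<le> norm (F i x - F i y) * K"
      using K(2)[of "F i x - F i y"] linear_diff[OF bounded_linear.linear[OF assms(1)]] by simp
    also have "\<dots> \<le> B * norm (x - y) * K"
      using B(2)[OF * y] K(1) by (intro mult_right_mono) auto
    finally show "norm (f (F i x) - f (F i y)) \<le> B * K * norm (x - y)"
      by (simp add: algebra_simps)
  qed
qed

lemma ublip_pair:
  assumes "ublip I S F" "ublip I S G"
  shows "ublip I S (\<lambda>i x. (F i x, G i x))"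
proof -
  have "ublip I S (\<lambda>i x. (F i x, 0) + (0, G i x))"
    by (intro ublip_add ublip_bounded_linear[OF _ assms(1), of "\<lambda>x. (x, 0)"]
        ublip_bounded_linear[OF _ assms(2), of "\<lambda>x. (0, x)"] bounded_linear_Pair
        bounded_linear_ident bounded_linear_zero)
  then show ?thesis by simp
qed

lemma ublip_comp:
  assumes "ublip I S F" "\<And>x. x \<in> S' \<Longrightarrow> h x \<in> S" and h: "\<And>x y. norm (h x - h y) \<le> norm (x - y)"
  shows "ublip I S' (\<lambda>i x. F i (h x))"
proof -
  obtain B where B0: "B > 0" and B: "\<And>i x. i \<in> I \<Longrightarrow> x \<in> S \<Longrightarrow> norm (F i x) \<le> B"
    "\<And>i x y. i \<in> I \<Longrightarrow> x \<in> S \<Longrightarrow> y \<in> S \<Longrightarrow> norm (F i x - F i y) \<le> B * norm (x - y)"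
    using assms(1) by (rule ublipE) blast
  show ?thesis
  proof (rule ublipI)
    fix i x y assume *: "i \<in> I" "x \<in> S'" "y \<in> S'"
    show "norm (F i (h x)) \<le> B" using B(1) assms(2) * by blast
    have "norm (F i (h x) - F i (h y)) \<le> B * norm (h x - h y)"
      using B(2) assms(2) * by blast
    also have "\<dots> \<le> B * norm (x - y)"
      using h B0 by (intro mult_left_mono) auto
    finally show "norm (F i (h x) - F i (h y)) \<le> B * norm (x - y)" .
  qed
qed

section \<open>The scaled force of the second primary and its uniform bounds\<close>

text \<open>The distance to the second primary: relative to the first one the particle is at
  \<open>\<nu> * z\<^sup>2\<close> and the second primary at \<open>-1\<close>.\<close>

definition qf :: "real \<Rightarrow> complex \<Rightarrow> real" where
  "qf \<nu> z = cmod (1 + of_real \<nu> * z\<^sup>2)"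

text \<open>\<open>gf\<close> and \<open>kf\<close> are \<open>(1 - 1 / q ^ 3) / \<nu>\<close> and \<open>(1 / q - 1 + \<nu> * Re (z\<^sup>2)) / \<nu>\<^sup>2\<close>,
  written so that they stay bounded as \<open>\<nu>\<close> tends to \<open>0\<close>.\<close>

definition gf :: "real \<Rightarrow> complex \<Rightarrow> real" where
  "gf \<nu> z = (2 * Re (z\<^sup>2) + \<nu> * cmod z ^ 4) * ((qf \<nu> z)\<^sup>2 + qf \<nu> z + 1)
     * inverse (qf \<nu> z + 1) * inverse (qf \<nu> z) ^ 3"

definition kf :: "real \<Rightarrow> complex \<Rightarrow> real" where
  "kf \<nu> z = (Re (z\<^sup>2) * (2 * Re (z\<^sup>2) + \<nu> * cmod z ^ 4) * (qf \<nu> z + 2) * inverse (qf \<nu> z + 1)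
     - cmod z ^ 4) * inverse (qf \<nu> z) * inverse (qf \<nu> z + 1)"

text \<open>\<open>Gf\<close> is the gradient of the perturbing potential \<open>Phi\<close> defined below.\<close>

definition Gf :: "real \<Rightarrow> real \<Rightarrow> complex \<Rightarrow> complex" where
  "Gf \<mu> \<nu> z = of_real (12 * cmod z ^ 4) * z
     + of_real (8 * \<mu>) * (of_real (kf \<nu> z - cmod z ^ 4 * inverse (qf \<nu> z) ^ 3) * z
        + of_real ((cmod z)\<^sup>2 * gf \<nu> z) * cnj z)"

text \<open>The part of \<open>Gf\<close> along \<open>z\<close> is central; only the part along
  \<open>cnj z\<close> exerts a torque, and this is its torque per unit of \<mu>. To leading order
  it is the quadrupole tidal torque.\<close>

definition torque :: "real \<Rightarrow> complex \<Rightarrow> real" where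
  "torque \<nu> z = - 8 * (cmod z)\<^sup>2 * Im (z\<^sup>2) * gf \<nu> z"

text \<open>Triples \<open>(\<epsilon>, \<nu>, \<mu>)\<close>. The bound \<open>1/100\<close> makes
  \<open>\<nu> * z\<^sup>2\<close> at most \<open>9/100\<close> on the ball of radius 3, which keeps
  the particle away from the second primary; including 0 keeps the constants from degenerating for
  small \<nu>.\<close>

definition params :: "(real \<times> real \<times> real) set" where
  "params = {0..1} \<times> {0..1/100} \<times> {0..1}"

lemma qf_sq: "(qf \<nu> z)\<^sup>2 = 1 + \<nu> * (2 * Re (z\<^sup>2) + \<nu> * cmod z ^ 4)"
proof -
  have "cmod z ^ 4 = (Re (z\<^sup>2))\<^sup>2 + (Im (z\<^sup>2))\<^sup>2"
    using cmod_power2[of "z\<^sup>2"] by (simp add: norm_power power_mult[symmetric])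
  then show ?thesis
    unfolding qf_def cmod_power2 by (simp add: power2_eq_square algebra_simps)
qed

lemma qf_ge:
  assumes "0 \<le> \<nu>" "\<nu> \<le> 1/100" "cmod z \<le> 3"
  shows "9/10 \<le> qf \<nu> z"
proof -
  have "cmod (of_real \<nu> * z\<^sup>2) \<le> 1/100 * 3\<^sup>2"
    unfolding norm_mult norm_power using assms by (intro mult_mono power_mono) auto
  moreover have "1 - cmod (of_real \<nu> * z\<^sup>2) \<le> qf \<nu> z"
    unfolding qf_def using norm_triangle_ineq2[of 1 "- (of_real \<nu> * z\<^sup>2)"] by simp
  ultimately show ?thesis by simp
qed

text \<open>Difference of squares applied to \<open>qf_sq\<close>. It supplies the factor \<nu> in
  the expansions of \<open>gf\<close>, \<open>kf\<close> and the powers of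
  \<open>qf\<close>.\<close>

lemma qf_minus_1:
  assumes "0 \<le> \<nu>" "\<nu> \<le> 1/100" "cmod z \<le> 3"
  shows "qf \<nu> z - 1 = \<nu> * ((2 * Re (z\<^sup>2) + \<nu> * cmod z ^ 4) * inverse (qf \<nu> z + 1))"
proof -
  have "(qf \<nu> z - 1) * (qf \<nu> z + 1) = \<nu> * (2 * Re (z\<^sup>2) + \<nu> * cmod z ^ 4)"
    using qf_sq[of \<nu> z] by (simp add: power2_eq_square algebra_simps)
  moreover have "qf \<nu> z + 1 \<noteq> 0" using qf_ge[OF assms] by simp
  ultimately show ?thesis by (simp add: field_simps)
qed

lemma gf_eq:
  assumes "0 < \<nu>" "\<nu> \<le> 1/100" "cmod z \<le> 3"
  shows "gf \<nu> z = (1 - inverse (qf \<nu> z) ^ 3) / \<nu>"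
proof -
  define q where "q = qf \<nu> z"
  define e where "e = 2 * Re (z\<^sup>2) + \<nu> * cmod z ^ 4"
  have q: "q \<noteq> 0" "q + 1 \<noteq> 0" using qf_ge[of \<nu> z] assms by (auto simp: q_def)
  have "q - 1 = \<nu> * (e * inverse (q + 1))"
    using qf_minus_1[of \<nu> z] assms by (simp add: q_def e_def)
  then have e: "e = (q - 1) * (q + 1) / \<nu>" using q assms by (simp add: field_simps)
  have "gf \<nu> z = e * (q\<^sup>2 + q + 1) * inverse (q + 1) * inverse q ^ 3"
    by (simp add: gf_def q_def e_def)
  also have "\<dots> = (1 - inverse q ^ 3) / \<nu>"
    unfolding e using q assms by (simp add: divide_simps) (simp add: algebra_simps power2_eq_square power3_eq_cube)
  finally show ?thesis by (simp add: q_def)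
qed

lemma kf_eq:
  assumes "0 < \<nu>" "\<nu> \<le> 1/100" "cmod z \<le> 3"
  shows "kf \<nu> z = (inverse (qf \<nu> z) - 1 + \<nu> * Re (z\<^sup>2)) / \<nu>\<^sup>2"
proof -
  define q where "q = qf \<nu> z"
  define x where "x = Re (z\<^sup>2)"
  define r where "r = cmod z ^ 4"
  have q: "q \<noteq> 0" "q + 1 \<noteq> 0" using qf_ge[of \<nu> z] assms by (auto simp: q_def)
  have "q - 1 = \<nu> * ((2 * x + \<nu> * r) * inverse (q + 1))"
    using qf_minus_1[of \<nu> z] assms by (simp add: q_def x_def r_def)
  then have e: "2 * x + \<nu> * r = (q - 1) * (q + 1) / \<nu>" using q assms by (simp add: field_simps)
  then have r: "r = ((q - 1) * (q + 1) / \<nu> - 2 * x) / \<nu>" using assms by (simp add: field_simps)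
  have "kf \<nu> z = (x * (2 * x + \<nu> * r) * (q + 2) * inverse (q + 1) - r) * inverse q * inverse (q + 1)"
    by (simp add: kf_def q_def x_def r_def)
  also have "\<dots> = (inverse q - 1 + \<nu> * x) / \<nu>\<^sup>2"
    unfolding e unfolding r using q assms
    by (simp add: divide_simps) (simp add: algebra_simps power2_eq_square power3_eq_cube)
  finally show ?thesis by (simp add: q_def x_def)
qed

abbreviation (input) "ublip3 F \<equiv> ublip params (cball 0 3) (\<lambda>i z. F (fst (snd i)) z)"

lemma ublip_id: "ublip I (cball (0::complex) 3) (\<lambda>i z. z)"
  by (rule ublip_linear) (auto intro: bounded_linear_ident)

lemma ublip_Re: "ublip I S F \<Longrightarrow> ublip I S (\<lambda>i z. Re (F i z))"
  by (rule ublip_bounded_linear) (rule bounded_linear_Re)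

lemma ublip_Im: "ublip I S F \<Longrightarrow> ublip I S (\<lambda>i z. Im (F i z))"
  by (rule ublip_bounded_linear) (rule bounded_linear_Im)

lemma ublip_cnj: "ublip I S F \<Longrightarrow> ublip I S (\<lambda>i z. cnj (F i z))"
  by (rule ublip_bounded_linear) (rule bounded_linear_cnj)

lemma ublip_of_real:
  "ublip I S F \<Longrightarrow> ublip I S (\<lambda>i z. of_real (F i z) :: complex)"
  by (rule ublip_bounded_linear) (rule bounded_linear_of_real)

lemma ublip_params:
  "ublip params S (\<lambda>i z. fst i)" "ublip params S (\<lambda>i z. fst (snd i))"
  "ublip params S (\<lambda>i z. snd (snd i))"
  by (rule ublip_param[of _ _ 1]; auto simp: params_def)+

lemmas ublip_intros = ublip_params ublip_of_real ublip_cnj ublip_Im ublip_Re ublip_id ublip_norm ublip_power ublip_mult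
  ublip_add ublip_diff ublip_minus ublip_const

lemma ublip_qf: "ublip3 qf"
  unfolding qf_def by (intro ublip_intros)

lemma ublip_inverse_qf: "ublip3 (\<lambda>\<nu> z. inverse (qf \<nu> z))"
  by (rule ublip_inverse[OF ublip_qf, of "9/10"]) (use qf_ge in \<open>fastforce simp: params_def\<close>)+

lemma ublip_inverse_qf_1: "ublip3 (\<lambda>\<nu> z. inverse (qf \<nu> z + 1))"
  by (rule ublip_inverse[of _ _ _ 1]) (use ublip_qf in \<open>auto intro!: ublip_intros simp: qf_def\<close>)

lemma ublip_gf: "ublip3 gf"
  unfolding gf_def by (intro ublip_intros ublip_qf ublip_inverse_qf ublip_inverse_qf_1)

lemma ublip_kf: "ublip3 kf"
  unfolding kf_def by (intro ublip_intros ublip_qf ublip_inverse_qf ublip_inverse_qf_1)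

lemma ublip_Gf: "ublip params (cball 0 3) (\<lambda>i z. Gf (snd (snd i)) (fst (snd i)) z)"
  unfolding Gf_def by (intro ublip_intros ublip_qf ublip_inverse_qf ublip_inverse_qf_1 ublip_gf ublip_kf)

lemma ublip_torque: "ublip3 torque"
  unfolding torque_def by (intro ublip_intros ublip_gf)

lemma gf_approx:
  "\<exists>C>0. \<forall>\<nu>\<in>{0..1/100}. \<forall>z\<in>cball 0 3. \<bar>gf \<nu> z - 3 * Re (z\<^sup>2)\<bar> \<le> C * \<nu>"
proof -
  \<comment> \<open>The remainder is exact, not a Taylor estimate. The factor
    \<open>(q\<^sup>2 + q + 1) / ((q + 1) * q ^ 3)\<close> equals \<open>3 / 2\<close> at
    \<open>q = 1\<close>; its deviation from there is \<open>- (q - 1) * (3 * q ^ 3 + 6 * q\<^sup>2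
    + 4 * q + 2) / (2 * (q + 1) * q ^ 3)\<close>, and \<open>qf_minus_1\<close> turns
    \<open>q - 1\<close> into a multiple of \<nu>.\<close>
  define R where "R \<nu> z = - (Re (z\<^sup>2) * (3 * qf \<nu> z ^ 3 + 6 * (qf \<nu> z)\<^sup>2 + 4 * qf \<nu> z + 2)
      * (2 * Re (z\<^sup>2) + \<nu> * cmod z ^ 4) * inverse (qf \<nu> z + 1) ^ 2 * inverse (qf \<nu> z) ^ 3)
     + cmod z ^ 4 * ((qf \<nu> z)\<^sup>2 + qf \<nu> z + 1) * inverse (qf \<nu> z + 1) * inverse (qf \<nu> z) ^ 3" for \<nu> z
  have "ublip3 R" unfolding R_def by (intro ublip_intros ublip_qf ublip_inverse_qf ublip_inverse_qf_1)
  then obtain C where C: "C > 0" "\<And>i x. i \<in> params \<Longrightarrow> x \<in> cball 0 3 \<Longrightarrow> norm (R (fst (snd i)) x) \<le> C"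
    by (rule ublipE) blast
  have "\<bar>gf \<nu> z - 3 * Re (z\<^sup>2)\<bar> \<le> C * \<nu>" if \<nu>: "\<nu> \<in> {0..1/100}" and z: "z \<in> cball 0 3" for \<nu> z
  proof -
    have "gf \<nu> z - 3 * Re (z\<^sup>2) = \<nu> * R \<nu> z"
    proof (cases "\<nu> = 0")
      case True
      then show ?thesis by (simp add: gf_def qf_def)
    next
      case False
      define q where "q = qf \<nu> z"
      define x where "x = Re (z\<^sup>2)"
      define r where "r = cmod z ^ 4"
      have q: "q \<noteq> 0" "q + 1 \<noteq> 0" using qf_ge[of \<nu> z] \<nu> z by (auto simp: q_def)
      have "q - 1 = \<nu> * ((2 * x + \<nu> * r) * inverse (q + 1))"
        using qf_minus_1[of \<nu> z] \<nu> z by (simp add: q_def x_def r_def)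
      then have e: "2 * x + \<nu> * r = (q - 1) * (q + 1) / \<nu>" using q False by (simp add: field_simps)
      then have r: "r = ((q - 1) * (q + 1) / \<nu> - 2 * x) / \<nu>" using False by (simp add: field_simps)
      have "(2 * x + \<nu> * r) * (q\<^sup>2 + q + 1) * inverse (q + 1) * inverse q ^ 3 - 3 * x
        = \<nu> * (- (x * (3 * q ^ 3 + 6 * q\<^sup>2 + 4 * q + 2) * (2 * x + \<nu> * r)
              * inverse (q + 1) ^ 2 * inverse q ^ 3)
           + r * (q\<^sup>2 + q + 1) * inverse (q + 1) * inverse q ^ 3)"
        unfolding e unfolding r using q False
        by (simp add: divide_simps) (simp add: algebra_simps power2_eq_square power3_eq_cube)
      then show ?thesis by (simp add: gf_def R_def q_def x_def r_def)
    qed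
    moreover have "\<bar>R \<nu> z\<bar> \<le> C"
      using C(2)[of "(0, \<nu>, 0)" z] \<nu> z by (auto simp: params_def)
    ultimately show ?thesis
      using \<nu> by (simp add: abs_mult) (metis mult.commute mult_right_mono)
  qed
  then show ?thesis using C(1) by blast
qed

text \<open>The fifth power appears when the torque is differentiated along a rotation. The
  difference is \<open>1 - q\<close> times a geometric sum over \<open>q ^ 5\<close>.\<close>

lemma inverse_qf5_approx:
  "\<exists>C>0. \<forall>\<nu>\<in>{0..1/100}. \<forall>z\<in>cball 0 3. \<bar>inverse (qf \<nu> z) ^ 5 - 1\<bar> \<le> C * \<nu>"
proof -
  define R where "R \<nu> z = - ((2 * Re (z\<^sup>2) + \<nu> * cmod z ^ 4) * inverse (qf \<nu> z + 1)
     * (1 + qf \<nu> z + qf \<nu> z ^ 2 + qf \<nu> z ^ 3 + qf \<nu> z ^ 4) * inverse (qf \<nu> z) ^ 5)" for \<nu> z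
  have "ublip3 R" unfolding R_def by (intro ublip_intros ublip_qf ublip_inverse_qf ublip_inverse_qf_1)
  then obtain C where C: "C > 0" "\<And>i x. i \<in> params \<Longrightarrow> x \<in> cball 0 3 \<Longrightarrow> norm (R (fst (snd i)) x) \<le> C"
    by (rule ublipE) blast
  have "\<bar>inverse (qf \<nu> z) ^ 5 - 1\<bar> \<le> C * \<nu>" if \<nu>: "\<nu> \<in> {0..1/100}" and z: "z \<in> cball 0 3" for \<nu> z
  proof -
    define q where "q = qf \<nu> z"
    have q: "q \<noteq> 0" using qf_ge[of \<nu> z] \<nu> z by (auto simp: q_def)
    have "\<nu> * R \<nu> z = - (q - 1) * (1 + q + q ^ 2 + q ^ 3 + q ^ 4) * inverse q ^ 5"
      using qf_minus_1[of \<nu> z] \<nu> z by (simp add: R_def q_def)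
    also have "\<dots> = inverse q ^ 5 - 1"
      using q by (simp add: divide_simps) (simp add: algebra_simps power2_eq_square power3_eq_cube power4_eq_xxxx eval_nat_numeral)
    finally have "inverse (qf \<nu> z) ^ 5 - 1 = \<nu> * R \<nu> z" by (simp add: q_def)
    moreover have "\<bar>R \<nu> z\<bar> \<le> C"
      using C(2)[of "(0, \<nu>, 0)" z] \<nu> z by (auto simp: params_def)
    ultimately show ?thesis
      using \<nu> by (simp add: abs_mult) (metis mult.commute mult_right_mono)
  qed
  then show ?thesis using C(1) by blast
qed

section \<open>The rescaled equations and their Kepler approximation\<close>

text \<open>A harmonic oscillator of unit frequency with the Coriolis term of the rotating frame,
  weighted by the time change. The centrifugal force about the first primary is the first summand of
  \<open>Gf\<close>.\<close>

definition lc_field :: "real \<Rightarrow> real \<Rightarrow> real \<Rightarrow> complex \<times> complex \<Rightarrow> complex \<times> complex" where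
  "lc_field \<epsilon> \<nu> \<mu> Y = (snd Y, - (of_real (8 * \<epsilon> * (cmod (fst Y))\<^sup>2) * \<i> * snd Y) - fst Y
     + of_real (\<epsilon>\<^sup>2) * Gf \<mu> \<nu> (fst Y))"

text \<open>The unperturbed orbit: a Kepler ejection orbit is a harmonic oscillation in the
  Levi-Civita plane, seen from a frame that rotates by \<open>psi\<close>.\<close>

definition psi :: "real \<Rightarrow> real \<Rightarrow> real" where
  "psi \<epsilon> t = \<epsilon> * (t - sin t * cos t)"

definition Z0 :: "real \<Rightarrow> real \<Rightarrow> real \<Rightarrow> complex" where
  "Z0 \<epsilon> \<theta> t = cis (\<theta> - psi \<epsilon> t) * of_real (sin t)"

definition P0 :: "real \<Rightarrow> real \<Rightarrow> real \<Rightarrow> complex" where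
  "P0 \<epsilon> \<theta> t = cis (\<theta> - psi \<epsilon> t) * Complex (cos t) (- 2 * \<epsilon> * sin t ^ 3)"

lemma psi_deriv [derivative_intros]: "(psi \<epsilon> has_real_derivative 2 * \<epsilon> * (sin t)\<^sup>2) (at t within S)"
proof -
  have "1 - (cos t * cos t + - sin t * sin t) = 2 * (sin t)\<^sup>2"
    using cos_squared_eq[of t] by (simp add: power2_eq_square)
  then have "\<epsilon> * (1 - (cos t * cos t + - sin t * sin t)) = 2 * \<epsilon> * (sin t)\<^sup>2"
    by simp
  then show ?thesis
    unfolding psi_def by (auto intro!: derivative_eq_intros simp: algebra_simps)
qed

lemma psi_bounds:
  assumes "0 \<le> \<epsilon>" "0 \<le> t"
  shows "0 \<le> psi \<epsilon> t" "psi \<epsilon> t \<le> \<epsilon> * (t + 1)"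
proof -
  have 1: "sin t * cos t \<le> t"
    using assms sin_x_le_x[of "2 * t"] by (simp add: sin_double)
  have "\<bar>sin t\<bar> * \<bar>cos t\<bar> \<le> 1 * 1" by (intro mult_mono) auto
  then have "- (sin t * cos t) \<le> 1" by (simp add: abs_mult[symmetric])
  with 1 assms show "0 \<le> psi \<epsilon> t" "psi \<epsilon> t \<le> \<epsilon> * (t + 1)"
    unfolding psi_def by (auto intro!: mult_nonneg_nonneg mult_left_mono)
qed

lemma psi_shift_pi: "psi \<epsilon> (s + pi) = psi \<epsilon> s + \<epsilon> * pi"
  by (simp add: psi_def algebra_simps)

lemma psi_shift: "psi \<epsilon> (t + pi * real k) = psi \<epsilon> t + real k * \<epsilon> * pi"
proof (induction k)
  case (Suc k)
  have "t + pi * real (Suc k) = (t + pi * real k) + pi" by (simp add: algebra_simps)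
  then have "psi \<epsilon> (t + pi * real (Suc k)) = psi \<epsilon> (t + pi * real k) + \<epsilon> * pi"
    by (simp only: psi_shift_pi)
  with Suc show ?case by (simp add: algebra_simps)
qed simp

lemma Z0_deriv: "(Z0 \<epsilon> \<theta> has_vector_derivative P0 \<epsilon> \<theta> t) (at t within S)"
  unfolding has_vector_derivative_complex_iff Z0_def P0_def
  by (auto intro!: derivative_eq_intros simp: algebra_simps power2_eq_square power3_eq_cube)

lemma P0_deriv:
  "(P0 \<epsilon> \<theta> has_vector_derivative
     cis (\<theta> - psi \<epsilon> t) * Complex (- sin t - 4 * \<epsilon>\<^sup>2 * sin t ^ 5) (- 8 * \<epsilon> * (sin t)\<^sup>2 * cos t))
   (at t within S)"
  unfolding has_vector_derivative_complex_iff P0_def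
  by (auto intro!: derivative_eq_intros simp: algebra_simps eval_nat_numeral)

lemma cmod_Z0: "cmod (Z0 \<epsilon> \<theta> t) = \<bar>sin t\<bar>"
  by (simp add: Z0_def norm_mult)

lemma cmod_Z0_sq: "(cmod (Z0 \<epsilon> \<theta> t))\<^sup>2 = (sin t)\<^sup>2"
  by (simp add: cmod_Z0)

lemma cmod_P0_sq: "(cmod (P0 \<epsilon> \<theta> t))\<^sup>2 = (cos t)\<^sup>2 + 4 * \<epsilon>\<^sup>2 * sin t ^ 6"
  by (simp add: P0_def norm_mult cmod_power2 power_mult_distrib flip: power_mult)

lemma cmod_P0_le:
  assumes "0 \<le> \<epsilon>" "\<epsilon> \<le> 1/4"
  shows "cmod (P0 \<epsilon> \<theta> t) \<le> 3/2"
proof -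
  have "cmod (P0 \<epsilon> \<theta> t) \<le> \<bar>cos t\<bar> + \<bar>- 2 * \<epsilon> * sin t ^ 3\<bar>"
    using cmod_le[of "Complex (cos t) (- 2 * \<epsilon> * sin t ^ 3)"] by (simp add: P0_def norm_mult)
  moreover have "\<bar>sin t\<bar> ^ 3 \<le> 1" by (intro power_le_one) auto
  then have "2 * \<epsilon> * \<bar>sin t\<bar> ^ 3 \<le> 2 * \<epsilon> * 1" using assms by (intro mult_left_mono) auto
  moreover have "\<bar>cos t\<bar> \<le> 1" by simp
  moreover have "\<bar>- 2 * \<epsilon> * sin t ^ 3\<bar> = 2 * \<epsilon> * \<bar>sin t\<bar> ^ 3"
    using assms by (simp add: abs_mult power_abs)
  ultimately show ?thesis using assms by linarith
qed

text \<open>The rotation of the frame is contained in \<open>psi\<close>, so the Coriolis and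
  oscillator terms are matched exactly and no error of order \<epsilon> remains. The term with
  \<open>sin t ^ 5\<close> is the centrifugal force along \<open>Z0\<close>; what is left is the
  force of the second primary.\<close>

lemma Y0_deriv:
  "((\<lambda>t. (Z0 \<epsilon> \<theta> t, P0 \<epsilon> \<theta> t)) has_vector_derivative
     lc_field \<epsilon> \<nu> \<mu> (Z0 \<epsilon> \<theta> t, P0 \<epsilon> \<theta> t)
      + (0, of_real (\<epsilon>\<^sup>2) * (of_real (12 * sin t ^ 5) * cis (\<theta> - psi \<epsilon> t) - Gf \<mu> \<nu> (Z0 \<epsilon> \<theta> t))))
   (at t within S)"
proof -
  define w where "w = cis (\<theta> - psi \<epsilon> t)"
  have "w * Complex (- sin t - 4 * \<epsilon>\<^sup>2 * sin t ^ 5) (- 8 * \<epsilon> * (sin t)\<^sup>2 * cos t)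
     = - (of_real (8 * \<epsilon> * (sin t)\<^sup>2) * \<i> * (w * Complex (cos t) (- 2 * \<epsilon> * sin t ^ 3)))
       - w * of_real (sin t) + of_real (\<epsilon>\<^sup>2) * (of_real (12 * sin t ^ 5) * w)"
  proof -
    define A where "A = Complex (- sin t - 4 * \<epsilon>\<^sup>2 * sin t ^ 5) (- 8 * \<epsilon> * (sin t)\<^sup>2 * cos t)"
    define D where "D = Complex (cos t) (- 2 * \<epsilon> * sin t ^ 3)"
    have hA: "A = - (of_real (8 * \<epsilon> * (sin t)\<^sup>2) * \<i> * D)
       - of_real (sin t) + of_real (\<epsilon>\<^sup>2) * of_real (12 * sin t ^ 5)"
      by (simp add: A_def D_def complex_eq_iff Re_power2 Im_power2) (simp add: eval_nat_numeral)
    have "w * A = - (of_real (8 * \<epsilon> * (sin t)\<^sup>2) * \<i> * (w * D))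
       - w * of_real (sin t) + of_real (\<epsilon>\<^sup>2) * (of_real (12 * sin t ^ 5) * w)"
      unfolding hA by (simp add: algebra_simps)
    then show ?thesis by (simp only: A_def D_def)
  qed
  then have "lc_field \<epsilon> \<nu> \<mu> (Z0 \<epsilon> \<theta> t, P0 \<epsilon> \<theta> t)
      + (0, of_real (\<epsilon>\<^sup>2) * (of_real (12 * sin t ^ 5) * cis (\<theta> - psi \<epsilon> t) - Gf \<mu> \<nu> (Z0 \<epsilon> \<theta> t)))
    = (P0 \<epsilon> \<theta> t, w * Complex (- sin t - 4 * \<epsilon>\<^sup>2 * sin t ^ 5) (- 8 * \<epsilon> * (sin t)\<^sup>2 * cos t))"
    unfolding lc_field_def fst_conv snd_conv cmod_Z0_sq
    by (simp add: P0_def Z0_def w_def right_diff_distrib)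
  then show ?thesis
    using has_vector_derivative_Pair[OF Z0_deriv[of \<epsilon> \<theta> t S] P0_deriv[of \<epsilon> \<theta> t S]]
    by (simp add: w_def)
qed

lemma ublip_lc_field:
  "ublip params (cball 0 3) (\<lambda>i Y. lc_field (fst i) (fst (snd i)) (snd (snd i)) Y)"
proof -
  have fst3: "fst Y \<in> cball 0 3" "snd Y \<in> cball 0 3" if "Y \<in> cball (0::complex\<times>complex) 3" for Y
    using that norm_fst_le[of "fst Y" "snd Y"] norm_snd_le[of "snd Y" "fst Y"] by auto
  have f: "ublip params (cball (0::complex\<times>complex) 3) (\<lambda>i Y. F i (fst Y))"
    if "ublip params (cball 0 3) F" for F :: "_ \<Rightarrow> complex \<Rightarrow> complex"
    by (rule ublip_comp[OF that, of _ fst])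
      (use fst3 norm_fst_le in \<open>auto\<close>)
  have s: "ublip params (cball (0::complex\<times>complex) 3) (\<lambda>i Y. snd Y)"
    by (rule ublip_linear) (auto intro: bounded_linear_snd)
  show ?thesis
    unfolding lc_field_def by (intro ublip_pair ublip_intros f[OF ublip_Gf] f[OF ublip_id] s)
qed

lemma lc_field_lipschitz:
  obtains L where "L > 0"
    "\<And>\<epsilon> \<nu> \<mu> x y. \<epsilon> \<in> {0..1} \<Longrightarrow> \<nu> \<in> {0..1/100} \<Longrightarrow> \<mu> \<in> {0..1} \<Longrightarrow> x \<in> cball 0 3 \<Longrightarrow> y \<in> cball 0 3 \<Longrightarrow>
      norm (lc_field \<epsilon> \<nu> \<mu> x - lc_field \<epsilon> \<nu> \<mu> y) \<le> L * norm (x - y)"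
proof -
  obtain L where "L > 0" and L: "\<And>i x y. i \<in> params \<Longrightarrow> x \<in> cball 0 3 \<Longrightarrow> y \<in> cball 0 3 \<Longrightarrow>
     norm (lc_field (fst i) (fst (snd i)) (snd (snd i)) x - lc_field (fst i) (fst (snd i)) (snd (snd i)) y)
       \<le> L * norm (x - y)"
    using ublip_lc_field by (rule ublipE) blast
  show thesis
  proof (rule that[OF \<open>L > 0\<close>])
    fix \<epsilon> \<nu> \<mu> :: real and x y :: "complex \<times> complex"
    assume "\<epsilon> \<in> {0..1}" "\<nu> \<in> {0..1/100}" "\<mu> \<in> {0..1}" "x \<in> cball 0 3" "y \<in> cball 0 3"
    then show "norm (lc_field \<epsilon> \<nu> \<mu> x - lc_field \<epsilon> \<nu> \<mu> y) \<le> L * norm (x - y)"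
      using L[of "(\<epsilon>, \<nu>, \<mu>)" x y] by (auto simp: params_def)
  qed
qed

text \<open>The bound 3 is part of the notion so that one Lipschitz constant of the field applies to
  every solution, which gives uniqueness without further a priori estimates.\<close>

definition lc_sol :: "real \<Rightarrow> real \<Rightarrow> real \<Rightarrow> real \<Rightarrow> (real \<Rightarrow> complex \<times> complex) \<Rightarrow> bool" where
  "lc_sol \<epsilon> \<nu> \<mu> T Y \<longleftrightarrow> (\<forall>t\<in>{0..T}. norm (Y t) \<le> 3 \<and>
     (Y has_vector_derivative lc_field \<epsilon> \<nu> \<mu> (Y t)) (at t within {0..T}))"

lemma lc_sol_unique:
  assumes p: "\<epsilon> \<in> {0..1}" "\<nu> \<in> {0..1/100}" "\<mu> \<in> {0..1}"
    and s: "lc_sol \<epsilon> \<nu> \<mu> T X" "lc_sol \<epsilon> \<nu> \<mu> T Y" and a: "0 \<le> a" "a \<le> b" "b \<le> T" and eq: "X a = Y a"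
  shows "X b = Y b"
proof -
  obtain L where L: "L > 0" "\<And>x y. x \<in> cball 0 3 \<Longrightarrow> y \<in> cball 0 3 \<Longrightarrow>
      norm (lc_field \<epsilon> \<nu> \<mu> x - lc_field \<epsilon> \<nu> \<mu> y) \<le> L * norm (x - y)"
    using lc_field_lipschitz p by metis
  have "norm (X b - Y b) \<le> (norm (X a - Y a) + 0 * (b - a)) * exp (L * (b - a))"
  proof (rule gronwall_bound[where y = "\<lambda>t. X t - Y t"
        and y' = "\<lambda>t. lc_field \<epsilon> \<nu> \<mu> (X t) - lc_field \<epsilon> \<nu> \<mu> (Y t)"])
    fix t assume t: "t \<in> {a..b}"
    then have tT: "t \<in> {0..T}" using a by auto
    have sub: "{a..b} \<subseteq> {0..T}" using a by auto
    show "((\<lambda>t. X t - Y t) has_vector_derivative lc_field \<epsilon> \<nu> \<mu> (X t) - lc_field \<epsilon> \<nu> \<mu> (Y t))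
        (at t within {a..b})"
      using s tT unfolding lc_sol_def
      by (intro has_vector_derivative_diff has_vector_derivative_within_subset[OF _ sub]) auto
    show "norm (lc_field \<epsilon> \<nu> \<mu> (X t) - lc_field \<epsilon> \<nu> \<mu> (Y t)) \<le> L * norm (X t - Y t) + 0"
      using L(2)[of "X t" "Y t"] s tT unfolding lc_sol_def by auto
  qed (use a L in auto)
  then show ?thesis using eq by simp
qed

lemma cmod_cis_diff_le: "cmod (cis \<theta> - cis \<theta>') \<le> \<bar>\<theta> - \<theta>'\<bar>"
proof -
  have "cmod (cis \<theta> - cis \<theta>') = cmod (cis \<theta>' * (cis (\<theta> - \<theta>') - 1))"
    by (simp add: right_diff_distrib cis_mult)
  also have "\<dots> = cmod (exp (\<i> * of_real (\<theta> - \<theta>')) - 1)"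
    by (simp add: norm_mult cis_conv_exp)
  also have "\<dots> \<le> \<bar>\<theta> - \<theta>'\<bar>"
  proof -
    have "cmod (exp (\<i> * of_real x) - 1) \<le> \<bar>x\<bar>" for x :: real
    proof -
      have "(cmod (exp (\<i> * of_real x) - 1))\<^sup>2 = (2 * sin (x / 2))\<^sup>2"
        unfolding cmod_power2 cis_conv_exp[symmetric]
        using cos_double_sin[of "x / 2"] sin_cos_squared_add[of x]
        by (simp add: power2_eq_square algebra_simps)
      also have "\<dots> \<le> x\<^sup>2"
        using abs_sin_x_le_abs_x[of "x / 2"] by (intro abs_le_square_iff[THEN iffD1]) (simp add: abs_mult)
      finally show ?thesis by (simp add: abs_le_square_iff[symmetric])
    qed
    then show ?thesis .
  qed
  finally show ?thesis .
qed

text \<open>Both estimates are Gronwall comparisons for the cut-off field. The constants depend on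
  \<open>T\<close> alone because the bounds on \<open>lc_field\<close> and \<open>Gf\<close> are
  uniform over \<open>params\<close>.\<close>

lemma lc_solutions_near_kepler:
  assumes T: "0 < T"
  shows "\<exists>C>0. \<exists>E>0. \<exists>\<epsilon>0>0. \<forall>\<epsilon>\<in>{0<..\<epsilon>0}. \<forall>\<nu>\<in>{0<..1/100}. \<forall>\<mu>\<in>{0..1}.
    \<exists>Y :: real \<Rightarrow> real \<Rightarrow> complex \<times> complex. (\<forall>\<theta>. Y \<theta> 0 = (0, cis \<theta>) \<and> lc_sol \<epsilon> \<nu> \<mu> T (Y \<theta>)) \<and>
      (\<forall>\<theta>. \<forall>t\<in>{0..T}. norm (Y \<theta> t - (Z0 \<epsilon> \<theta> t, P0 \<epsilon> \<theta> t)) \<le> C * \<epsilon>\<^sup>2) \<and>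
      (\<forall>\<theta> \<theta>'. \<forall>t\<in>{0..T}. norm (Y \<theta> t - Y \<theta>' t) \<le> E * \<bar>\<theta> - \<theta>'\<bar>)"
proof -
  obtain L where L: "L > 0"
    "\<And>\<epsilon> \<nu> \<mu> x y. \<epsilon> \<in> {0..1} \<Longrightarrow> \<nu> \<in> {0..1/100} \<Longrightarrow> \<mu> \<in> {0..1} \<Longrightarrow> x \<in> cball 0 3 \<Longrightarrow> y \<in> cball 0 3 \<Longrightarrow>
      norm (lc_field \<epsilon> \<nu> \<mu> x - lc_field \<epsilon> \<nu> \<mu> y) \<le> L * norm (x - y)"
    using lc_field_lipschitz by metis
  obtain B where B: "B > 0" "\<And>i x. i \<in> params \<Longrightarrow> x \<in> cball 0 3 \<Longrightarrow>
      cmod (Gf (snd (snd i)) (fst (snd i)) x) \<le> B"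
    using ublip_Gf by (rule ublipE) blast
  define C where "C = (12 + B) * T * exp (L * T)"
  define E where "E = exp (L * T)"
  \<comment> \<open>This choice gives \<open>C * \<epsilon>\<^sup>2 \<le> 1/8\<close>. The Kepler
    orbit has norm at most \<open>5/2\<close>, so the solutions stay in the ball of radius 3 and
    never meet the cut-off.\<close>
  define \<epsilon>0 where "\<epsilon>0 = min (1/4) (1 / (2 * C))"
  have C: "C > 0" "E > 0" "\<epsilon>0 > 0" using B T by (auto simp: C_def E_def \<epsilon>0_def)
  have "\<exists>Y :: real \<Rightarrow> real \<Rightarrow> complex \<times> complex. (\<forall>\<theta>. Y \<theta> 0 = (0, cis \<theta>) \<and> lc_sol \<epsilon> \<nu> \<mu> T (Y \<theta>)) \<and>
      (\<forall>\<theta>. \<forall>t\<in>{0..T}. norm (Y \<theta> t - (Z0 \<epsilon> \<theta> t, P0 \<epsilon> \<theta> t)) \<le> C * \<epsilon>\<^sup>2) \<and>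
      (\<forall>\<theta> \<theta>'. \<forall>t\<in>{0..T}. norm (Y \<theta> t - Y \<theta>' t) \<le> E * \<bar>\<theta> - \<theta>'\<bar>)"
    if \<epsilon>: "\<epsilon> \<in> {0<..\<epsilon>0}" and \<nu>: "\<nu> \<in> {0<..1/100}" and \<mu>: "\<mu> \<in> {0..1}" for \<epsilon> \<nu> \<mu>
  proof -
    define F where "F = lc_field \<epsilon> \<nu> \<mu>"
    define P where "P = closest_point (cball (0::complex\<times>complex) 3)"
    have \<epsilon>1: "0 < \<epsilon>" "\<epsilon> \<le> 1/4" "\<epsilon> \<in> {0..1}" "\<nu> \<in> {0..1/100}"
      using \<epsilon> \<nu> by (auto simp: \<epsilon>0_def)
    have C\<epsilon>: "C * \<epsilon>\<^sup>2 \<le> 1/8"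
    proof -
      have "C * \<epsilon> \<le> 1/2" using \<epsilon> C by (auto simp: \<epsilon>0_def field_simps)
      then have "C * \<epsilon> * \<epsilon> \<le> 1/2 * (1/4)" using \<epsilon>1 C by (intro mult_mono) auto
      then show ?thesis by (simp add: power2_eq_square)
    qed
    have lipF: "norm (F x - F y) \<le> L * norm (x - y)" if "x \<in> cball 0 3" "y \<in> cball 0 3" for x y
      unfolding F_def using L(2)[OF \<epsilon>1(3,4) \<mu> that] .
    note co = cutoff_ode_solution_exists[of 3 F L, OF lipF less_imp_le[OF T] L(1), simplified,
        folded P_def]
    have "\<exists>Y. Y 0 = (0, cis \<theta>) \<and> (\<forall>t\<in>{0..T}. (Y has_vector_derivative F (P (Y t))) (at t within {0..T}))"
      for \<theta> using co(1) by auto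
    then obtain Y where Y: "\<And>\<theta>. Y \<theta> 0 = (0, cis \<theta>)"
      "\<And>\<theta> t. t \<in> {0..T} \<Longrightarrow> (Y \<theta> has_vector_derivative F (P (Y \<theta> t))) (at t within {0..T})"
      by metis
    have Y0: "norm (Z0 \<epsilon> \<theta> t, P0 \<epsilon> \<theta> t) \<le> 5/2" for \<theta> t
    proof -
      have "norm (Z0 \<epsilon> \<theta> t, P0 \<epsilon> \<theta> t) \<le> cmod (Z0 \<epsilon> \<theta> t) + cmod (P0 \<epsilon> \<theta> t)"
        by (rule norm_Pair_le)
      moreover have "cmod (Z0 \<epsilon> \<theta> t) \<le> 1" by (simp add: cmod_Z0)
      ultimately show ?thesis using cmod_P0_le[of \<epsilon> \<theta> t] \<epsilon>1 by linarith
    qed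
    have near: "norm (Y \<theta> t - (Z0 \<epsilon> \<theta> t, P0 \<epsilon> \<theta> t)) \<le> C * \<epsilon>\<^sup>2" if t: "t \<in> {0..T}" for \<theta> t
    proof -
      define R where "R s = (0::complex, of_real (\<epsilon>\<^sup>2) * (of_real (12 * sin s ^ 5) * cis (\<theta> - psi \<epsilon> s)
          - Gf \<mu> \<nu> (Z0 \<epsilon> \<theta> s)))" for s
      define W where "W s = (Z0 \<epsilon> \<theta> s, P0 \<epsilon> \<theta> s)" for s
      have PW: "P (W s) = W s" for s
        using co(3)[of "W s"] Y0[of \<theta> s] by (auto simp: W_def)
      have R: "norm (R s) \<le> \<epsilon>\<^sup>2 * (12 + B)" for s
      proof -
        have "\<bar>sin s\<bar> ^ 5 \<le> 1" by (intro power_le_one) auto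
        then have "cmod (of_real (12 * sin s ^ 5) * cis (\<theta> - psi \<epsilon> s)) \<le> 12"
          by (simp add: norm_mult norm_power)
        moreover have "cmod (Gf \<mu> \<nu> (Z0 \<epsilon> \<theta> s)) \<le> B"
        proof -
          have "cmod (Z0 \<epsilon> \<theta> s) \<le> 3" using abs_sin_le_one[of s] unfolding cmod_Z0 by linarith
          then show ?thesis using B(2)[of "(\<epsilon>, \<nu>, \<mu>)" "Z0 \<epsilon> \<theta> s"] \<epsilon>1 \<mu> by (simp add: params_def)
        qed
        ultimately have "cmod (of_real (12 * sin s ^ 5) * cis (\<theta> - psi \<epsilon> s) - Gf \<mu> \<nu> (Z0 \<epsilon> \<theta> s)) \<le> 12 + B"
          using norm_triangle_ineq4[of "of_real (12 * sin s ^ 5) * cis (\<theta> - psi \<epsilon> s)" "Gf \<mu> \<nu> (Z0 \<epsilon> \<theta> s)"]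
          by linarith
        then have "\<epsilon>\<^sup>2 * cmod (of_real (12 * sin s ^ 5) * cis (\<theta> - psi \<epsilon> s) - Gf \<mu> \<nu> (Z0 \<epsilon> \<theta> s)) \<le> \<epsilon>\<^sup>2 * (12 + B)"
          by (intro mult_left_mono) auto
        then show ?thesis unfolding R_def norm_Pair norm_mult by (simp add: norm_power)
      qed
      have "norm (Y \<theta> t - W t) \<le> (norm (Y \<theta> 0 - W 0) + \<epsilon>\<^sup>2 * (12 + B) * (t - 0)) * exp (L * (t - 0))"
      proof (rule gronwall_bound[where y = "\<lambda>s. Y \<theta> s - W s" and y' = "\<lambda>s. F (P (Y \<theta> s)) - (F (W s) + R s)"])
        fix s assume s: "s \<in> {0..t}"
        have sub: "{0..t} \<subseteq> {0..T}" using t by auto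
        show "((\<lambda>s. Y \<theta> s - W s) has_vector_derivative F (P (Y \<theta> s)) - (F (W s) + R s)) (at s within {0..t})"
          unfolding W_def R_def F_def
          by (intro has_vector_derivative_diff Y0_deriv
              has_vector_derivative_within_subset[OF Y(2)[unfolded F_def] sub]) (use s t in auto)
        have "norm (F (P (Y \<theta> s)) - F (P (W s))) \<le> L * norm (Y \<theta> s - W s)" by (rule co(2))
        then have "norm (F (P (Y \<theta> s)) - F (W s)) \<le> L * norm (Y \<theta> s - W s)" unfolding PW .
        then show "norm (F (P (Y \<theta> s)) - (F (W s) + R s)) \<le> L * norm (Y \<theta> s - W s) + \<epsilon>\<^sup>2 * (12 + B)"
          using R[of s] norm_triangle_ineq4[of "F (P (Y \<theta> s)) - F (W s)" "R s"]
          by (simp add: diff_diff_add)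
      qed (use t L B in auto)
      also have "norm (Y \<theta> 0 - W 0) = 0" by (simp add: Y(1) W_def Z0_def P0_def psi_def complex_eq_iff)
      also have "(0 + \<epsilon>\<^sup>2 * (12 + B) * (t - 0)) * exp (L * (t - 0)) \<le> (\<epsilon>\<^sup>2 * (12 + B) * T) * exp (L * T)"
        using t L(1) B(1) mult_left_mono[of t T "\<epsilon>\<^sup>2 * (12 + B)"] by (intro mult_mono) auto
      finally show ?thesis by (simp add: C_def W_def algebra_simps)
    qed
    have le3: "norm (Y \<theta> t) \<le> 3" if "t \<in> {0..T}" for \<theta> t
      using near[OF that, of \<theta>] C\<epsilon> Y0[of \<theta> t] norm_triangle_sub[of "Y \<theta> t" "(Z0 \<epsilon> \<theta> t, P0 \<epsilon> \<theta> t)"]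
      by linarith
    have PY: "P (Y \<theta> t) = Y \<theta> t" if "t \<in> {0..T}" for \<theta> t
      using co(3)[of "Y \<theta> t"] le3[OF that] by auto
    have "lc_sol \<epsilon> \<nu> \<mu> T (Y \<theta>)" for \<theta>
      unfolding lc_sol_def using le3 Y(2)[of _ \<theta>] PY unfolding F_def by auto
    moreover have "norm (Y \<theta> t - Y \<theta>' t) \<le> E * \<bar>\<theta> - \<theta>'\<bar>" if t: "t \<in> {0..T}" for \<theta> \<theta>' t
    proof -
      have "norm (Y \<theta> t - Y \<theta>' t) \<le> (norm (Y \<theta> 0 - Y \<theta>' 0) + 0 * (t - 0)) * exp (L * (t - 0))"
      proof (rule gronwall_bound[where y = "\<lambda>s. Y \<theta> s - Y \<theta>' s" and y' = "\<lambda>s. F (P (Y \<theta> s)) - F (P (Y \<theta>' s))"])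
        fix s assume s: "s \<in> {0..t}"
        have sub: "{0..t} \<subseteq> {0..T}" using t by auto
        show "((\<lambda>s. Y \<theta> s - Y \<theta>' s) has_vector_derivative F (P (Y \<theta> s)) - F (P (Y \<theta>' s))) (at s within {0..t})"
          by (intro has_vector_derivative_diff has_vector_derivative_within_subset[OF Y(2) sub])
             (use s t in auto)
        show "norm (F (P (Y \<theta> s)) - F (P (Y \<theta>' s))) \<le> L * norm (Y \<theta> s - Y \<theta>' s) + 0"
          using co(2) by simp
      qed (use t L in auto)
      also have "norm (Y \<theta> 0 - Y \<theta>' 0) \<le> \<bar>\<theta> - \<theta>'\<bar>"
      proof -
        have "cmod (cis \<theta> - cis \<theta>') \<le> \<bar>\<theta> - \<theta>'\<bar>" by (rule cmod_cis_diff_le)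
        then show ?thesis by (simp add: Y(1) norm_Pair)
      qed
      also have "(\<bar>\<theta> - \<theta>'\<bar> + 0 * (t - 0)) * exp (L * (t - 0)) \<le> \<bar>\<theta> - \<theta>'\<bar> * exp (L * T)"
        using t L by (intro mult_mono) auto
      finally show ?thesis by (simp add: E_def mult.commute)
    qed
    ultimately show ?thesis using near Y(1) by blast
  qed
  then show ?thesis using C by blast
qed

section \<open>Symmetries and first integrals\<close>

lemma qf_cnj [simp]: "qf \<nu> (cnj z) = qf \<nu> z"
proof -
  have "1 + of_real \<nu> * (cnj z)\<^sup>2 = cnj (1 + of_real \<nu> * z\<^sup>2)" by simp
  then show ?thesis unfolding qf_def by (metis complex_mod_cnj)
qed

lemma gf_cnj [simp]: "gf \<nu> (cnj z) = gf \<nu> z"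
  unfolding gf_def by (simp flip: complex_cnj_power)

lemma kf_cnj [simp]: "kf \<nu> (cnj z) = kf \<nu> z"
  unfolding kf_def by (simp flip: complex_cnj_power)

lemma Gf_cnj: "Gf \<mu> \<nu> (cnj z) = cnj (Gf \<mu> \<nu> z)"
  unfolding Gf_def by simp

lemma qf_minus [simp]: "qf \<nu> (- z) = qf \<nu> z"
  by (simp add: qf_def)

lemma gf_minus [simp]: "gf \<nu> (- z) = gf \<nu> z"
  by (simp add: gf_def)

lemma Gf_minus: "Gf \<mu> \<nu> (- z) = - Gf \<mu> \<nu> z"
  unfolding Gf_def by (simp add: kf_def algebra_simps)

lemma torque_minus [simp]: "torque \<nu> (- z) = torque \<nu> z"
  by (simp add: torque_def)

lemma lc_sol_subset:
  assumes "lc_sol \<epsilon> \<nu> \<mu> T Y" "T' \<le> T"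
  shows "lc_sol \<epsilon> \<nu> \<mu> T' Y"
  unfolding lc_sol_def
proof (intro ballI conjI)
  fix t assume t: "t \<in> {0..T'}"
  have sub: "{0..T'} \<subseteq> {0..T}" using assms by auto
  show "norm (Y t) \<le> 3"
    "(Y has_vector_derivative lc_field \<epsilon> \<nu> \<mu> (Y t)) (at t within {0..T'})"
    using assms(1) t sub unfolding lc_sol_def
    by (auto intro!: has_vector_derivative_within_subset[OF _ sub])
qed

lemma lc_sol_minus:
  assumes "lc_sol \<epsilon> \<nu> \<mu> T Y"
  shows "lc_sol \<epsilon> \<nu> \<mu> T (\<lambda>t. - Y t)"
proof -
  have "lc_field \<epsilon> \<nu> \<mu> (- Y) = - lc_field \<epsilon> \<nu> \<mu> Y" for Y
    by (simp add: lc_field_def Gf_minus)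
  then show ?thesis
    using assms unfolding lc_sol_def by (auto intro!: derivative_eq_intros)
qed

text \<open>The reversing symmetry of the problem: reflection in the horizontal axis, which is
  conjugation in the Levi-Civita plane, combined with reversal of time.\<close>

lemma lc_sol_reverse:
  assumes "lc_sol \<epsilon> \<nu> \<mu> T Y"
  shows "lc_sol \<epsilon> \<nu> \<mu> T (\<lambda>t. (cnj (fst (Y (T - t))), - cnj (snd (Y (T - t)))))"
  unfolding lc_sol_def
proof (intro ballI conjI)
  fix t assume t: "t \<in> {0..T}"
  then have t': "T - t \<in> {0..T}" by auto
  define \<rho> where "\<rho> = (\<lambda>Y :: complex \<times> complex. (cnj (fst Y), - cnj (snd Y)))"
  have lin: "bounded_linear \<rho>"
    unfolding \<rho>_def
    by (intro bounded_linear_Pair bounded_linear_minus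
        bounded_linear_compose[OF bounded_linear_cnj] bounded_linear_fst bounded_linear_snd)
  have nrm: "norm (\<rho> Y) = norm Y" for Y by (cases Y) (simp add: \<rho>_def norm_Pair)
  show "norm (cnj (fst (Y (T - t))), - cnj (snd (Y (T - t)))) \<le> 3"
    using assms t' nrm[of "Y (T - t)"] unfolding lc_sol_def \<rho>_def by simp
  have "((Y \<circ> (\<lambda>t. T - t)) has_vector_derivative (-1) *\<^sub>R lc_field \<epsilon> \<nu> \<mu> (Y (T - t))) (at t within {0..T})"
  proof (rule vector_diff_chain_within)
    show "((\<lambda>t. T - t) has_vector_derivative -1) (at t within {0..T})"
      by (auto intro!: derivative_eq_intros)
    have "(\<lambda>t. T - t) ` {0..T} = {0..T}" by auto
    then show "(Y has_vector_derivative lc_field \<epsilon> \<nu> \<mu> (Y (T - t))) (at (T - t) within (\<lambda>t. T - t) ` {0..T})"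
      using assms t' unfolding lc_sol_def by simp
  qed
  from bounded_linear.has_vector_derivative[OF lin this]
  have "((\<lambda>t. \<rho> (Y (T - t))) has_vector_derivative \<rho> (- lc_field \<epsilon> \<nu> \<mu> (Y (T - t)))) (at t within {0..T})"
    by (simp add: o_def)
  moreover have "\<rho> (- lc_field \<epsilon> \<nu> \<mu> Y) = lc_field \<epsilon> \<nu> \<mu> (\<rho> Y)" for Y
    by (simp add: lc_field_def \<rho>_def Gf_cnj)
  ultimately show "((\<lambda>t. (cnj (fst (Y (T - t))), - cnj (snd (Y (T - t))))) has_vector_derivative
      lc_field \<epsilon> \<nu> \<mu> (cnj (fst (Y (T - t))), - cnj (snd (Y (T - t))))) (at t within {0..T})"
    by (simp add: \<rho>_def)
qed

text \<open>Half the derivative of the distance \<open>(cmod z)\<^sup>2\<close> to the primary, so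
  its zeros are the critical times of that distance.\<close>

definition radial :: "complex \<times> complex \<Rightarrow> real" where
  "radial Y = Re (cnj (fst Y) * snd Y)"

text \<open>The angular momentum in the inertial frame.\<close>

definition angmom :: "real \<Rightarrow> complex \<times> complex \<Rightarrow> real" where
  "angmom \<epsilon> Y = Im (cnj (fst Y) * snd Y) + 2 * \<epsilon> * cmod (fst Y) ^ 4"

lemma lc_solD:
  assumes "lc_sol \<epsilon> \<nu> \<mu> T Y" "t \<in> {0..T}"
  shows "((\<lambda>t. fst (Y t)) has_vector_derivative snd (Y t)) (at t within {0..T})"
    and "((\<lambda>t. snd (Y t)) has_vector_derivative snd (lc_field \<epsilon> \<nu> \<mu> (Y t))) (at t within {0..T})"
    and "norm (Y t) \<le> 3" "cmod (fst (Y t)) \<le> 3" "cmod (snd (Y t)) \<le> 3"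
proof -
  have *: "(Y has_vector_derivative lc_field \<epsilon> \<nu> \<mu> (Y t)) (at t within {0..T})" "norm (Y t) \<le> 3"
    using assms by (auto simp: lc_sol_def)
  show "norm (Y t) \<le> 3" by fact
  show "cmod (fst (Y t)) \<le> 3" "cmod (snd (Y t)) \<le> 3"
    using *(2) norm_fst_le[of "fst (Y t)" "snd (Y t)"] norm_snd_le[of "snd (Y t)" "fst (Y t)"] by auto
  show "((\<lambda>t. fst (Y t)) has_vector_derivative snd (Y t)) (at t within {0..T})"
    using bounded_linear.has_vector_derivative[OF bounded_linear_fst *(1)] by (simp add: lc_field_def)
  show "((\<lambda>t. snd (Y t)) has_vector_derivative snd (lc_field \<epsilon> \<nu> \<mu> (Y t))) (at t within {0..T})"
    using bounded_linear.has_vector_derivative[OF bounded_linear_snd *(1)] .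
qed

lemma cmod_sq_deriv:
  assumes "lc_sol \<epsilon> \<nu> \<mu> T Y" "t \<in> {0..T}"
  shows "((\<lambda>t. (cmod (fst (Y t)))\<^sup>2) has_real_derivative 2 * radial (Y t)) (at t within {0..T})"
  using lc_solD(1)[OF assms]
  unfolding cmod_power2 radial_def
  by (auto intro!: derivative_eq_intros simp: algebra_simps)

lemma radial_deriv:
  assumes "lc_sol \<epsilon> \<nu> \<mu> T Y" "t \<in> {0..T}"
  shows "((\<lambda>t. radial (Y t)) has_real_derivative
    (cmod (snd (Y t)))\<^sup>2 - (cmod (fst (Y t)))\<^sup>2 + 8 * \<epsilon> * (cmod (fst (Y t)))\<^sup>2 * Im (cnj (fst (Y t)) * snd (Y t))
      + \<epsilon>\<^sup>2 * Re (cnj (fst (Y t)) * Gf \<mu> \<nu> (fst (Y t)))) (at t within {0..T})"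
proof -
  define a where "a = 8 * \<epsilon> * (cmod (fst (Y t)))\<^sup>2"
  define G where "G = Gf \<mu> \<nu> (fst (Y t))"
  show ?thesis
    using lc_solD(1,2)[OF assms]
    unfolding lc_field_def radial_def snd_conv
      a_def[symmetric] G_def[symmetric]
    by (auto intro!: derivative_eq_intros simp: algebra_simps cmod_power2 simp flip: of_real_power)
       (simp add: power2_eq_square)
qed

text \<open>The Coriolis contribution cancels against the derivative of
  \<open>2 * \<epsilon> * cmod z ^ 4\<close>, and the oscillator and centrifugal forces are central.
  Only the torque of the second primary survives.\<close>

lemma angmom_deriv:
  assumes "lc_sol \<epsilon> \<nu> \<mu> T Y" "t \<in> {0..T}"
  shows "((\<lambda>t. angmom \<epsilon> (Y t)) has_real_derivative \<epsilon>\<^sup>2 * \<mu> * torque \<nu> (fst (Y t))) (at t within {0..T})"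
proof -
  define a where "a = 8 * \<epsilon> * (cmod (fst (Y t)))\<^sup>2"
  define G where "G = Gf \<mu> \<nu> (fst (Y t))"
  define z where "z = fst (Y t)"
  define p where "p = snd (Y t)"
  have 1: "((\<lambda>t. Im (cnj (fst (Y t)) * snd (Y t))) has_real_derivative
      - a * Re (cnj z * p) + \<epsilon>\<^sup>2 * Im (cnj z * G)) (at t within {0..T})"
    using lc_solD(1,2)[OF assms]
    unfolding lc_field_def snd_conv
      a_def[symmetric] G_def[symmetric] z_def p_def
    by (auto intro!: derivative_eq_intros simp: algebra_simps simp flip: of_real_power)
  have 2: "((\<lambda>t. 2 * \<epsilon> * ((cmod (fst (Y t)))\<^sup>2)\<^sup>2) has_real_derivative a * Re (cnj z * p)) (at t within {0..T})"
    by (rule DERIV_cong[OF DERIV_cmult[OF DERIV_power[OF cmod_sq_deriv[OF assms]]]])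
      (simp add: a_def radial_def z_def p_def algebra_simps)
  have "Im (cnj z * G) = \<mu> * torque \<nu> z"
  proof -
    have "Im (cnj z * G) = 8 * \<mu> * ((cmod z)\<^sup>2 * gf \<nu> z) * Im (cnj z * cnj z)"
      unfolding G_def z_def[symmetric] Gf_def
      by (simp add: algebra_simps)
    then show ?thesis by (simp add: torque_def power2_eq_square)
  qed
  then show ?thesis
    using DERIV_add[OF 1 2] unfolding angmom_def by (simp add: z_def power_mult[symmetric] mult.assoc)
qed

text \<open>The first summand stems from the centrifugal potential about the first primary, the
  second from the tidal potential of the second primary; both carry the factor
  \<open>4 * (cmod z)\<^sup>2\<close> of the time change.\<close>

definition Phi :: "real \<Rightarrow> real \<Rightarrow> complex \<Rightarrow> real" where
  "Phi \<mu> \<nu> z = 2 * cmod z ^ 6 + 4 * \<mu> * (cmod z)\<^sup>2 * kf \<nu> z"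

lemma Phi_deriv:
  assumes z: "(z has_vector_derivative p) (at t within S)"
    and \<nu>: "0 < \<nu>" "\<nu> \<le> 1/100" and z3: "\<And>s. s \<in> S \<Longrightarrow> cmod (z s) \<le> 3" and t: "t \<in> S"
  shows "((\<lambda>s. Phi \<mu> \<nu> (z s)) has_real_derivative Re (cnj p * Gf \<mu> \<nu> (z t))) (at t within S)"
proof -
  define r where "r s = (cmod (z s))\<^sup>2" for s
  define x where "x s = Re ((z s)\<^sup>2)" for s
  define r' where "r' = 2 * Re (cnj (z t) * p)"
  define x' where "x' = 2 * Re (z t * p)"
  define q where "q = qf \<nu> (z t)"
  have r: "(r has_real_derivative r') (at t within S)"
    using z unfolding r_def r'_def cmod_power2
    by (auto intro!: derivative_eq_intros simp: algebra_simps)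
  have x: "(x has_real_derivative x') (at t within S)"
    using z unfolding x_def x'_def Re_power2
    by (auto intro!: derivative_eq_intros simp: algebra_simps)
  define d where "d s = 1 + \<nu> * (2 * x s + \<nu> * (r s)\<^sup>2)" for s
  have q2: "d s = (qf \<nu> (z s))\<^sup>2" for s
    unfolding qf_sq d_def by (simp add: x_def r_def flip: power_mult)
  define sd where "sd s = sqrt (d s)" for s
  have qs: "qf \<nu> (z s) = sd s" for s
    unfolding q2 sd_def by (simp add: qf_def)
  have q0: "q > 0" using qf_ge[of \<nu> "z t"] \<nu> z3[OF t] by (simp add: q_def)
  have dt: "d t = q\<^sup>2" "d t > 0" using q2[of t] q0 by (auto simp: q_def)
  have sq: "sd t = q" using dt q0 by (simp add: sd_def)
  have ki: "((\<lambda>s. (inverse (sd s) - 1 + \<nu> * x s) / \<nu>\<^sup>2) has_real_derivative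
      (- (\<nu> * x' + \<nu>\<^sup>2 * r t * r') * inverse q ^ 3 + \<nu> * x') / \<nu>\<^sup>2) (at t within S)"
  proof -
    have "(d has_real_derivative 2 * (\<nu> * x' + \<nu>\<^sup>2 * r t * r')) (at t within S)"
      unfolding d_def using r x
      by (auto intro!: derivative_eq_intros simp: algebra_simps power2_eq_square)
    then have "(sd has_real_derivative (\<nu> * x' + \<nu>\<^sup>2 * r t * r') * inverse q) (at t within S)"
      unfolding sd_def by (rule DERIV_cong[OF DERIV_chain2[where f = sqrt and g = d, OF DERIV_real_sqrt[OF dt(2)]]])
        (use q0 dt in \<open>simp add: field_simps\<close>)
    then show ?thesis
      using x q0 \<nu> by (auto intro!: derivative_eq_intros simp: sq field_simps power3_eq_cube)
  qed
  have k': "(- (\<nu> * x' + \<nu>\<^sup>2 * r t * r') * inverse q ^ 3 + \<nu> * x') / \<nu>\<^sup>2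
      = x' * gf \<nu> (z t) - r t * r' * inverse q ^ 3"
    unfolding gf_eq[OF \<nu> z3[OF t]] q_def[symmetric] using \<nu>(1) q0
    by (simp add: divide_simps) (simp add: algebra_simps power2_eq_square)
  have "((\<lambda>s. kf \<nu> (z s)) has_real_derivative x' * gf \<nu> (z t) - r t * r' * inverse q ^ 3) (at t within S)"
    by (rule has_field_derivative_transform_within[OF ki[unfolded k'], of 1])
      (use t \<nu> z3 in \<open>auto simp: kf_eq qs x_def\<close>)
  moreover have "Phi \<mu> \<nu> (z s) = 2 * r s ^ 3 + 4 * \<mu> * r s * kf \<nu> (z s)" for s
    by (simp add: Phi_def r_def flip: power_mult)
  ultimately have D: "((\<lambda>s. Phi \<mu> \<nu> (z s)) has_real_derivative
      6 * (r t)\<^sup>2 * r' + 4 * \<mu> * (r' * kf \<nu> (z t) + r t * (x' * gf \<nu> (z t) - r t * r' * inverse q ^ 3))) (at t within S)"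
    using r by (auto intro!: derivative_eq_intros simp: algebra_simps)
  have G: "Re (cnj p * Gf \<mu> \<nu> (z t)) = 12 * (r t)\<^sup>2 * Re (cnj p * z t)
      + 8 * \<mu> * ((kf \<nu> (z t) - (r t)\<^sup>2 * inverse q ^ 3) * Re (cnj p * z t) + r t * gf \<nu> (z t) * Re (cnj p * cnj (z t)))"
  proof -
    have gen: "Re (cnj p * (of_real a * w + of_real b * (of_real c * w + of_real d * cnj w)))
      = a * Re (cnj p * w) + b * (c * Re (cnj p * w) + d * Re (cnj p * cnj w))" for a b c d w
      by (simp add: algebra_simps)
    have r2: "(r t)\<^sup>2 = cmod (z t) ^ 4" by (simp add: r_def flip: power_mult)
    show ?thesis unfolding Gf_def gen q_def r2 r_def by simp
  qed
  have e: "Re (cnj p * z t) = r' / 2" "Re (cnj p * cnj (z t)) = x' / 2"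
    by (simp_all add: r'_def x'_def algebra_simps)
  show ?thesis
    by (rule DERIV_cong[OF D]) (simp only: G e, simp add: algebra_simps power2_eq_square)
qed

text \<open>The Jacobi integral in scaled variables, with its value fixed by the ejection. The
  Coriolis force does no work, and \<open>Gf\<close> is the gradient of \<open>Phi\<close>.\<close>

lemma lc_sol_energy:
  assumes s: "lc_sol \<epsilon> \<nu> \<mu> T Y" and \<nu>: "0 < \<nu>" "\<nu> \<le> 1/100"
    and Y0: "fst (Y 0) = 0" "cmod (snd (Y 0)) = 1" and t: "t \<in> {0..T}"
  shows "(cmod (snd (Y t)))\<^sup>2 = 1 - (cmod (fst (Y t)))\<^sup>2 + 2 * \<epsilon>\<^sup>2 * Phi \<mu> \<nu> (fst (Y t))"
proof -
  define H where "H t = (cmod (snd (Y t)))\<^sup>2 + (cmod (fst (Y t)))\<^sup>2 - 2 * \<epsilon>\<^sup>2 * Phi \<mu> \<nu> (fst (Y t))" for t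
  have "(H has_real_derivative 0) (at t within {0..T})" if t: "t \<in> {0..T}" for t
  proof -
    define a where "a = 8 * \<epsilon> * (cmod (fst (Y t)))\<^sup>2"
    define G where "G = Gf \<mu> \<nu> (fst (Y t))"
    have 1: "((\<lambda>t. (cmod (snd (Y t)))\<^sup>2) has_real_derivative
        - 2 * radial (Y t) + 2 * \<epsilon>\<^sup>2 * Re (cnj (snd (Y t)) * G)) (at t within {0..T})"
      using lc_solD(1,2)[OF s t]
      unfolding lc_field_def radial_def snd_conv cmod_power2
        a_def[symmetric, unfolded cmod_power2] G_def[symmetric]
      by (auto intro!: derivative_eq_intros simp: algebra_simps simp flip: of_real_power)
    have 2: "((\<lambda>t. Phi \<mu> \<nu> (fst (Y t))) has_real_derivative Re (cnj (snd (Y t)) * G)) (at t within {0..T})"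
      unfolding G_def by (rule Phi_deriv[OF lc_solD(1)[OF s t] \<nu> lc_solD(4)[OF s] t])
    show ?thesis
      unfolding H_def
      by (rule DERIV_cong[OF DERIV_diff[OF DERIV_add[OF 1 cmod_sq_deriv[OF s t]] DERIV_cmult[OF 2]]])
        (simp add: algebra_simps)
  qed
  then have "H t = H 0"
    using has_field_derivative_zero_constant[of "{0..T}" H] t by force
  then show ?thesis using Y0 by (simp add: H_def Phi_def)
qed

section \<open>Critical points of functions with derivative close to a sine\<close>

lemma mvt_within_open:
  fixes f :: "real \<Rightarrow> real"
  assumes "\<And>x. x \<in> S \<Longrightarrow> (f has_real_derivative f' x) (at x within S)" "{a..b} \<subseteq> S" "a < b"
  shows "\<exists>x\<in>{a<..<b}. f b - f a = f' x * (b - a)"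
proof (rule mvt_simple[OF assms(3)])
  fix x assume "a \<le> x" "x \<le> b"
  then show "(f has_derivative (*) (f' x)) (at x within {a..b})"
    using has_field_derivative_subset[OF assms(1)[of x] assms(2)] assms(2)
    unfolding has_field_derivative_def by auto
qed

lemma mvt_within:
  fixes f :: "real \<Rightarrow> real"
  assumes "\<And>x. x \<in> S \<Longrightarrow> (f has_real_derivative f' x) (at x within S)" "{a..b} \<subseteq> S" "a \<le> b"
  shows "\<exists>x\<in>{a..b}. f b - f a = f' x * (b - a)"
proof (cases "a = b")
  case False
  then show ?thesis using mvt_within_open[OF assms(1,2)] assms(3) by force
qed auto

lemma cos_double_shift: "cos (2 * (real j * (pi / 2) + s)) = (-1) ^ j * cos (2 * s)"
proof -
  have "2 * (real j * (pi / 2) + s) = real j * pi + 2 * s" by (simp add: algebra_simps)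
  then show ?thesis by (simp only: cos_add) simp
qed

lemma sin_cos_shift:
  "sin (real j * (pi / 2) + s) * cos (real j * (pi / 2) + s) = (-1) ^ j * sin (2 * s) / 2"
proof -
  have "2 * (real j * (pi / 2) + s) = real j * pi + 2 * s" by (simp add: algebra_simps)
  then have "sin (2 * (real j * (pi / 2) + s)) = (-1) ^ j * sin (2 * s)"
    by (simp only: sin_add) simp
  then show ?thesis unfolding sin_double by simp
qed

text \<open>An abstraction of \<open>radial\<close> along an ejection orbit. Near a zero of
  \<open>sin t * cos t\<close> the estimate of the derivative decides, elsewhere the estimate of the
  function itself. The excess \<open>pi / 6\<close> in \<open>T\<close> makes room for the last
  zone, around \<open>n * pi\<close>.\<close>

locale near_sine =
  fixes f f' :: "real \<Rightarrow> real" and T \<kappa> :: real and n :: nat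
  assumes der: "\<And>t. t \<in> {0..T} \<Longrightarrow> (f has_real_derivative f' t) (at t within {0..T})"
    and f0: "f 0 = 0" and T: "real n * pi + pi / 6 \<le> T"
    and near: "\<And>t. t \<in> {0..T} \<Longrightarrow> \<bar>f t - sin t * cos t\<bar> \<le> \<kappa>"
    and near': "\<And>t. t \<in> {0..T} \<Longrightarrow> \<bar>f' t - cos (2 * t)\<bar> \<le> 1/10"
    and \<kappa>: "\<kappa> \<le> 1/10"
begin

text \<open>With half-width \<open>pi / 6\<close>, \<open>cos (2 * t)\<close> has modulus at least
  \<open>1 / 2\<close> inside a zone and \<open>sin t * cos t\<close> has modulus at least
  \<open>1 / 4\<close> between zones, so an error of \<open>1 / 10\<close> spoils neither the slope
  nor the sign. Zone 0 is one-sided.\<close>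

definition zone :: "nat \<Rightarrow> real set" where
  "zone j = {t. 0 \<le> t \<and> \<bar>t - real j * (pi / 2)\<bar> \<le> pi / 6}"

definition tau :: "nat \<Rightarrow> real" where
  "tau j = (THE t. t \<in> zone j \<and> f t = 0)"

lemma zone_sub: "j \<le> 2 * n \<Longrightarrow> zone j \<subseteq> {0..T}"
proof -
  assume "j \<le> 2 * n"
  then have "real j * (pi / 2) \<le> real (2 * n) * (pi / 2)" by (intro mult_right_mono) auto
  also have "\<dots> = real n * pi" by simp
  finally show ?thesis using T unfolding zone_def subset_iff mem_Collect_eq atLeastAtMost_iff by linarith
qed

lemma contf: "S \<subseteq> {0..T} \<Longrightarrow> continuous_on S f"
  by (rule continuous_on_subset[OF DERIV_continuous_on[OF der]])

lemma zone_slope: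
  assumes j: "j \<le> 2 * n" and st: "s \<in> zone j" "t \<in> zone j" "s \<le> t"
  shows "2 / 5 * (t - s) \<le> (-1) ^ j * (f t - f s)"
proof -
  have sub: "{s..t} \<subseteq> zone j"
    using st unfolding zone_def subset_iff mem_Collect_eq atLeastAtMost_iff by linarith
  then have sub': "{s..t} \<subseteq> {0..T}" using zone_sub[OF j] by blast
  obtain x where x: "x \<in> {s..t}" "f t - f s = f' x * (t - s)"
    using mvt_within[OF der sub' st(3)] by blast
  define y where "y = x - real j * (pi / 2)"
  have xy: "x = real j * (pi / 2) + y" by (simp add: y_def)
  have y: "\<bar>2 * y\<bar> \<le> pi / 3"
  proof -
    have "x \<in> zone j" using x(1) sub by blast
    then have "\<bar>y\<bar> \<le> pi / 6" by (simp only: zone_def mem_Collect_eq y_def)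
    then show ?thesis by (simp add: abs_mult)
  qed
  have "cos (pi / 3) \<le> cos \<bar>2 * y\<bar>"
    by (rule cos_monotone_0_pi_le) (use y in auto)
  then have c: "1 / 2 \<le> cos (2 * y)" by (simp add: cos_60)
  have "\<bar>f' x - cos (2 * x)\<bar> \<le> 1/10" using near' x(1) sub' by blast
  then have "\<bar>(-1) ^ j * (f' x - cos (2 * x))\<bar> \<le> 1/10" by (simp add: abs_mult power_abs)
  moreover have "(-1) ^ j * cos (2 * x) = cos (2 * y)"
    unfolding xy cos_double_shift by (simp flip: mult.assoc power_mult_distrib)
  ultimately have "\<bar>(-1) ^ j * f' x - cos (2 * y)\<bar> \<le> 1/10" by (simp only: right_diff_distrib)
  from abs_le_D2[OF this] c have "2 / 5 \<le> (-1) ^ j * f' x" by simp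
  then have "2 / 5 * (t - s) \<le> (-1) ^ j * f' x * (t - s)"
    using st(3) by (intro mult_right_mono) auto
  then show ?thesis by (simp add: x(2) mult.assoc)
qed

lemma sign_between:
  assumes j: "j < 2 * n" and t: "real j * (pi / 2) + pi / 6 \<le> t" "t \<le> real (Suc j) * (pi / 2) - pi / 6"
  shows "0 < (-1) ^ j * f t"
proof -
  define y where "y = t - real j * (pi / 2)"
  have ty: "t = real j * (pi / 2) + y" by (simp add: y_def)
  have y: "\<bar>2 * y - pi / 2\<bar> \<le> pi / 6"
  proof -
    have "real (Suc j) * (pi / 2) = real j * (pi / 2) + pi / 2" by (simp add: algebra_simps)
    then have "pi / 6 \<le> y \<and> y \<le> pi / 2 - pi / 6"
      using t unfolding y_def by linarith
    then show ?thesis unfolding abs_le_iff by (auto simp: field_simps)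
  qed
  have "cos (pi / 3) \<le> cos \<bar>2 * y - pi / 2\<bar>"
    by (rule cos_monotone_0_pi_le) (use y pi_gt_zero in linarith)+
  then have c: "1 / 2 \<le> sin (2 * y)" by (simp add: cos_60 cos_diff)
  have "real (Suc j) * (pi / 2) \<le> real (2 * n) * (pi / 2)"
    using j by (intro mult_right_mono) auto
  also have "\<dots> = real n * pi" by simp
  finally have "t \<le> T" using T t pi_gt_zero by linarith
  moreover have "0 \<le> t" using t(1) by (rule order_trans[rotated]) auto
  ultimately have "t \<in> {0..T}" by simp
  then have "\<bar>f t - sin t * cos t\<bar> \<le> 1/10" using near \<kappa> by force
  then have "\<bar>(-1) ^ j * (f t - sin t * cos t)\<bar> \<le> 1/10" by (simp add: abs_mult power_abs)
  moreover have "(-1) ^ j * (sin t * cos t) = sin (2 * y) / 2"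
    unfolding ty sin_cos_shift by (simp flip: mult.assoc power_mult_distrib)
  ultimately have "\<bar>(-1) ^ j * f t - sin (2 * y) / 2\<bar> \<le> 1/10" by (simp only: right_diff_distrib)
  from abs_le_D2[OF this] c show ?thesis by simp
qed

lemma center_small:
  assumes "j \<le> 2 * n"
  shows "\<bar>f (real j * (pi / 2))\<bar> \<le> \<kappa>" "real j * (pi / 2) \<in> zone j"
proof -
  show z: "real j * (pi / 2) \<in> zone j" by (simp add: zone_def)
  show "\<bar>f (real j * (pi / 2))\<bar> \<le> \<kappa>"
    using near[of "real j * (pi / 2)"] sin_cos_shift[of j 0] zone_sub[OF assms] z by auto
qed

lemma zero_unique:
  assumes "j \<le> 2 * n" "s \<in> zone j" "t \<in> zone j" "f s = 0" "f t = 0"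
  shows "s = t"
  using zone_slope[OF assms(1,2,3)] zone_slope[OF assms(1,3,2)] assms(4,5)
  by (cases "s \<le> t") auto

lemma zero_exists:
  assumes j: "j \<le> 2 * n"
  shows "\<exists>t\<in>zone j. f t = 0"
proof (cases "j = 0")
  \<comment> \<open>Zone 0 offers no room to the left of its center, so the intermediate value
    argument is replaced by the known zero of \<open>f\<close> at 0.\<close>
  case True
  then show ?thesis using f0 by (intro bexI[of _ 0]) (auto simp: zone_def)
next
  case False
  define c where "c = real j * (pi / 2)"
  have "1 * (pi / 2) \<le> c" using False unfolding c_def by (intro mult_right_mono) auto
  then have c: "pi / 2 \<le> c" by simp
  have z: "c \<in> zone j" "c - pi / 6 \<in> zone j" "c + pi / 6 \<in> zone j"
    using c pi_gt_zero unfolding zone_def mem_Collect_eq c_def[symmetric] by linarith+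
  have "\<bar>(-1) ^ j * f c\<bar> \<le> 1/10"
    using center_small[OF j] \<kappa> by (simp add: c_def abs_mult power_abs)
  \<comment> \<open>The gain of the slope over half a zone outweighs the value at the center, so
    \<open>f\<close> has opposite signs at the two ends of the zone.\<close>
  moreover have "2 / 5 * (pi / 6) > 1/10" using pi_gt3 by simp
  ultimately have s: "(-1) ^ j * f (c - pi / 6) \<le> 0" "0 \<le> (-1) ^ j * f (c + pi / 6)"
    using zone_slope[OF j z(2,1)] zone_slope[OF j z(1,3)] by (auto simp: right_diff_distrib)
  have "\<exists>t. c - pi / 6 \<le> t \<and> t \<le> c + pi / 6 \<and> (-1) ^ j * f t = 0"
  proof (rule IVT'[of "\<lambda>t. (-1) ^ j * f t", OF s])
    show "continuous_on {c - pi / 6..c + pi / 6} (\<lambda>t. (-1) ^ j * f t)"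
    proof (intro continuous_intros contf)
      have "{c - pi / 6..c + pi / 6} \<subseteq> zone j"
        using c pi_gt_zero unfolding zone_def subset_iff mem_Collect_eq atLeastAtMost_iff c_def[symmetric]
        by linarith
      then show "{c - pi / 6..c + pi / 6} \<subseteq> {0..T}" using zone_sub[OF j] by blast
    qed
  qed auto
  then obtain t where t: "c - pi / 6 \<le> t" "t \<le> c + pi / 6" "f t = 0" by auto
  have "t \<in> zone j" using t c pi_gt_zero unfolding zone_def mem_Collect_eq c_def[symmetric] by linarith
  then show ?thesis using t(3) by blast
qed

lemma tau:
  assumes j: "j \<le> 2 * n"
  shows "tau j \<in> zone j" "f (tau j) = 0"
    and "\<And>t. t \<in> zone j \<Longrightarrow> f t = 0 \<Longrightarrow> t = tau j"
proof -
  have "\<exists>!t. t \<in> zone j \<and> f t = 0"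
    using zero_exists[OF j] zero_unique[OF j] by blast
  from theI'[OF this] show "tau j \<in> zone j" "f (tau j) = 0"
    unfolding tau_def by auto
  then show "\<And>t. t \<in> zone j \<Longrightarrow> f t = 0 \<Longrightarrow> t = tau j"
    using zero_unique[OF j] by blast
qed

lemma tau_0 [simp]: "tau 0 = 0"
  using tau(3)[of 0 0] f0 by (auto simp: zone_def)

text \<open>The displacement of a zero is controlled by the value of \<open>f\<close>. This locates
  the zeros here and later yields their Lipschitz dependence on the ejection angle.\<close>

lemma tau_slope:
  assumes j: "j \<le> 2 * n" and t: "t \<in> zone j"
  shows "2 / 5 * \<bar>t - tau j\<bar> \<le> \<bar>f t\<bar>"
proof -
  have "\<bar>(-1) ^ j * f t\<bar> = \<bar>f t\<bar>" by (simp add: abs_mult power_abs)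
  then show ?thesis
    using zone_slope[OF j t tau(1)[OF j]] zone_slope[OF j tau(1)[OF j] t] tau(2)[OF j]
    by (cases "t \<le> tau j") auto
qed

lemma tau_near:
  assumes "j \<le> 2 * n"
  shows "\<bar>tau j - real j * (pi / 2)\<bar> \<le> 5 / 2 * \<kappa>"
  using order_trans[OF tau_slope[OF assms center_small(2)[OF assms]] center_small(1)[OF assms]]
  unfolding abs_minus_commute[of "tau j"] by simp

lemma tau_less:
  assumes "j < 2 * n"
  shows "tau j < tau (Suc j)"
proof -
  have "real (Suc j) * (pi / 2) = real j * (pi / 2) + pi / 2" by (simp add: algebra_simps)
  moreover have "\<bar>tau j - real j * (pi / 2)\<bar> \<le> pi / 6" "\<bar>tau (Suc j) - real (Suc j) * (pi / 2)\<bar> \<le> pi / 6"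
    using tau(1)[of j] tau(1)[of "Suc j"] assms by (auto simp: zone_def)
  ultimately show ?thesis using pi_gt_zero by linarith
qed

lemma tau_strict_mono: "i < j \<Longrightarrow> j \<le> 2 * n \<Longrightarrow> tau i < tau j"
proof (induction j)
  case (Suc j)
  then show ?case using tau_less[of j] by (cases "i = j") auto
qed simp

lemma tau_range: "j \<le> 2 * n \<Longrightarrow> 0 \<le> tau j" "j \<le> 2 * n \<Longrightarrow> tau j \<le> T"
  using tau(1)[of j] zone_sub[of j] by auto

lemma sign_between_tau:
  assumes j: "j < 2 * n" and t: "tau j < t" "t < tau (Suc j)"
  shows "0 < (-1) ^ j * f t"
proof -
  have j': "j \<le> 2 * n" "Suc j \<le> 2 * n" using j by auto
  note z = tau(1)[OF j'(1)] tau(1)[OF j'(2)]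
  have t0: "0 \<le> t" using tau_range(1)[OF j'(1)] t by simp
  consider "t \<le> real j * (pi / 2) + pi / 6" | "real (Suc j) * (pi / 2) - pi / 6 \<le> t"
    | "real j * (pi / 2) + pi / 6 \<le> t" "t \<le> real (Suc j) * (pi / 2) - pi / 6"
    by linarith
  then show ?thesis
  proof cases
    case 1
    then have "t \<in> zone j" using z(1) t t0 unfolding zone_def mem_Collect_eq by linarith
    from zone_slope[OF j'(1) z(1) this] t tau(2)[OF j'(1)] show ?thesis by simp
  next
    case 2
    then have "t \<in> zone (Suc j)" using z(2) t t0 unfolding zone_def mem_Collect_eq by linarith
    from zone_slope[OF j'(2) this z(2)] t tau(2)[OF j'(2)] show ?thesis by simp
  next
    case 3
    then show ?thesis by (rule sign_between[OF j])
  qed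
qed

lemma zero_is_tau:
  assumes "f t = 0" "0 \<le> t" "t \<le> tau (2 * n)"
  obtains j where "j \<le> 2 * n" "t = tau j"
proof (cases "t = tau (2 * n)")
  case False
  then have lt: "t < tau (2 * n)" using assms by simp
  \<comment> \<open>Nothing is known about \<open>tau\<close> beyond \<open>2 * n\<close>, but the
    least index does not get there because \<open>2 * n\<close> itself qualifies.\<close>
  define m where "m = (LEAST m. t < tau m)"
  have m: "t < tau m" "m \<le> 2 * n"
    using LeastI[of "\<lambda>m. t < tau m", OF lt] Least_le[of "\<lambda>m. t < tau m", OF lt] by (auto simp: m_def)
  have "m \<noteq> 0" using m assms by (cases m) auto
  then obtain j where j: "m = Suc j" by (cases m) auto
  have "tau j \<le> t" using not_less_Least[of j "\<lambda>m. t < tau m"] j m_def by auto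
  then show ?thesis
    using sign_between_tau[of j t] m j assms(1) that[of j] by (cases "t = tau j") auto
qed (use that in auto)

lemma between_tau:
  assumes "0 \<le> t" "t < tau (2 * n)"
  obtains j where "j < 2 * n" "tau j \<le> t" "t < tau (Suc j)"
proof -
  define m where "m = (LEAST m. t < tau m)"
  have m: "t < tau m" "m \<le> 2 * n"
    using LeastI[of "\<lambda>m. t < tau m", OF assms(2)] Least_le[of "\<lambda>m. t < tau m", OF assms(2)]
    by (auto simp: m_def)
  have "m \<noteq> 0" using m assms by (cases m) auto
  then obtain j where j: "m = Suc j" by (cases m) auto
  have "tau j \<le> t" using not_less_Least[of j "\<lambda>m. t < tau m"] j m_def by auto
  then show ?thesis using that[of j] m j by auto
qed

lemma primitive_mono:
  assumes rho: "\<And>t. t \<in> {0..T} \<Longrightarrow> (\<rho> has_real_derivative 2 * f t) (at t within {0..T})"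
    and j: "j < 2 * n" and st: "tau j \<le> s" "s < t" "t \<le> tau (Suc j)"
  shows "0 < (-1) ^ j * (\<rho> t - \<rho> s)"
proof -
  have sub: "{s..t} \<subseteq> {0..T}"
    using tau_range(1)[of j] tau_range(2)[of "Suc j"] j st by auto
  obtain x where x: "x \<in> {s<..<t}" "\<rho> t - \<rho> s = 2 * f x * (t - s)"
    using mvt_within_open[OF rho sub st(2)] by blast
  have "0 < (-1) ^ j * f x" using sign_between_tau[OF j] x(1) st by auto
  then have "0 < ((-1) ^ j * f x) * (2 * (t - s))" using st(2) by (intro mult_pos_pos[of "_ * _"]) auto
  then show ?thesis by (simp add: x(2) mult_ac)
qed

text \<open>\<open>rel_max_at\<close> is a weak inequality, so a stretch on which \<rho> is constant
  would contribute infinitely many points. Strict monotonicity between consecutive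
  \<open>tau\<close> leaves only the points with odd index.\<close>

lemma card_rel_max:
  assumes rho: "\<And>t. t \<in> {0..T} \<Longrightarrow> (\<rho> has_real_derivative 2 * f t) (at t within {0..T})"
  shows "card {s \<in> {0<..<tau (2 * n)}. rel_max_at \<rho> s} = n"
proof -
  have "{s \<in> {0<..<tau (2 * n)}. rel_max_at \<rho> s} = (\<lambda>k. tau (2 * k + 1)) ` {..<n}"
  proof (intro equalityI subsetI)
    fix s assume "s \<in> {s \<in> {0<..<tau (2 * n)}. rel_max_at \<rho> s}"
    then have s: "0 < s" "s < tau (2 * n)" and mx: "rel_max_at \<rho> s" by auto
    obtain j where j: "j < 2 * n" "tau j \<le> s" "s < tau (Suc j)"
      using between_tau[of s] s by auto
    have right: "\<exists>t. s < t \<and> t < b \<and> \<rho> t \<le> \<rho> s" if "s < b" for b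
    proof -
      have "\<forall>\<^sub>F t in at_right s. t \<in> {s<..<b}" using that by (rule eventually_at_right_real)
      moreover have "\<forall>\<^sub>F t in at_right s. \<rho> t \<le> \<rho> s"
        using mx unfolding rel_max_at_def eventually_at_split by simp
      ultimately have "\<forall>\<^sub>F t in at_right s. s < t \<and> t < b \<and> \<rho> t \<le> \<rho> s"
        by eventually_elim auto
      from eventually_happens[OF this] show ?thesis by simp
    qed
    have left: "\<exists>t. b < t \<and> t < s \<and> \<rho> t \<le> \<rho> s" if "b < s" for b
    proof -
      have "\<forall>\<^sub>F t in at_left s. t \<in> {b<..<s}" using that by (rule eventually_at_left_real)
      moreover have "\<forall>\<^sub>F t in at_left s. \<rho> t \<le> \<rho> s"
        using mx unfolding rel_max_at_def eventually_at_split by simp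
      ultimately have "\<forall>\<^sub>F t in at_left s. b < t \<and> t < s \<and> \<rho> t \<le> \<rho> s"
        by eventually_elim auto
      from eventually_happens[OF this] show ?thesis by simp
    qed
    have "odd j"
    proof
      assume "even j"
      obtain t where "s < t" "t < tau (Suc j)" "\<rho> t \<le> \<rho> s" using right j(3) by blast
      then show False using primitive_mono[OF rho j(1,2), of t] \<open>even j\<close> by auto
    qed
    moreover have "s = tau j"
    proof (rule ccontr)
      assume "s \<noteq> tau j"
      then obtain t where "tau j < t" "t < s" "\<rho> t \<le> \<rho> s" using left[of "tau j"] j(2) by auto
      then show False using primitive_mono[OF rho j(1), of t s] \<open>odd j\<close> j by auto
    qed
    ultimately show "s \<in> (\<lambda>k. tau (2 * k + 1)) ` {..<n}"
      using j(1) by (auto elim!: oddE)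
  next
    fix s assume "s \<in> (\<lambda>k. tau (2 * k + 1)) ` {..<n}"
    then obtain k where k: "k < n" "s = tau (2 * k + 1)" by auto
    have lt: "tau (2 * k) < s" "s < tau (2 * k + 2)"
      using tau_less[of "2 * k"] tau_less[of "2 * k + 1"] k by auto
    have "0 < s" "s < tau (2 * n)"
      using tau_strict_mono[of 0 "2 * k + 1"] tau_strict_mono[of "2 * k + 1" "2 * n"] k by auto
    moreover have "rel_max_at \<rho> s"
      unfolding rel_max_at_def eventually_at_topological
    proof (intro exI[of _ "{tau (2 * k)<..<tau (2 * k + 2)}"] conjI ballI impI)
      fix t assume t: "t \<in> {tau (2 * k)<..<tau (2 * k + 2)}" "t \<noteq> s"
      show "\<rho> t \<le> \<rho> s"
      proof (cases "t < s")
        case True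
        then show ?thesis using primitive_mono[OF rho, of "2 * k" t s] t k by auto
      next
        case False
        then show ?thesis using primitive_mono[OF rho, of "2 * k + 1" s t] t k by auto
      qed
    qed (use lt in auto)
    ultimately show "s \<in> {s \<in> {0<..<tau (2 * n)}. rel_max_at \<rho> s}" by auto
  qed
  moreover have "inj_on (\<lambda>k. tau (2 * k + 1)) {..<n}"
  proof (rule linorder_inj_onI')
    fix i j assume "i \<in> {..<n}" "j \<in> {..<n}" "i < j"
    then show "tau (2 * i + 1) \<noteq> tau (2 * j + 1)"
      using tau_strict_mono[of "2 * i + 1" "2 * j + 1"] by auto
  qed
  ultimately show ?thesis by (simp add: card_image)
qed

end

section \<open>The torque of the second primary\<close>

lemma cis_sq_Re_Im:
  "Re ((cis \<alpha> * of_real s)\<^sup>2) = s\<^sup>2 * cos (2 * \<alpha>)" "Im ((cis \<alpha> * of_real s)\<^sup>2) = s\<^sup>2 * sin (2 * \<alpha>)"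
proof -
  have "(cis \<alpha>)\<^sup>2 = cis (2 * \<alpha>)" by (simp add: power2_eq_square cis_mult)
  then have "(cis \<alpha> * of_real s)\<^sup>2 = of_real (s\<^sup>2) * cis (2 * \<alpha>)"
    by (simp add: power_mult_distrib)
  then show "Re ((cis \<alpha> * of_real s)\<^sup>2) = s\<^sup>2 * cos (2 * \<alpha>)" "Im ((cis \<alpha> * of_real s)\<^sup>2) = s\<^sup>2 * sin (2 * \<alpha>)"
    by (simp_all flip: of_real_power)
qed

lemma cmod_cis_real: "cmod (cis \<alpha> * of_real s) = \<bar>s\<bar>"
  by (simp add: norm_mult)

text \<open>As \<nu> tends to 0 this derivative becomes
  \<open>- 48 * s ^ 6 * cos (4 * \<alpha>)\<close>, the derivative of the limiting torque
  \<open>- 12 * s ^ 6 * sin (4 * \<alpha>)\<close>.\<close>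

lemma torque_rotation_deriv:
  assumes \<nu>: "0 < \<nu>" "\<nu> \<le> 1/100" and s: "\<bar>s\<bar> \<le> 1"
  defines "z \<equiv> \<lambda>\<alpha>. cis \<alpha> * of_real s"
  shows "((\<lambda>\<alpha>. torque \<nu> (z \<alpha>)) has_real_derivative
     - 8 * s ^ 4 * (2 * cos (2 * \<alpha>) * gf \<nu> (z \<alpha>) - 6 * s\<^sup>2 * (sin (2 * \<alpha>))\<^sup>2 * inverse (qf \<nu> (z \<alpha>)) ^ 5)) (at \<alpha>)"
proof -
  define d where "d \<beta> = 1 + \<nu> * (2 * (s\<^sup>2 * cos (2 * \<beta>)) + \<nu> * s ^ 4)" for \<beta>
  define sd where "sd \<beta> = sqrt (d \<beta>)" for \<beta>
  have z3: "cmod (z \<beta>) \<le> 3" for \<beta> using s by (simp add: z_def cmod_cis_real)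
  have q2: "d \<beta> = (qf \<nu> (z \<beta>))\<^sup>2" for \<beta>
    unfolding qf_sq d_def z_def cis_sq_Re_Im cmod_cis_real by simp
  have qs: "qf \<nu> (z \<beta>) = sd \<beta>" for \<beta>
    unfolding sd_def q2 by (simp add: qf_def)
  have q0: "sd \<beta> > 0" for \<beta> using qf_ge[of \<nu> "z \<beta>"] \<nu> z3 by (simp add: qs)
  have d0: "d \<alpha> > 0" using q0[of \<alpha>] by (simp add: sd_def)
  have "(d has_real_derivative - (4 * \<nu> * s\<^sup>2 * sin (2 * \<alpha>))) (at \<alpha>)"
    unfolding d_def by (auto intro!: derivative_eq_intros)
  then have sdd: "(sd has_real_derivative - (2 * \<nu> * s\<^sup>2 * sin (2 * \<alpha>)) * inverse (sd \<alpha>)) (at \<alpha>)"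
    unfolding sd_def
    by (rule DERIV_cong[OF DERIV_chain2[where f = sqrt and g = d, OF DERIV_real_sqrt[OF d0]]])
      (use d0 in \<open>simp add: field_simps\<close>)
  have tq: "torque \<nu> (z \<beta>) = - 8 * s ^ 4 * sin (2 * \<beta>) * ((1 - inverse (sd \<beta>) ^ 3) / \<nu>)" for \<beta>
    unfolding torque_def gf_eq[OF \<nu> z3] qs unfolding z_def cis_sq_Re_Im cmod_cis_real
    by (simp add: power2_eq_square eval_nat_numeral)
  have g: "gf \<nu> (z \<alpha>) = (1 - inverse (sd \<alpha>) ^ 3) / \<nu>"
    unfolding gf_eq[OF \<nu> z3] qs ..
  have 1: "((\<lambda>\<beta>. (1 - inverse (sd \<beta>) ^ 3) / \<nu>) has_real_derivative
      - (6 * s\<^sup>2 * sin (2 * \<alpha>) * inverse (sd \<alpha>) ^ 5)) (at \<alpha>)"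
    using sdd q0[of \<alpha>] \<nu>(1)
    by (auto intro!: derivative_eq_intros simp: field_simps eval_nat_numeral)
  have 2: "((\<lambda>\<beta>. - 8 * s ^ 4 * sin (2 * \<beta>)) has_real_derivative - 8 * s ^ 4 * (2 * cos (2 * \<alpha>))) (at \<alpha>)"
    by (auto intro!: derivative_eq_intros)
  show ?thesis
    unfolding tq g qs
    by (rule DERIV_cong[OF DERIV_mult[OF 2 1]]) (use \<nu>(1) in \<open>simp add: field_simps power2_eq_square\<close>)
qed

lemma torque_constants:
  obtains A where "A > 0"
    and "\<And>\<nu> z. 0 < \<nu> \<Longrightarrow> \<nu> \<le> 1/100 \<Longrightarrow> cmod z \<le> 3 \<Longrightarrow> \<bar>gf \<nu> z - 3 * Re (z\<^sup>2)\<bar> \<le> A * \<nu>"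
    and "\<And>\<nu> z. 0 < \<nu> \<Longrightarrow> \<nu> \<le> 1/100 \<Longrightarrow> cmod z \<le> 3 \<Longrightarrow> \<bar>inverse (qf \<nu> z) ^ 5 - 1\<bar> \<le> A * \<nu>"
proof -
  obtain A1 where A1: "A1 > 0" "\<forall>\<nu>\<in>{0..1/100}. \<forall>z\<in>cball 0 3. \<bar>gf \<nu> z - 3 * Re (z\<^sup>2)\<bar> \<le> A1 * \<nu>"
    using gf_approx by blast
  obtain A2 where A2: "A2 > 0" "\<forall>\<nu>\<in>{0..1/100}. \<forall>z\<in>cball 0 3. \<bar>inverse (qf \<nu> z) ^ 5 - 1\<bar> \<le> A2 * \<nu>"
    using inverse_qf5_approx by blast
  show thesis
  proof (rule that[of "A1 + A2"])
    fix \<nu> :: real and z assume *: "0 < \<nu>" "\<nu> \<le> 1/100" "cmod z \<le> 3"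
    then have "\<bar>gf \<nu> z - 3 * Re (z\<^sup>2)\<bar> \<le> A1 * \<nu>" "\<bar>inverse (qf \<nu> z) ^ 5 - 1\<bar> \<le> A2 * \<nu>"
      using A1(2) A2(2) by auto
    moreover have "0 \<le> A1 * \<nu>" "0 \<le> A2 * \<nu>" using A1 A2 * by auto
    ultimately show "\<bar>gf \<nu> z - 3 * Re (z\<^sup>2)\<bar> \<le> (A1 + A2) * \<nu>"
      "\<bar>inverse (qf \<nu> z) ^ 5 - 1\<bar> \<le> (A1 + A2) * \<nu>"
      unfolding distrib_right by linarith+
  qed (use A1 A2 in auto)
qed

lemma cos_4_near:
  assumes "\<bar>\<alpha> - real j * (pi / 4)\<bar> \<le> pi / 12"
  shows "1 / 2 \<le> (-1) ^ j * cos (4 * \<alpha>)"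
proof -
  define y where "y = \<alpha> - real j * (pi / 4)"
  have "4 * \<alpha> = real j * pi + 4 * y" by (simp add: y_def algebra_simps)
  then have "cos (4 * \<alpha>) = (-1) ^ j * cos (4 * y)" by (simp only: cos_add) simp
  then have e: "(-1) ^ j * cos (4 * \<alpha>) = cos (4 * y)" by (simp flip: mult.assoc power_mult_distrib)
  have "\<bar>4 * y\<bar> \<le> pi / 3" using assms unfolding y_def abs_mult by simp
  then have "cos (pi / 3) \<le> cos \<bar>4 * y\<bar>"
    by (intro cos_monotone_0_pi_le) (use pi_gt_zero in linarith)+
  then show ?thesis unfolding e by (simp add: cos_60)
qed

locale torque_bounds =
  fixes \<nu> A :: real
  assumes \<nu>: "0 < \<nu>" "\<nu> \<le> 1/100"
    and A: "\<And>z. cmod z \<le> 3 \<Longrightarrow> \<bar>gf \<nu> z - 3 * Re (z\<^sup>2)\<bar> \<le> A * \<nu>"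
      "\<And>z. cmod z \<le> 3 \<Longrightarrow> \<bar>inverse (qf \<nu> z) ^ 5 - 1\<bar> \<le> A * \<nu>"
    and A\<nu>: "A * \<nu> \<le> 1/1000"
begin

lemma torque_rotate:
  assumes s: "\<bar>s\<bar> \<le> 1" and le: "\<beta> \<le> \<alpha>"
    and near: "\<bar>\<alpha> - real j * (pi / 4)\<bar> \<le> pi / 12" "\<bar>\<beta> - real j * (pi / 4)\<bar> \<le> pi / 12"
  shows "(18 * s\<^sup>2 - 7) * (\<alpha> - \<beta>)
    \<le> (-1) ^ Suc j * (torque \<nu> (cis \<alpha> * of_real s) - torque \<nu> (cis \<beta> * of_real s))"
proof -
  define h where "h \<alpha> = torque \<nu> (cis \<alpha> * of_real s)" for \<alpha>
  define h' where "h' \<alpha> = - 8 * s ^ 4 * (2 * cos (2 * \<alpha>) * gf \<nu> (cis \<alpha> * of_real s)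
      - 6 * s\<^sup>2 * (sin (2 * \<alpha>))\<^sup>2 * inverse (qf \<nu> (cis \<alpha> * of_real s)) ^ 5)" for \<alpha>
  have "(h has_real_derivative h' x) (at x within UNIV)" for x
    unfolding h_def h'_def using torque_rotation_deriv[OF \<nu> s] by simp
  from mvt_within[of UNIV h h', OF this _ le] obtain x
    where x: "x \<in> {\<beta>..\<alpha>}" "h \<alpha> - h \<beta> = h' x * (\<alpha> - \<beta>)" by auto
  define z where "z = cis x * complex_of_real s"
  have z3: "cmod z \<le> 3" using s by (simp add: z_def cmod_cis_real)
  define u where "u = gf \<nu> z - 3 * (s\<^sup>2 * cos (2 * x))"
  define w where "w = inverse (qf \<nu> z) ^ 5 - 1"
  have u: "\<bar>u\<bar> \<le> 1/1000" and w: "\<bar>w\<bar> \<le> 1/1000"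
    using A[OF z3] A\<nu> by (auto simp: u_def w_def z_def cis_sq_Re_Im)
  have s2: "0 \<le> s\<^sup>2" "s\<^sup>2 \<le> 1" using s by (auto simp: abs_square_le_1)
  have s4: "s ^ 4 \<le> 1" "s ^ 6 \<le> 1" "0 \<le> s ^ 4" "0 \<le> s ^ 6"
    using power_le_one[OF s2, of 2] power_le_one[OF s2, of 3] by (simp_all flip: power_mult)
  define er where "er = - 16 * (s ^ 4 * (cos (2 * x) * u)) + 48 * (s ^ 6 * ((sin (2 * x))\<^sup>2 * w))"
  have h'x: "h' x = - 48 * s ^ 6 * cos (4 * x) + er"
  proof -
    have c4: "cos (4 * x) = (cos (2 * x))\<^sup>2 - (sin (2 * x))\<^sup>2"
      using cos_double[of "2 * x"] by simp
    have gw: "gf \<nu> z = u + 3 * (s\<^sup>2 * cos (2 * x))" "inverse (qf \<nu> z) ^ 5 = w + 1"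
      by (simp_all add: u_def w_def)
    have s6: "s ^ 6 = s ^ 4 * s\<^sup>2" by (simp flip: power_add)
    show ?thesis
      unfolding h'_def z_def[symmetric] er_def c4 gw s6 by (simp add: algebra_simps power2_eq_square)
  qed
  have am: "\<bar>a * b\<bar> \<le> c * d" if "\<bar>a\<bar> \<le> c" "\<bar>b\<bar> \<le> d" for a b c d :: real
    unfolding abs_mult using that abs_ge_zero[of a] by (intro mult_mono) linarith+
  have "\<bar>s ^ 4\<bar> \<le> 1" "\<bar>s ^ 6\<bar> \<le> 1" "\<bar>(sin (2 * x))\<^sup>2\<bar> \<le> 1"
    using s4 by (simp_all add: abs_square_le_1)
  from am[OF this(1) am[OF abs_cos_le_one u]] am[OF this(2) am[OF this(3) w]]
  have "\<bar>s ^ 4 * (cos (2 * x) * u)\<bar> \<le> 1/1000" "\<bar>s ^ 6 * ((sin (2 * x))\<^sup>2 * w)\<bar> \<le> 1/1000"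
    by simp_all
  then have "\<bar>er\<bar> \<le> 1" unfolding er_def by linarith
  then have "\<bar>(-1) ^ Suc j * er\<bar> \<le> 1"
    by (simp add: abs_mult power_abs)
  from abs_le_D2[OF this] have e: "- 1 \<le> (-1) ^ Suc j * er"
    by linarith
  have "\<bar>x - real j * (pi / 4)\<bar> \<le> pi / 12"
    using near x(1) unfolding atLeastAtMost_iff abs_le_iff by linarith
  from cos_4_near[OF this] have "48 * s ^ 6 * (1 / 2) \<le> 48 * s ^ 6 * ((-1) ^ j * cos (4 * x))"
    using s4 by (intro mult_left_mono) auto
  also have "\<dots> = (-1) ^ Suc j * (- 48 * s ^ 6 * cos (4 * x))" by simp
  finally have "48 * s ^ 6 * (1 / 2) + - 1 \<le> (-1) ^ Suc j * h' x"
    unfolding h'x distrib_left by (intro add_mono e)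
  then have "24 * s ^ 6 - 1 \<le> (-1) ^ Suc j * h' x" by simp
  \<comment> \<open>The right side is at least the tangent line of \<open>24 * x ^ 3\<close> at
    \<open>x = 1/2\<close>, with \<open>x = s\<^sup>2\<close>. Over a passage only a square of the
    sine then has to be integrated instead of a sixth power.\<close>
  moreover have "18 * s\<^sup>2 - 6 \<le> 24 * s ^ 6"
  proof -
    have "24 * s ^ 6 - (18 * s\<^sup>2 - 6) = 24 * ((s\<^sup>2 - 1/2)\<^sup>2 * (s\<^sup>2 + 1))"
      by (simp add: power2_eq_square eval_nat_numeral algebra_simps)
    moreover have "0 \<le> (s\<^sup>2 - 1/2)\<^sup>2 * (s\<^sup>2 + 1)" by simp
    ultimately show ?thesis by linarith
  qed
  ultimately have "18 * s\<^sup>2 - 7 \<le> (-1) ^ Suc j * h' x" by linarith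
  then have "(18 * s\<^sup>2 - 7) * (\<alpha> - \<beta>) \<le> (-1) ^ Suc j * h' x * (\<alpha> - \<beta>)"
    using le by (intro mult_right_mono) auto
  also have "\<dots> = (-1) ^ Suc j * (h \<alpha> - h \<beta>)" by (simp add: x(2))
  finally show ?thesis by (simp add: h_def)
qed

lemma torque_cont: "continuous_on S (\<lambda>t. torque \<nu> (w t))"
  if w: "continuous_on S w" and w3: "\<And>t. t \<in> S \<Longrightarrow> cmod (w t) \<le> 3" for S :: "real set"
proof -
  have "qf \<nu> (w t) \<noteq> 0" "qf \<nu> (w t) + 1 \<noteq> 0" if "t \<in> S" for t
    using qf_ge[of \<nu> "w t"] \<nu> w3[OF that] by auto
  moreover have "continuous_on S (\<lambda>t. qf \<nu> (w t))"
    unfolding qf_def by (intro continuous_intros w)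
  ultimately show ?thesis
    unfolding torque_def gf_def by (intro continuous_intros w) auto
qed

definition pass_torque :: "real \<Rightarrow> real \<Rightarrow> real" where
  "pass_torque \<epsilon> \<theta> = integral {0..pi} (\<lambda>t. torque \<nu> (Z0 \<epsilon> \<theta> t))"

lemma Z0_le_1: "cmod (Z0 \<epsilon> \<theta> t) \<le> 1"
  by (simp add: cmod_Z0)

lemma cont_Z0: "continuous_on S (Z0 \<epsilon> \<theta>)"
  by (rule continuous_on_vector_derivative) (rule Z0_deriv)

lemma cont_torque_Z0: "continuous_on S (\<lambda>t. torque \<nu> (Z0 \<epsilon> \<theta> t))"
proof (intro torque_cont cont_Z0)
  show "cmod (Z0 \<epsilon> \<theta> t) \<le> 3" for t using Z0_le_1[of \<epsilon> \<theta> t] by simp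
qed

text \<open>The bound of \<open>torque_rotate\<close> is integrated along the passage, and
  \<open>9 * pi - 7 * pi = 2 * pi\<close>. The window \<open>pi / 20\<close> leaves
  \<open>pi / 30\<close> for the rotation of the frame within the window \<open>pi / 12\<close> of
  that lemma.\<close>

lemma pass_torque_mono:
  assumes \<epsilon>: "0 \<le> \<epsilon>" "\<epsilon> \<le> 1/1000" and le: "\<beta> \<le> \<alpha>"
    and near: "\<bar>\<alpha> - real j * (pi / 4)\<bar> \<le> pi / 20" "\<bar>\<beta> - real j * (pi / 4)\<bar> \<le> pi / 20"
  shows "2 * pi * (\<alpha> - \<beta>) \<le> (-1) ^ Suc j * (pass_torque \<epsilon> \<alpha> - pass_torque \<epsilon> \<beta>)"
proof -
  have int: "(\<lambda>t. torque \<nu> (Z0 \<epsilon> \<theta> t)) integrable_on {0..pi}" for \<theta>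
    by (intro integrable_continuous_real cont_torque_Z0)
  have sin2: "((\<lambda>t. (18 * (sin t)\<^sup>2 - 7) * (\<alpha> - \<beta>)) has_integral
      ((9 * (pi - sin pi * cos pi) - 7 * pi) * (\<alpha> - \<beta>) - (9 * (0 - sin 0 * cos 0) - 7 * 0) * (\<alpha> - \<beta>))) {0..pi}"
  proof (rule fundamental_theorem_of_calculus)
    fix t
    have "((\<lambda>t. (9 * psi 1 t - 7 * t) * (\<alpha> - \<beta>)) has_real_derivative
        (18 * (sin t)\<^sup>2 - 7) * (\<alpha> - \<beta>)) (at t within {0..pi})"
      by (auto intro!: derivative_eq_intros)
    then show "((\<lambda>t. (9 * (t - sin t * cos t) - 7 * t) * (\<alpha> - \<beta>)) has_vector_derivative
        (18 * (sin t)\<^sup>2 - 7) * (\<alpha> - \<beta>)) (at t within {0..pi})"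
      by (simp add: psi_def has_real_derivative_iff_has_vector_derivative)
  qed simp
  have "2 * pi * (\<alpha> - \<beta>) = integral {0..pi} (\<lambda>t. (18 * (sin t)\<^sup>2 - 7) * (\<alpha> - \<beta>))"
    using integral_unique[OF sin2] by (simp add: algebra_simps)
  also have "\<dots> \<le> integral {0..pi} (\<lambda>t. (-1) ^ Suc j * (torque \<nu> (Z0 \<epsilon> \<alpha> t) - torque \<nu> (Z0 \<epsilon> \<beta> t)))"
  proof (rule integral_le)
    show "(\<lambda>t. (18 * (sin t)\<^sup>2 - 7) * (\<alpha> - \<beta>)) integrable_on {0..pi}"
      using sin2 by (rule has_integral_integrable)
    show "(\<lambda>t. (-1) ^ Suc j * (torque \<nu> (Z0 \<epsilon> \<alpha> t) - torque \<nu> (Z0 \<epsilon> \<beta> t))) integrable_on {0..pi}"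
      by (intro integrable_on_mult_right integrable_diff int)
    fix t assume t: "t \<in> {0..pi}"
    have p: "0 \<le> psi \<epsilon> t" "psi \<epsilon> t \<le> 1/1000 * (pi + 1)"
      using psi_bounds[of \<epsilon> t] \<epsilon> t mult_mono[of \<epsilon> "1/1000" "t + 1" "pi + 1"] by auto
    have p': "psi \<epsilon> t \<le> pi / 30" using p(2) pi_gt3 by simp
    have "(18 * (sin t)\<^sup>2 - 7) * ((\<alpha> - psi \<epsilon> t) - (\<beta> - psi \<epsilon> t))
      \<le> (-1) ^ Suc j * (torque \<nu> (cis (\<alpha> - psi \<epsilon> t) * of_real (sin t)) - torque \<nu> (cis (\<beta> - psi \<epsilon> t) * of_real (sin t)))"
    proof (rule torque_rotate)
      define c where "c = real j * (pi / 4)"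
      show "\<bar>\<alpha> - psi \<epsilon> t - real j * (pi / 4)\<bar> \<le> pi / 12" "\<bar>\<beta> - psi \<epsilon> t - real j * (pi / 4)\<bar> \<le> pi / 12"
        using near p(1) p' unfolding c_def[symmetric] by linarith+
    qed (use le in auto)
    then show "(18 * (sin t)\<^sup>2 - 7) * (\<alpha> - \<beta>)
      \<le> (-1) ^ Suc j * (torque \<nu> (Z0 \<epsilon> \<alpha> t) - torque \<nu> (Z0 \<epsilon> \<beta> t))"
      by (simp add: Z0_def)
  qed
  also have "\<dots> = (-1) ^ Suc j * (pass_torque \<epsilon> \<alpha> - pass_torque \<epsilon> \<beta>)"
    unfolding pass_torque_def by (simp add: integral_diff[OF int int])
  finally show ?thesis .
qed

text \<open>On the diagonal \<open>Re (z\<^sup>2)\<close> vanishes except for the small rotation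
  \<open>psi\<close> of the frame, so \<open>gf\<close> and with it the torque stay small during the
  whole passage.\<close>

lemma pass_torque_quarter:
  assumes \<epsilon>: "0 \<le> \<epsilon>" "\<epsilon> \<le> 1/20000"
  shows "\<bar>pass_torque \<epsilon> (pi / 4)\<bar> \<le> 1/10"
proof -
  have "\<bar>pass_torque \<epsilon> (pi / 4)\<bar> \<le> integral {0..pi} (\<lambda>t. 1/50)"
    unfolding pass_torque_def real_norm_def[symmetric]
  proof (rule integral_norm_bound_integral)
    show "(\<lambda>t. torque \<nu> (Z0 \<epsilon> (pi / 4) t)) integrable_on {0..pi}"
      by (intro integrable_continuous_real cont_torque_Z0)
    show "(\<lambda>t. 1 / 50 :: real) integrable_on {0..pi}" by (simp add: integrable_const_ivl)
    fix t assume t: "t \<in> {0..pi}"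
    have p: "0 \<le> psi \<epsilon> t" "psi \<epsilon> t \<le> 1/20000 * (pi + 1)"
      using psi_bounds[of \<epsilon> t] \<epsilon> t mult_mono[of \<epsilon> "1/20000" "t + 1" "pi + 1"] by auto
    then have p': "psi \<epsilon> t \<le> 1/4000" using pi_less_4 by simp
    define z where "z = cis (pi / 4 - psi \<epsilon> t) * complex_of_real (sin t)"
    have z1: "cmod z \<le> 1" by (simp add: z_def cmod_cis_real)
    have "Re (z\<^sup>2) = (sin t)\<^sup>2 * sin (2 * psi \<epsilon> t)"
      unfolding z_def cis_sq_Re_Im by (simp add: right_diff_distrib cos_diff)
    moreover have "\<bar>(sin t)\<^sup>2 * sin (2 * psi \<epsilon> t)\<bar> \<le> 1 * (2 * psi \<epsilon> t)"
      unfolding abs_mult using abs_sin_x_le_abs_x[of "2 * psi \<epsilon> t"] p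
      by (intro mult_mono) (auto simp: abs_square_le_1)
    ultimately have "\<bar>gf \<nu> z\<bar> \<le> 1/1000 + 3 * (2 * (1/4000))"
      using A(1)[of z] A\<nu> z1 p' by linarith
    then have g: "\<bar>gf \<nu> z\<bar> \<le> 1/400" by simp
    have "\<bar>torque \<nu> z\<bar> = 8 * ((cmod z)\<^sup>2 * (\<bar>Im (z\<^sup>2)\<bar> * \<bar>gf \<nu> z\<bar>))"
      by (simp add: torque_def abs_mult)
    also have "\<dots> \<le> 8 * (1 * (1 * (1/400)))"
    proof -
      have "cmod (z\<^sup>2) \<le> 1" using z1 by (simp add: norm_power power_le_one)
      then have "\<bar>Im (z\<^sup>2)\<bar> \<le> 1" using abs_Im_le_cmod[of "z\<^sup>2"] by linarith
      then show ?thesis using g z1 by (intro mult_left_mono mult_mono) (auto simp: power_le_one)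
    qed
    finally show "norm (torque \<nu> (Z0 \<epsilon> (pi / 4) t)) \<le> 1/50" by (simp add: z_def Z0_def)
  qed
  also have "\<dots> \<le> 1/10" using pi_less_4 by simp
  finally show ?thesis .
qed

text \<open>After \<open>k\<close> passages \<open>Z0\<close> has changed sign \<open>k\<close>
  times and the frame has turned by \<open>k * \<epsilon> * pi\<close>. The torque is even in
  \<open>z\<close>, so passage \<open>k\<close> is a first passage with a shifted ejection
  angle.\<close>

lemma torque_sum:
  "integral {0..real k * pi} (\<lambda>t. torque \<nu> (Z0 \<epsilon> \<theta> t)) = (\<Sum>i<k. pass_torque \<epsilon> (\<theta> - real i * \<epsilon> * pi))"
proof (induction k)
  case (Suc k)
  define F where "F = (\<lambda>t. torque \<nu> (Z0 \<epsilon> \<theta> t))"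
  have F: "F (x + real k * pi) = torque \<nu> (Z0 \<epsilon> (\<theta> - real k * \<epsilon> * pi) x)" for x
  proof -
    have "Z0 \<epsilon> \<theta> (x + pi * real k) = (-1) ^ k * Z0 \<epsilon> (\<theta> - real k * \<epsilon> * pi) x"
      unfolding Z0_def psi_shift sin_add by (simp add: algebra_simps)
    then show ?thesis by (cases "even k") (auto simp: F_def mult.commute)
  qed
  have "integral {0..real (Suc k) * pi} F = integral {0..real k * pi} F + integral {real k * pi..real (Suc k) * pi} F"
    by (rule Henstock_Kurzweil_Integration.integral_combine[symmetric])
      (auto simp: F_def intro!: integrable_continuous_real cont_torque_Z0)
  also have "integral {real k * pi..real (Suc k) * pi} F = integral {0 + real k * pi..pi + real k * pi} F"
    by (simp add: algebra_simps)
  also have "\<dots> = integral {0..pi} (F \<circ> (+) (real k * pi))"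
    by (rule integral_shift_Icc_real[symmetric])
  also have "\<dots> = pass_torque \<epsilon> (\<theta> - real k * \<epsilon> * pi)"
    by (simp add: o_def F pass_torque_def add.commute[of "real k * pi"])
  finally show ?case using Suc by (simp add: F_def)
qed simp

end

section \<open>Close encounters of ejection orbits\<close>

text \<open>If the first \<open>k\<close> terms summed to at most \<open>e\<close>, the last of
  them, being the smallest, would be at most \<open>e\<close>. Every later term would then be at
  most \<open>e - d < 0\<close>, and the whole sum at most \<open>2 * e - d < - e\<close>.\<close>

lemma partial_sum_gt:
  fixes a :: "nat \<Rightarrow> real"
  assumes gap: "\<And>i. Suc i < n \<Longrightarrow> a (Suc i) + d \<le> a i" and d: "0 < d" and k: "0 < k" "k < n"
    and sum: "\<bar>\<Sum>i<n. a i\<bar> \<le> e" and e: "3 * e < d"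
  shows "e < (\<Sum>i<k. a i)"
proof (rule ccontr)
  assume "\<not> e < (\<Sum>i<k. a i)"
  then have le: "(\<Sum>i<k. a i) \<le> e" by simp
  have dec: "a j \<le> a i" if "i \<le> j" "j < n" for i j
    using that
  proof (induction j rule: dec_induct)
    case (step j)
    then show ?case using gap[of j] d by simp
  qed simp
  have e0: "0 \<le> e" using sum by linarith
  have "a (k - 1) \<le> e"
  proof (rule ccontr)
    assume *: "\<not> a (k - 1) \<le> e"
    have "(\<Sum>i<k. e) < (\<Sum>i<k. a i)"
    proof (rule sum_strict_mono)
      fix i assume "i \<in> {..<k}"
      then have "i \<le> k - 1" "k - 1 < n" using k by auto
      then show "e < a i" using dec[of i "k - 1"] * by linarith
    qed (use k in auto)
    moreover have "1 * e \<le> real k * e" using k e0 by (intro mult_right_mono) auto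
    ultimately show False using le by simp
  qed
  then have neg: "a i \<le> e - d" if "k \<le> i" "i < n" for i
    using dec[OF that] gap[of "k - 1"] k by simp
  have 1: "(\<Sum>i<n. a i) = (\<Sum>i<k. a i) + (\<Sum>i\<in>{k..<n}. a i)"
    using k by (simp add: sum.atLeastLessThan_concat[of 0 k n, symmetric] lessThan_atLeast0)
  have "(\<Sum>i\<in>{k..<n}. a i) \<le> (\<Sum>i\<in>{k..<n}. e - d)"
    by (intro sum_mono) (use neg in auto)
  also have "\<dots> \<le> 1 * (e - d)"
  proof -
    have "real (n - k) * (e - d) \<le> 1 * (e - d)"
      using k e e0 by (intro mult_right_mono_neg) auto
    then show ?thesis by simp
  qed
  finally have "(\<Sum>i<n. a i) \<le> e + 1 * (e - d)" unfolding 1 by (intro add_mono le)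
  then show False using abs_le_D2[OF sum] e by simp
qed

text \<open>The ejection velocity is only required to have modulus 1, so that negation and time
  reversal preserve the notion; the angle is brought into the interval from 0 to \<open>pi\<close>
  at the end.\<close>

definition ec_solution :: "real \<Rightarrow> real \<Rightarrow> real \<Rightarrow> nat \<Rightarrow> real \<Rightarrow> (real \<Rightarrow> complex \<times> complex) \<Rightarrow> bool" where
  "ec_solution \<epsilon> \<nu> \<mu> n T Y \<longleftrightarrow> 0 < T \<and> lc_sol \<epsilon> \<nu> \<mu> T Y \<and> fst (Y 0) = 0 \<and> cmod (snd (Y 0)) = 1 \<and>
     fst (Y T) = 0 \<and> (\<forall>t\<in>{0<..<T}. fst (Y t) \<noteq> 0) \<and>
     card {t \<in> {0<..<T}. rel_max_at (\<lambda>t. (cmod (fst (Y t)))\<^sup>2) t} = n"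

text \<open>In the plane of \<open>z\<^sup>2\<close> the orbit stays near the segment from 0 to
  \<open>d\<close> and comes near its tip. The radius \<open>9/20\<close> is less than half the
  distance 1 that separates a tip from the other three directions, so orbits along different
  \<open>d\<close> have different projections.\<close>

definition along :: "complex \<Rightarrow> real \<Rightarrow> (real \<Rightarrow> complex \<times> complex) \<Rightarrow> bool" where
  "along d T Y \<longleftrightarrow> (\<exists>t\<in>{0..T}. cmod ((fst (Y t))\<^sup>2 - d) \<le> 9/20) \<and>
     (\<forall>t\<in>{0..T}. \<exists>y\<in>{0..1}. cmod ((fst (Y t))\<^sup>2 - d * of_real y) \<le> 9/20)"

text \<open>Of the three smallness conditions, the first makes \<open>C * \<epsilon>\<^sup>2\<close>
  a tiny fraction of \<epsilon> and keeps the derivative of \<open>radial\<close> near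
  \<open>cos (2 * t)\<close>, the second brings the error of the accumulated torque below
  \<epsilon>, and the third bounds the total rotation of the frame by \<open>1/200\<close>.\<close>

locale lc_orbits = torque_bounds \<nu> A for \<nu> A +
  fixes n :: nat and \<epsilon> \<mu> T C E B :: real and Y :: "real \<Rightarrow> real \<Rightarrow> complex \<times> complex"
  assumes n: "1 \<le> n" and T: "real n * pi + pi / 6 \<le> T" and \<epsilon>0: "0 < \<epsilon>" and \<mu>: "0 < \<mu>" "\<mu> < 1"
    and Y_0: "\<And>\<theta>. Y \<theta> 0 = (0, cis \<theta>)" and sol: "\<And>\<theta>. lc_sol \<epsilon> \<nu> \<mu> T (Y \<theta>)"
    and Y_near: "\<And>\<theta> t. t \<in> {0..T} \<Longrightarrow> norm (Y \<theta> t - (Z0 \<epsilon> \<theta> t, P0 \<epsilon> \<theta> t)) \<le> C * \<epsilon>\<^sup>2"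
    and Y_lip: "\<And>\<theta> \<theta>' t. t \<in> {0..T} \<Longrightarrow> norm (Y \<theta> t - Y \<theta>' t) \<le> E * \<bar>\<theta> - \<theta>'\<bar>"
    and B: "\<And>z. cmod z \<le> 3 \<Longrightarrow> \<bar>torque \<nu> z\<bar> \<le> B" "\<And>z. cmod z \<le> 3 \<Longrightarrow> cmod (Gf \<mu> \<nu> z) \<le> B"
      "\<And>z w. cmod z \<le> 3 \<Longrightarrow> cmod w \<le> 3 \<Longrightarrow> \<bar>torque \<nu> z - torque \<nu> w\<bar> \<le> B * cmod (z - w)"
    and C0: "0 < C" "0 < E" "0 < B"
    and small: "\<epsilon> * (1000 + 10 * C + 3 * B) \<le> 1 / 20000" "\<epsilon> * (B * C * (T + 10)) \<le> 1" "\<epsilon> * (T + 1) \<le> 1/200"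
begin

lemma \<epsilon>_small: "\<epsilon> \<le> 1/20000" "\<epsilon> * C \<le> 1/200000" "C * \<epsilon>\<^sup>2 \<le> 1/200000 * \<epsilon>" "C * \<epsilon>\<^sup>2 \<le> 1/1000000"
proof -
  have "0 \<le> \<epsilon> * C" "0 \<le> \<epsilon> * B" using \<epsilon>0 C0 by auto
  then show 1: "\<epsilon> \<le> 1/20000" "\<epsilon> * C \<le> 1/200000"
    using small(1) \<epsilon>0 by (auto simp: algebra_simps)
  show 2: "C * \<epsilon>\<^sup>2 \<le> 1/200000 * \<epsilon>"
    using mult_right_mono[OF 1(2), of \<epsilon>] \<epsilon>0 by (simp add: power2_eq_square algebra_simps)
  show "C * \<epsilon>\<^sup>2 \<le> 1/1000000" using 1(1) 2 by simp
qed

lemma n\<epsilon>: "real n * \<epsilon> * pi \<le> 1/200"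
proof -
  have "real n * pi \<le> T + 1" using T pi_gt_zero by linarith
  then have "\<epsilon> * (real n * pi) \<le> \<epsilon> * (T + 1)" using \<epsilon>0 by (intro mult_left_mono) auto
  then show ?thesis using small(3) by (simp add: algebra_simps)
qed

abbreviation "z \<theta> t \<equiv> fst (Y \<theta> t)"
abbreviation "p \<theta> t \<equiv> snd (Y \<theta> t)"

lemma T0: "0 < T"
  by (rule less_le_trans[OF _ T]) (auto intro: add_nonneg_pos)

lemma near:
  assumes "t \<in> {0..T}"
  shows "cmod (z \<theta> t - Z0 \<epsilon> \<theta> t) \<le> C * \<epsilon>\<^sup>2" "cmod (p \<theta> t - P0 \<epsilon> \<theta> t) \<le> C * \<epsilon>\<^sup>2"
  using Y_near[OF assms, of \<theta>] norm_fst_le[of "z \<theta> t - Z0 \<epsilon> \<theta> t" "p \<theta> t - P0 \<epsilon> \<theta> t"]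
    norm_snd_le[of "p \<theta> t - P0 \<epsilon> \<theta> t" "z \<theta> t - Z0 \<epsilon> \<theta> t"]
  by (cases "Y \<theta> t"; simp)+

lemma lip:
  assumes "t \<in> {0..T}"
  shows "cmod (z \<theta> t - z \<theta>' t) \<le> E * \<bar>\<theta> - \<theta>'\<bar>" "cmod (p \<theta> t - p \<theta>' t) \<le> E * \<bar>\<theta> - \<theta>'\<bar>"
  using Y_lip[OF assms, of \<theta> \<theta>'] norm_fst_le[of "z \<theta> t - z \<theta>' t" "p \<theta> t - p \<theta>' t"]
    norm_snd_le[of "p \<theta> t - p \<theta>' t" "z \<theta> t - z \<theta>' t"]
  by (cases "Y \<theta> t"; cases "Y \<theta>' t"; simp)+

lemma z3: "t \<in> {0..T} \<Longrightarrow> cmod (z \<theta> t) \<le> 3" and p3: "t \<in> {0..T} \<Longrightarrow> cmod (p \<theta> t) \<le> 3"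
  using lc_solD(4,5)[OF sol] by auto

lemma P0_le: "cmod (P0 \<epsilon> \<theta> t) \<le> 3/2"
  using cmod_P0_le[of \<epsilon> \<theta> t] \<epsilon>0 \<epsilon>_small(1) by simp

lemma cnj_mult_diff: "cmod (cnj a * b - cnj c * d) \<le> cmod (a - c) * cmod b + cmod c * cmod (b - d)"
proof -
  have "cnj a * b - cnj c * d = cnj (a - c) * b + cnj c * (b - d)" by (simp add: algebra_simps)
  then show ?thesis by (metis norm_triangle_ineq norm_mult complex_mod_cnj)
qed

lemma radial_near:
  assumes t: "t \<in> {0..T}"
  shows "\<bar>radial (Y \<theta> t) - sin t * cos t\<bar> \<le> 4 * (C * \<epsilon>\<^sup>2)"
proof -
  have "cnj (Z0 \<epsilon> \<theta> t) * P0 \<epsilon> \<theta> t = (cis (\<theta> - psi \<epsilon> t) * cnj (cis (\<theta> - psi \<epsilon> t)))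
      * (of_real (sin t) * Complex (cos t) (- 2 * \<epsilon> * sin t ^ 3))"
    unfolding Z0_def P0_def by (simp only: complex_cnj_mult complex_cnj_complex_of_real mult_ac)
  also have "cis (\<theta> - psi \<epsilon> t) * cnj (cis (\<theta> - psi \<epsilon> t)) = 1" by (simp add: cis_cnj cis_mult)
  finally have "Re (cnj (Z0 \<epsilon> \<theta> t) * P0 \<epsilon> \<theta> t) = sin t * cos t" by simp
  then have "\<bar>radial (Y \<theta> t) - sin t * cos t\<bar> \<le> cmod (cnj (z \<theta> t) * p \<theta> t - cnj (Z0 \<epsilon> \<theta> t) * P0 \<epsilon> \<theta> t)"
    unfolding radial_def by (metis abs_Re_le_cmod minus_complex.simps(1))
  also have "\<dots> \<le> cmod (z \<theta> t - Z0 \<epsilon> \<theta> t) * cmod (p \<theta> t) + cmod (Z0 \<epsilon> \<theta> t) * cmod (p \<theta> t - P0 \<epsilon> \<theta> t)"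
    by (rule cnj_mult_diff)
  also have "\<dots> \<le> (C * \<epsilon>\<^sup>2) * 3 + 1 * (C * \<epsilon>\<^sup>2)"
    using near[OF t, of \<theta>] p3[OF t, of \<theta>] Z0_le_1[of \<epsilon> \<theta> t] C0 by (intro add_mono mult_mono) auto
  finally show ?thesis by simp
qed

lemma sq_diff_le:
  assumes "cmod (a - b) \<le> e" "cmod a + cmod b \<le> c" "0 \<le> e"
  shows "\<bar>(cmod a)\<^sup>2 - (cmod b)\<^sup>2\<bar> \<le> c * e"
proof -
  have "\<bar>(cmod a)\<^sup>2 - (cmod b)\<^sup>2\<bar> = (cmod a + cmod b) * \<bar>cmod a - cmod b\<bar>"
    by (simp add: power2_eq_square square_diff_square_factored abs_mult)
  also have "\<dots> \<le> c * e"
    using assms norm_triangle_ineq3[of a b] order_trans[OF add_nonneg_nonneg[OF norm_ge_zero norm_ge_zero] assms(2)]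
    by (intro mult_mono) auto
  finally show ?thesis .
qed

lemma z_sq_near: "t \<in> {0..T} \<Longrightarrow> \<bar>(cmod (z \<theta> t))\<^sup>2 - (sin t)\<^sup>2\<bar> \<le> 4 * (C * \<epsilon>\<^sup>2)"
  using sq_diff_le[OF near(1)[of t \<theta>], of 4] z3[of t \<theta>] Z0_le_1[of \<epsilon> \<theta> t] C0
  by (auto simp: cmod_Z0_sq)

lemma p_sq_near:
  assumes t: "t \<in> {0..T}"
  shows "\<bar>(cmod (p \<theta> t))\<^sup>2 - (cos t)\<^sup>2\<bar> \<le> 5 * (C * \<epsilon>\<^sup>2) + 4 * \<epsilon>\<^sup>2"
proof -
  have "\<bar>(cmod (p \<theta> t))\<^sup>2 - (cmod (P0 \<epsilon> \<theta> t))\<^sup>2\<bar> \<le> 5 * (C * \<epsilon>\<^sup>2)"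
    by (rule sq_diff_le[OF near(2)[OF t]]) (use p3[OF t, of \<theta>] P0_le[of \<theta> t] C0 in auto)
  moreover have "(sin t) ^ 6 \<le> 1"
    using power_le_one[of "(sin t)\<^sup>2" 3] by (simp add: abs_square_le_1 flip: power_mult)
  then have "4 * \<epsilon>\<^sup>2 * sin t ^ 6 \<le> 4 * \<epsilon>\<^sup>2 * 1" by (intro mult_left_mono) auto
  moreover have "0 \<le> 4 * \<epsilon>\<^sup>2 * sin t ^ 6" by simp
  ultimately show ?thesis unfolding cmod_P0_sq by linarith
qed

definition rad' :: "real \<Rightarrow> real \<Rightarrow> real" where
  "rad' \<theta> t = (cmod (p \<theta> t))\<^sup>2 - (cmod (z \<theta> t))\<^sup>2 + 8 * \<epsilon> * (cmod (z \<theta> t))\<^sup>2 * Im (cnj (z \<theta> t) * p \<theta> t)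
      + \<epsilon>\<^sup>2 * Re (cnj (z \<theta> t) * Gf \<mu> \<nu> (z \<theta> t))"

lemma rad'_near:
  assumes t: "t \<in> {0..T}"
  shows "\<bar>rad' \<theta> t - cos (2 * t)\<bar> \<le> 1/10"
proof -
  have am: "\<bar>a * b\<bar> \<le> c * d" if "\<bar>a\<bar> \<le> c" "\<bar>b\<bar> \<le> d" for a b c d :: real
    unfolding abs_mult using that abs_ge_zero[of a] by (intro mult_mono) linarith+
  have "cmod (cnj (z \<theta> t) * p \<theta> t) \<le> 3 * 3"
    unfolding norm_mult complex_mod_cnj using z3[OF t, of \<theta>] p3[OF t, of \<theta>] by (intro mult_mono) auto
  then have 1: "\<bar>Im (cnj (z \<theta> t) * p \<theta> t)\<bar> \<le> 9"
    using abs_Im_le_cmod[of "cnj (z \<theta> t) * p \<theta> t"] by linarith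
  have 2: "\<bar>(cmod (z \<theta> t))\<^sup>2\<bar> \<le> 9" using power_mono[OF z3[OF t, of \<theta>], of 2] by simp
  have 3: "\<bar>8 * \<epsilon> * (cmod (z \<theta> t))\<^sup>2 * Im (cnj (z \<theta> t) * p \<theta> t)\<bar> \<le> (8 * \<epsilon>) * 9 * 9"
    by (intro am 1 2) (use \<epsilon>0 in auto)
  have "cmod (cnj (z \<theta> t) * Gf \<mu> \<nu> (z \<theta> t)) \<le> 3 * B"
    unfolding norm_mult complex_mod_cnj using z3[OF t, of \<theta>] B(2)[of "z \<theta> t"] by (intro mult_mono) auto
  then have "\<bar>Re (cnj (z \<theta> t) * Gf \<mu> \<nu> (z \<theta> t))\<bar> \<le> 3 * B"
    using abs_Re_le_cmod[of "cnj (z \<theta> t) * Gf \<mu> \<nu> (z \<theta> t)"] by linarith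
  then have 4: "\<bar>\<epsilon>\<^sup>2 * Re (cnj (z \<theta> t) * Gf \<mu> \<nu> (z \<theta> t))\<bar> \<le> \<epsilon>\<^sup>2 * (3 * B)"
    by (intro am) auto
  have e2: "\<epsilon>\<^sup>2 \<le> \<epsilon>" using \<epsilon>0 \<epsilon>_small(1) by (simp add: power2_eq_square mult_left_le)
  then have "\<epsilon>\<^sup>2 * (3 * B) \<le> \<epsilon> * (3 * B)" using C0 by (intro mult_right_mono) auto
  moreover have "\<epsilon> * (3 * B) \<le> 1/20000" using small(1) \<epsilon>0 C0 by (simp add: algebra_simps) (smt (verit) mult_pos_pos)
  moreover have "cos (2 * t) = (cos t)\<^sup>2 - (sin t)\<^sup>2" by (rule cos_double)
  ultimately show ?thesis
    using 3 4 e2 z_sq_near[OF t, of \<theta>] p_sq_near[OF t, of \<theta>] \<epsilon>_small unfolding rad'_def by linarith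
qed

lemma near_sine: "near_sine (\<lambda>t. radial (Y \<theta> t)) (rad' \<theta>) T (4 * (C * \<epsilon>\<^sup>2)) n"
proof
  fix t assume t: "t \<in> {0..T}"
  show "((\<lambda>t. radial (Y \<theta> t)) has_real_derivative rad' \<theta> t) (at t within {0..T})"
    unfolding rad'_def by (rule radial_deriv[OF sol t])
qed (use T radial_near rad'_near \<epsilon>_small(4) Y_0 in \<open>auto simp: radial_def\<close>)

text \<open>The critical times of the distance: odd indices are maxima, even indices are close
  encounters with the primary.\<close>

definition enc :: "real \<Rightarrow> nat \<Rightarrow> real" where
  "enc \<theta> = near_sine.tau (\<lambda>t. radial (Y \<theta> t))"

abbreviation "zone \<equiv> near_sine.zone"

lemmas enc_tau = near_sine.tau[OF near_sine, folded enc_def]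
lemmas enc_slope = near_sine.tau_slope[OF near_sine, folded enc_def]
lemmas enc_less = near_sine.tau_strict_mono[OF near_sine, folded enc_def]
lemmas enc_0 [simp] = near_sine.tau_0[OF near_sine, folded enc_def]

lemma zone_sub: "j \<le> 2 * n \<Longrightarrow> zone j \<subseteq> {0..T}"
  by (rule near_sine.zone_sub[OF near_sine])

lemma enc_near: "j \<le> 2 * n \<Longrightarrow> \<bar>enc \<theta> j - real j * (pi / 2)\<bar> \<le> 10 * (C * \<epsilon>\<^sup>2)"
  using near_sine.tau_near[OF near_sine, folded enc_def, of j \<theta>] by simp

lemma enc_range: "j \<le> 2 * n \<Longrightarrow> enc \<theta> j \<in> {0..T}"
  using enc_tau(1) zone_sub by blast

lemma zone_sq:
  assumes "j \<le> 2 * n" "t \<in> zone j"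
  shows "even j \<Longrightarrow> 3 / 4 \<le> (cos t)\<^sup>2" "odd j \<Longrightarrow> 3 / 4 \<le> (sin t)\<^sup>2"
proof -
  define y where "y = t - real j * (pi / 2)"
  have t: "t = real j * (pi / 2) + y" by (simp add: y_def)
  have "\<bar>y\<bar> \<le> pi / 6" using assms(2) by (simp only: near_sine.zone_def[OF near_sine] mem_Collect_eq y_def)
  then have "\<bar>2 * y\<bar> \<le> pi / 3" by (simp add: abs_mult)
  then have "cos (pi / 3) \<le> cos \<bar>2 * y\<bar>"
    by (intro cos_monotone_0_pi_le) (use pi_gt_zero in linarith)+
  then have c: "1 / 2 \<le> cos (2 * y)" by (simp add: cos_60)
  have d: "cos (2 * t) = (-1) ^ j * cos (2 * y)" unfolding t by (rule cos_double_shift)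
  have "cos (2 * t) = 2 * (cos t)\<^sup>2 - 1" "cos (2 * t) = 1 - 2 * (sin t)\<^sup>2"
    using cos_double_cos[of t] cos_double_sin[of t] by auto
  then show "even j \<Longrightarrow> 3 / 4 \<le> (cos t)\<^sup>2" "odd j \<Longrightarrow> 3 / 4 \<le> (sin t)\<^sup>2"
    using c d by auto
qed

lemma p_large:
  assumes "j \<le> 2 * n" "even j" "t \<in> zone j"
  shows "1 / 2 \<le> cmod (p \<theta> t)"
proof -
  have t: "t \<in> {0..T}" using assms zone_sub by blast
  have "\<epsilon>\<^sup>2 \<le> \<epsilon>" using \<epsilon>0 \<epsilon>_small(1) by (simp add: power2_eq_square mult_left_le)
  then have "1 / 4 \<le> (cmod (p \<theta> t))\<^sup>2"
    using zone_sq(1)[OF assms(1,3,2)] p_sq_near[OF t, of \<theta>] \<epsilon>_small by linarith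
  then have "(1 / 2)\<^sup>2 \<le> (cmod (p \<theta> t))\<^sup>2" by (simp add: power2_eq_square)
  then show ?thesis by (rule power2_le_imp_le) simp
qed

lemma z_large:
  assumes "j \<le> 2 * n" "odd j" "t \<in> zone j"
  shows "1 / 2 \<le> cmod (z \<theta> t)"
proof -
  have t: "t \<in> {0..T}" using assms zone_sub by blast
  have "1 / 4 \<le> (cmod (z \<theta> t))\<^sup>2"
    using zone_sq(2)[OF assms(1,3,2)] z_sq_near[OF t, of \<theta>] \<epsilon>_small by linarith
  then have "(1 / 2)\<^sup>2 \<le> (cmod (z \<theta> t))\<^sup>2" by (simp add: power2_eq_square)
  then show ?thesis by (rule power2_le_imp_le) simp
qed

text \<open>At an encounter position and velocity are perpendicular. Vanishing angular momentum then
  gives \<open>cmod w * cmod v = 2 * \<epsilon> * cmod w ^ 4\<close>, and as the speed is at least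
  \<open>1/2\<close> this forces \<open>w = 0\<close>.\<close>

lemma collision_iff:
  assumes j: "j \<le> 2 * n" "even j"
  shows "z \<theta> (enc \<theta> j) = 0 \<longleftrightarrow> angmom \<epsilon> (Y \<theta> (enc \<theta> j)) = 0"
proof
  assume M: "angmom \<epsilon> (Y \<theta> (enc \<theta> j)) = 0"
  define w where "w = z \<theta> (enc \<theta> j)"
  define v where "v = p \<theta> (enc \<theta> j)"
  have "Re (cnj w * v) = 0" "Im (cnj w * v) = - (2 * \<epsilon> * cmod w ^ 4)"
    using M enc_tau(2)[OF j(1), of \<theta>] by (auto simp: angmom_def radial_def w_def v_def)
  then have "cmod (cnj w * v) = 2 * \<epsilon> * cmod w ^ 4"
    using \<epsilon>0 unfolding cmod_def by simp
  then have "cmod w * cmod v = cmod w * (2 * \<epsilon> * cmod w ^ 3)"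
    by (simp add: norm_mult eval_nat_numeral mult_ac)
  moreover have "2 * \<epsilon> * cmod w ^ 3 < 1 / 2"
  proof -
    have "cmod w ^ 3 \<le> 3 ^ 3" unfolding w_def by (intro power_mono z3 enc_range j) auto
    then have "2 * \<epsilon> * cmod w ^ 3 \<le> 2 * (1/20000) * 3 ^ 3"
      using \<epsilon>0 \<epsilon>_small(1) by (intro mult_mono) auto
    then show ?thesis by simp
  qed
  moreover have "1 / 2 \<le> cmod v" unfolding v_def by (rule p_large[OF j enc_tau(1)[OF j(1)]])
  ultimately show "z \<theta> (enc \<theta> j) = 0" by (auto simp: w_def)
qed (simp add: angmom_def)

definition tq :: "real \<Rightarrow> real \<Rightarrow> real" where
  "tq \<theta> t = integral {0..t} (\<lambda>s. torque \<nu> (z \<theta> s))"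

lemma cont_z: "continuous_on {0..T} (z \<theta>)"
  by (rule continuous_on_vector_derivative) (rule lc_solD(1)[OF sol])

lemma cont_torque_z: "t \<le> T \<Longrightarrow> continuous_on {0..t} (\<lambda>s. torque \<nu> (z \<theta> s))"
  by (intro torque_cont continuous_on_subset[OF cont_z] z3) auto

lemma angmom_eq:
  assumes t: "t \<in> {0..T}"
  shows "angmom \<epsilon> (Y \<theta> t) = \<epsilon>\<^sup>2 * \<mu> * tq \<theta> t"
proof -
  have h: "((\<lambda>s. \<epsilon>\<^sup>2 * \<mu> * torque \<nu> (z \<theta> s)) has_integral (angmom \<epsilon> (Y \<theta> t) - angmom \<epsilon> (Y \<theta> 0))) {0..t}"
  proof (rule fundamental_theorem_of_calculus)
    fix s assume s: "s \<in> {0..t}"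
    have sub: "{0..t} \<subseteq> {0..T}" using t by auto
    show "((\<lambda>s. angmom \<epsilon> (Y \<theta> s)) has_vector_derivative \<epsilon>\<^sup>2 * \<mu> * torque \<nu> (z \<theta> s)) (at s within {0..t})"
      unfolding has_real_derivative_iff_has_vector_derivative[symmetric]
      by (rule has_field_derivative_subset[OF angmom_deriv[OF sol] sub]) (use s t in auto)
  qed (use t in auto)
  have "angmom \<epsilon> (Y \<theta> 0) = 0" by (simp add: angmom_def Y_0)
  moreover have "integral {0..t} (\<lambda>s. \<epsilon>\<^sup>2 * \<mu> * torque \<nu> (z \<theta> s)) = \<epsilon>\<^sup>2 * \<mu> * tq \<theta> t"
    unfolding tq_def by (rule integral_mult_right)
  ultimately show ?thesis using integral_unique[OF h] by linarith
qed

lemma tq_zero_iff: "j \<le> 2 * n \<Longrightarrow> even j \<Longrightarrow> z \<theta> (enc \<theta> j) = 0 \<longleftrightarrow> tq \<theta> (enc \<theta> j) = 0"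
  using collision_iff[of j \<theta>] angmom_eq[OF enc_range] \<epsilon>0 \<mu> by simp

text \<open>There are two sources of error: the orbit deviates from \<open>Z0\<close>, which costs
  \<open>B * C * T * \<epsilon>\<^sup>2\<close>, and the encounter deviates from time
  \<open>k * pi\<close>, which costs \<open>10 * B * C * \<epsilon>\<^sup>2\<close>.\<close>

lemma tq_close:
  assumes k: "k \<le> n"
  shows "\<bar>tq \<theta> (enc \<theta> (2 * k)) - (\<Sum>i<k. pass_torque \<epsilon> (\<theta> - real i * \<epsilon> * pi))\<bar> \<le> \<epsilon>"
proof -
  define \<tau> where "\<tau> = enc \<theta> (2 * k)"
  define F where "F = (\<lambda>s. torque \<nu> (Z0 \<epsilon> \<theta> s))"
  have \<tau>: "\<tau> \<in> {0..T}" unfolding \<tau>_def using k by (intro enc_range) auto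
  have kT: "real k * pi \<in> {0..T}"
  proof -
    have "real k * pi \<le> real n * pi" using k by (intro mult_right_mono) auto
    then show ?thesis using T pi_gt_zero unfolding atLeastAtMost_iff by (intro conjI mult_nonneg_nonneg) linarith+
  qed
  have intF: "F integrable_on {a..b}" for a b
    unfolding F_def by (intro integrable_continuous_real cont_torque_Z0)
  have 1: "\<bar>tq \<theta> \<tau> - integral {0..\<tau>} F\<bar> \<le> B * C * T * \<epsilon>\<^sup>2"
  proof -
    have intz: "(\<lambda>s. torque \<nu> (z \<theta> s)) integrable_on {0..\<tau>}"
      using \<tau> by (intro integrable_continuous_real cont_torque_z) auto
    have "\<bar>tq \<theta> \<tau> - integral {0..\<tau>} F\<bar> = norm (integral {0..\<tau>} (\<lambda>s. torque \<nu> (z \<theta> s) - F s))"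
      unfolding tq_def using integral_diff[OF intz intF] by simp
    also have "\<dots> \<le> integral {0..\<tau>} (\<lambda>s. B * (C * \<epsilon>\<^sup>2))"
    proof (rule integral_norm_bound_integral)
      fix s assume s: "s \<in> {0..\<tau>}"
      then have sT: "s \<in> {0..T}" using \<tau> by auto
      have Z3: "cmod (Z0 \<epsilon> \<theta> s) \<le> 3" using Z0_le_1[of \<epsilon> \<theta> s] by simp
      have "norm (torque \<nu> (z \<theta> s) - F s) \<le> B * cmod (z \<theta> s - Z0 \<epsilon> \<theta> s)"
        unfolding F_def using B(3)[OF z3[OF sT] Z3] by simp
      also have "\<dots> \<le> B * (C * \<epsilon>\<^sup>2)" using near(1)[OF sT] C0 by (intro mult_left_mono) auto
      finally show "norm (torque \<nu> (z \<theta> s) - F s) \<le> B * (C * \<epsilon>\<^sup>2)" .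
    qed (use intz intF in \<open>auto intro!: integrable_diff\<close>)
    also have "\<dots> = \<tau> * (B * (C * \<epsilon>\<^sup>2))" using \<tau> by simp
    also have "\<dots> \<le> T * (B * (C * \<epsilon>\<^sup>2))" using \<tau> C0 by (intro mult_right_mono) auto
    finally show ?thesis by (simp add: mult_ac)
  qed
  have "\<bar>integral {0..b} F - integral {0..a} F\<bar> \<le> B * (b - a)" if ab: "0 \<le> a" "a \<le> b" for a b
  proof -
    have "integral {0..b} F - integral {0..a} F = integral {a..b} F"
      using Henstock_Kurzweil_Integration.integral_combine[OF ab intF] by simp
    moreover have "norm (integral {a..b} F) \<le> integral {a..b} (\<lambda>s. B)"
    proof (rule integral_norm_bound_integral)
      fix s
      show "norm (F s) \<le> B" unfolding F_def using B(1)[of "Z0 \<epsilon> \<theta> s"] Z0_le_1[of \<epsilon> \<theta> s] by simp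
    qed (use intF in auto)
    ultimately show ?thesis using ab by (simp add: mult.commute)
  qed
  from this[of \<tau> "real k * pi"] this[of "real k * pi" \<tau>]
  have "\<bar>integral {0..\<tau>} F - integral {0..real k * pi} F\<bar> \<le> B * \<bar>\<tau> - real k * pi\<bar>"
    using \<tau> kT by (cases "\<tau> \<le> real k * pi") auto
  also have "\<dots> \<le> B * (10 * (C * \<epsilon>\<^sup>2))"
    using enc_near[of "2 * k" \<theta>] k C0 unfolding \<tau>_def by (intro mult_left_mono) auto
  finally have 2: "\<bar>integral {0..\<tau>} F - integral {0..real k * pi} F\<bar> \<le> B * C * 10 * \<epsilon>\<^sup>2" by (simp add: mult_ac)
  have "B * C * T * \<epsilon>\<^sup>2 + B * C * 10 * \<epsilon>\<^sup>2 = \<epsilon> * (B * C * (T + 10)) * \<epsilon>"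
    by (simp add: power2_eq_square algebra_simps)
  also have "\<dots> \<le> 1 * \<epsilon>" using small(2) \<epsilon>0 by (intro mult_right_mono) auto
  finally show ?thesis
    using 1 2 torque_sum[of k \<epsilon> \<theta>] unfolding \<tau>_def[symmetric] F_def[symmetric] by linarith
qed

text \<open>Collisions at encounters \<open>k\<close> and \<open>n\<close> would make both sums of
  pass torques at most \<epsilon> in modulus. Up to the sign \<open>s\<close> the torques decrease
  by at least \<open>2 * pi * (\<epsilon> * pi)\<close> per passage, which exceeds
  \<open>3 * \<epsilon>\<close>, so \<open>partial_sum_gt\<close> applies.\<close>

lemma no_early_collision:
  assumes \<theta>: "\<bar>\<theta> - real j * (pi / 4)\<bar> \<le> pi / 24" and coll: "z \<theta> (enc \<theta> (2 * n)) = 0"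
    and k: "0 < k" "k < n"
  shows "z \<theta> (enc \<theta> (2 * k)) \<noteq> 0"
proof
  assume c: "z \<theta> (enc \<theta> (2 * k)) = 0"
  define s :: real where "s = (-1) ^ Suc j"
  have s1: "\<bar>s * x\<bar> = \<bar>x\<bar>" for x by (simp add: s_def abs_mult power_abs)
  define b where "b i = pass_torque \<epsilon> (\<theta> - real i * \<epsilon> * pi)" for i :: nat
  have "tq \<theta> (enc \<theta> (2 * k)) = 0" "tq \<theta> (enc \<theta> (2 * n)) = 0"
    using tq_zero_iff[of "2 * k" \<theta>] tq_zero_iff[of "2 * n" \<theta>] c coll k by auto
  then have sums: "\<bar>\<Sum>i<k. b i\<bar> \<le> \<epsilon>" "\<bar>\<Sum>i<n. b i\<bar> \<le> \<epsilon>"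
    using tq_close[of k \<theta>] tq_close[of n \<theta>] k by (auto simp: b_def)
  have sd: "(\<Sum>i<m. s * b i) = s * (\<Sum>i<m. b i)" for m by (simp add: sum_distrib_left)
  have "\<epsilon> < (\<Sum>i<k. s * b i)"
  proof (rule partial_sum_gt[of n _ "2 * pi * (\<epsilon> * pi)"])
    fix i assume i: "Suc i < n"
    have shift: "\<bar>(\<theta> - real m * \<epsilon> * pi) - real j * (pi / 4)\<bar> \<le> pi / 20" if "m \<le> n" for m
    proof -
      have "real m * (\<epsilon> * pi) \<le> real n * (\<epsilon> * pi)"
        using that \<epsilon>0 by (intro mult_right_mono) auto
      also have "\<dots> \<le> 1/200" using n\<epsilon> by (simp only: mult.assoc)
      finally have m: "real m * \<epsilon> * pi \<le> 1/200" by (simp only: mult.assoc)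
      have m0: "0 \<le> real m * \<epsilon> * pi" using \<epsilon>0 by simp
      define c where "c = real j * (pi / 4)"
      show ?thesis
        using \<theta> m m0 pi_gt3 unfolding c_def[symmetric] by linarith
    qed
    have "2 * pi * ((\<theta> - real i * \<epsilon> * pi) - (\<theta> - real (Suc i) * \<epsilon> * pi)) \<le> s * (b i - b (Suc i))"
      unfolding s_def b_def
      by (rule pass_torque_mono) (use i \<epsilon>0 \<epsilon>_small(1) shift[of i] shift[of "Suc i"] in \<open>auto simp: algebra_simps\<close>)
    then show "s * b (Suc i) + 2 * pi * (\<epsilon> * pi) \<le> s * b i" by (simp add: algebra_simps)
  next
    have "3 * 3 < pi * pi" using pi_gt3 by (intro mult_strict_mono) auto
    then have "3 * \<epsilon> < 2 * (pi * pi) * \<epsilon>" using \<epsilon>0 by (intro mult_strict_right_mono) auto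
    then show "3 * \<epsilon> < 2 * pi * (\<epsilon> * pi)" by (simp add: mult_ac)
  qed (use sums k \<epsilon>0 in \<open>auto simp: sd s1\<close>)
  then show False using sums(1) s1[of "\<Sum>i<k. b i"] unfolding sd by linarith
qed

text \<open>A zero of \<open>z\<close> is a zero of \<open>radial\<close>, hence a critical time of
  the distance. Odd ones are excluded because the distance is large there, even ones by
  \<open>no_early_collision\<close>.\<close>

lemma ec_solution:
  assumes \<theta>: "\<bar>\<theta> - real j * (pi / 4)\<bar> \<le> pi / 24" and coll: "z \<theta> (enc \<theta> (2 * n)) = 0"
  shows "ec_solution \<epsilon> \<nu> \<mu> n (enc \<theta> (2 * n)) (Y \<theta>)"
  unfolding ec_solution_def
proof (intro conjI ballI)
  define \<tau> where "\<tau> = enc \<theta> (2 * n)"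
  have \<tau>T: "\<tau> \<in> {0..T}" unfolding \<tau>_def by (rule enc_range) simp
  show "0 < enc \<theta> (2 * n)" using enc_less[of 0 "2 * n" \<theta>] n by simp
  show "lc_sol \<epsilon> \<nu> \<mu> (enc \<theta> (2 * n)) (Y \<theta>)"
    by (rule lc_sol_subset[OF sol]) (use \<tau>T \<tau>_def in auto)
  show "z \<theta> 0 = 0" "cmod (p \<theta> 0) = 1" by (simp_all add: Y_0)
  show "z \<theta> (enc \<theta> (2 * n)) = 0" by fact
  fix t assume t: "t \<in> {0<..<enc \<theta> (2 * n)}"
  show "z \<theta> t \<noteq> 0"
  proof
    assume z: "z \<theta> t = 0"
    then have "radial (Y \<theta> t) = 0" by (simp add: radial_def)
    then obtain i where i: "i \<le> 2 * n" "t = enc \<theta> i"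
      using near_sine.zero_is_tau[OF near_sine, of \<theta> t, folded enc_def] t by auto
    show False
    proof (cases "even i")
      case True
      then obtain k where k: "i = 2 * k" by auto
      have "k \<noteq> 0" using i t k by (cases "k = 0") auto
      moreover have "k \<noteq> n" using i t k by auto
      ultimately have "0 < k" "k < n" using i k by auto
      then show False using no_early_collision[OF \<theta> coll] z i k by auto
    next
      case False
      then show False using z_large[OF i(1) _ enc_tau(1)[OF i(1)], of \<theta> \<theta>] z i by auto
    qed
  qed
next
  show "card {t \<in> {0<..<enc \<theta> (2 * n)}. rel_max_at (\<lambda>t. (cmod (z \<theta> t))\<^sup>2) t} = n"
    unfolding enc_def by (rule near_sine.card_rel_max[OF near_sine cmod_sq_deriv[OF sol]])
qed

lemma along_direction:
  assumes \<theta>: "\<bar>\<theta> - real j * (pi / 4)\<bar> \<le> pi / 24"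
  shows "along (\<i> ^ j) (enc \<theta> (2 * n)) (Y \<theta>)"
proof -
  have sq: "cmod ((z \<theta> t)\<^sup>2 - \<i> ^ j * of_real ((sin t)\<^sup>2)) \<le> 9/20" if t: "t \<in> {0..T}" for t
  proof -
    define d where "d = \<theta> - psi \<epsilon> t - real j * (pi / 4)"
    have "\<epsilon> * (t + 1) \<le> \<epsilon> * (T + 1)" using t \<epsilon>0 by (intro mult_left_mono) auto
    moreover have "0 \<le> psi \<epsilon> t" "psi \<epsilon> t \<le> \<epsilon> * (t + 1)" using psi_bounds[of \<epsilon> t] t \<epsilon>0 by auto
    ultimately have ps: "0 \<le> psi \<epsilon> t" "psi \<epsilon> t \<le> 1/200" using small(3) by linarith+
    define c where "c = real j * (pi / 4)"
    have d: "\<bar>d\<bar> \<le> 18/100"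
      using \<theta> ps pi_less_4 unfolding d_def c_def[symmetric] by linarith
    have "2 * (real j * (pi / 4)) = real j * (pi / 2)" by simp
    then have ij: "\<i> ^ j = cis (2 * (real j * (pi / 4)))"
      using Complex.DeMoivre[of "pi / 2" j] by (simp only: cis_pi_half)
    have "Z0 \<epsilon> \<theta> t = cis (real j * (pi / 4) + d) * of_real (sin t)" by (simp add: Z0_def d_def)
    moreover have "(cis \<alpha>)\<^sup>2 = cis (2 * \<alpha>)" for \<alpha> by (simp add: power2_eq_square cis_mult)
    ultimately have "(Z0 \<epsilon> \<theta> t)\<^sup>2 = cis (2 * (real j * (pi / 4) + d)) * of_real ((sin t)\<^sup>2)"
      by (simp only: power_mult_distrib of_real_power)
    also have "cis (2 * (real j * (pi / 4) + d)) = \<i> ^ j * cis (2 * d)"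
      unfolding ij cis_mult by (simp only: distrib_left)
    finally have "(Z0 \<epsilon> \<theta> t)\<^sup>2 - \<i> ^ j * of_real ((sin t)\<^sup>2) = \<i> ^ j * (cis (2 * d) - 1) * of_real ((sin t)\<^sup>2)"
      by (simp only: left_diff_distrib right_diff_distrib mult_1_right)
    moreover have "cmod (\<i> ^ j * w * of_real x) = cmod w * \<bar>x\<bar>" for w x
      by (simp add: norm_mult norm_power)
    ultimately have "cmod ((Z0 \<epsilon> \<theta> t)\<^sup>2 - \<i> ^ j * of_real ((sin t)\<^sup>2)) = cmod (cis (2 * d) - 1) * \<bar>(sin t)\<^sup>2\<bar>"
      by (simp only:)
    also have "\<dots> \<le> (2 * \<bar>d\<bar>) * 1"
    proof (rule mult_mono)
      show "cmod (cis (2 * d) - 1) \<le> 2 * \<bar>d\<bar>" using cmod_cis_diff_le[of "2 * d" 0] by (simp add: abs_mult)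
      show "\<bar>(sin t)\<^sup>2\<bar> \<le> 1" by (simp add: abs_square_le_1)
    qed auto
    finally have 1: "cmod ((Z0 \<epsilon> \<theta> t)\<^sup>2 - \<i> ^ j * of_real ((sin t)\<^sup>2)) \<le> 36/100" using d by simp
    have "(z \<theta> t)\<^sup>2 - (Z0 \<epsilon> \<theta> t)\<^sup>2 = (z \<theta> t - Z0 \<epsilon> \<theta> t) * (z \<theta> t + Z0 \<epsilon> \<theta> t)"
      by (simp add: power2_eq_square algebra_simps)
    then have "cmod ((z \<theta> t)\<^sup>2 - (Z0 \<epsilon> \<theta> t)\<^sup>2) = cmod (z \<theta> t - Z0 \<epsilon> \<theta> t) * cmod (z \<theta> t + Z0 \<epsilon> \<theta> t)"
      by (simp add: norm_mult)
    also have "\<dots> \<le> 1/1000000 * (3 + 1)"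
    proof (rule mult_mono)
      show "cmod (z \<theta> t - Z0 \<epsilon> \<theta> t) \<le> 1/1000000" using near(1)[OF t, of \<theta>] \<epsilon>_small(4) by linarith
      show "cmod (z \<theta> t + Z0 \<epsilon> \<theta> t) \<le> 3 + 1"
        using norm_triangle_ineq[of "z \<theta> t" "Z0 \<epsilon> \<theta> t"] z3[OF t, of \<theta>] Z0_le_1[of \<epsilon> \<theta> t] by linarith
    qed auto
    finally have 2: "cmod ((z \<theta> t)\<^sup>2 - (Z0 \<epsilon> \<theta> t)\<^sup>2) \<le> 1/100" by simp
    show ?thesis
      using norm_diff_triangle_le[OF 2 1] by linarith
  qed
  have sub: "{0..enc \<theta> (2 * n)} \<subseteq> {0..T}" using enc_range[of "2 * n" \<theta>] by auto
  show ?thesis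
    unfolding along_def
  proof (intro conjI ballI)
    have "enc \<theta> 2 \<le> enc \<theta> (2 * n)" using enc_less[of 2 "2 * n" \<theta>] n by (cases "n = 1") auto
    then have "pi / 2 \<in> {0..enc \<theta> (2 * n)}"
      using enc_near[of 2 \<theta>] n \<epsilon>_small(4) pi_gt3 by auto
    moreover from this sub have "pi / 2 \<in> {0..T}" by blast
    then have "cmod ((z \<theta> (pi / 2))\<^sup>2 - \<i> ^ j) \<le> 9/20" using sq[of "pi / 2"] by simp
    ultimately show "\<exists>t\<in>{0..enc \<theta> (2 * n)}. cmod ((z \<theta> t)\<^sup>2 - \<i> ^ j) \<le> 9/20" by blast
  next
    fix t assume "t \<in> {0..enc \<theta> (2 * n)}"
    then show "\<exists>y\<in>{0..1}. cmod ((z \<theta> t)\<^sup>2 - \<i> ^ j * of_real y) \<le> 9/20"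
      using sq[of t] sub by (intro bexI[of _ "(sin t)\<^sup>2"]) (auto simp: abs_square_le_1)
  qed
qed

text \<open>At a fixed time \<open>radial\<close> varies by at most \<open>6 * E\<close> per unit of
  angle; division by the slope \<open>2 / 5\<close> gives the factor 15.\<close>

lemma enc_lipschitz:
  assumes j: "j \<le> 2 * n"
  shows "\<bar>enc \<theta> j - enc \<theta>' j\<bar> \<le> 15 * E * \<bar>\<theta> - \<theta>'\<bar>"
proof -
  define t where "t = enc \<theta> j"
  have t: "t \<in> zone j" "t \<in> {0..T}" "radial (Y \<theta> t) = 0"
    using enc_tau[OF j, of \<theta>] enc_range[OF j, of \<theta>] by (auto simp: t_def)
  have "\<bar>radial (Y \<theta>' t)\<bar> = \<bar>radial (Y \<theta>' t) - radial (Y \<theta> t)\<bar>" using t by simp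
  also have "\<dots> \<le> cmod (cnj (z \<theta>' t) * p \<theta>' t - cnj (z \<theta> t) * p \<theta> t)"
    unfolding radial_def by (metis abs_Re_le_cmod minus_complex.simps(1))
  also have "\<dots> \<le> cmod (z \<theta>' t - z \<theta> t) * cmod (p \<theta>' t) + cmod (z \<theta> t) * cmod (p \<theta>' t - p \<theta> t)"
    by (rule cnj_mult_diff)
  also have "\<dots> \<le> (E * \<bar>\<theta>' - \<theta>\<bar>) * 3 + 3 * (E * \<bar>\<theta>' - \<theta>\<bar>)"
    using lip[OF t(2), of \<theta>' \<theta>] z3[OF t(2), of \<theta>] p3[OF t(2), of \<theta>'] C0 by (intro add_mono mult_mono) auto
  finally show ?thesis using enc_slope[OF j t(1), of \<theta>'] unfolding t_def by (simp add: abs_minus_commute)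
qed

lemma state_continuous:
  assumes j: "j \<le> 2 * n"
  shows "continuous_on UNIV (\<lambda>\<theta>. Y \<theta> (enc \<theta> j))"
proof -
  have "((\<lambda>\<theta>. Y \<theta> (enc \<theta> j)) \<longlongrightarrow> Y \<theta>0 (enc \<theta>0 j)) (at \<theta>0)" for \<theta>0
  proof -
    have "((\<lambda>\<theta>. Y \<theta> (enc \<theta> j) - Y \<theta>0 (enc \<theta> j)) \<longlongrightarrow> 0) (at \<theta>0)"
    proof (rule Lim_null_comparison)
      show "\<forall>\<^sub>F \<theta> in at \<theta>0. norm (Y \<theta> (enc \<theta> j) - Y \<theta>0 (enc \<theta> j)) \<le> E * \<bar>\<theta> - \<theta>0\<bar>"
        by (intro always_eventually allI Y_lip enc_range j)
      show "((\<lambda>\<theta>. E * \<bar>\<theta> - \<theta>0\<bar>) \<longlongrightarrow> 0) (at \<theta>0)"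
        by (auto intro!: tendsto_eq_intros)
    qed
    moreover have "((\<lambda>\<theta>. Y \<theta>0 (enc \<theta> j)) \<longlongrightarrow> Y \<theta>0 (enc \<theta>0 j)) (at \<theta>0)"
    proof -
      have "continuous_on UNIV (\<lambda>\<theta>. enc \<theta> j)"
      proof (rule lipschitz_on_continuous_on)
        show "(15 * E)-lipschitz_on UNIV (\<lambda>\<theta>. enc \<theta> j)"
          using enc_lipschitz[OF j] C0 by (intro lipschitz_onI) (auto simp: dist_real_def)
      qed
      moreover have "continuous_on {0..T} (Y \<theta>0)"
      proof (rule continuous_on_vector_derivative)
        fix t assume "t \<in> {0..T}"
        then show "(Y \<theta>0 has_vector_derivative lc_field \<epsilon> \<nu> \<mu> (Y \<theta>0 t)) (at t within {0..T})"
          using sol[of \<theta>0] by (simp add: lc_sol_def)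
      qed
      ultimately have "continuous_on UNIV (\<lambda>\<theta>. Y \<theta>0 (enc \<theta> j))"
        using enc_range[OF j] continuous_on_compose2[of "{0..T}" "Y \<theta>0" UNIV "\<lambda>\<theta>. enc \<theta> j"] by blast
      then show ?thesis by (simp add: continuous_on_def)
    qed
    ultimately have "((\<lambda>\<theta>. Y \<theta> (enc \<theta> j) - Y \<theta>0 (enc \<theta> j) + Y \<theta>0 (enc \<theta> j)) \<longlongrightarrow> 0 + Y \<theta>0 (enc \<theta>0 j)) (at \<theta>0)"
      by (rule tendsto_add)
    then show ?thesis by simp
  qed
  then show ?thesis by (simp add: continuous_on_def)
qed

text \<open>Near the diagonal the torque has opposite signs on the two sides, so the angular
  momentum at the \<open>n\<close>-th close encounter changes sign.\<close>

lemma diagonal_collision: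
  "\<exists>\<theta>. \<bar>\<theta> - pi / 4\<bar> \<le> pi / 24 \<and> z \<theta> (enc \<theta> (2 * n)) = 0"
proof -
  define M where "M \<theta> = angmom \<epsilon> (Y \<theta> (enc \<theta> (2 * n)))" for \<theta>
  have M: "M \<theta> = \<epsilon>\<^sup>2 * \<mu> * tq \<theta> (enc \<theta> (2 * n))" for \<theta>
    unfolding M_def by (rule angmom_eq[OF enc_range]) simp
  have em: "0 < \<epsilon>\<^sup>2 * \<mu>" using \<epsilon>0 \<mu> by simp
  have q: "\<bar>pass_torque \<epsilon> (pi / 4)\<bar> \<le> 1/10"
    by (rule pass_torque_quarter) (use \<epsilon>0 \<epsilon>_small(1) in auto)
  have shift: "0 \<le> real i * \<epsilon> * pi \<and> real i * \<epsilon> * pi \<le> 1/200" if "i < n" for i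
  proof -
    have "real i * (\<epsilon> * pi) \<le> real n * (\<epsilon> * pi)"
      using that \<epsilon>0 by (intro mult_right_mono) auto
    moreover have "real n * (\<epsilon> * pi) \<le> 1/200" using n\<epsilon> by (simp only: mult.assoc)
    ultimately have "real i * (\<epsilon> * pi) \<le> 1/200" by linarith
    moreover have "0 \<le> real i * (\<epsilon> * pi)" using \<epsilon>0 by simp
    ultimately show ?thesis by (simp only: mult.assoc)
  qed
  have n\<epsilon>1: "\<epsilon> < real n * (1/100)"
    using \<epsilon>_small(1) n by simp
  have sq: "1/5 \<le> pi * x" if "1/10 \<le> x" for x
    using mult_mono[of 3 pi "1/10" x] pi_gt3 that by simp
  have up: "0 \<le> M (pi / 4 + pi / 24)"
  proof -
    \<comment> \<open>Even after the rotation of the frame the angle is at least \<open>1/10\<close>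
      off the diagonal, so each passage contributes at least \<open>2/5 - 1/10\<close>. A
      contribution of \<open>1/100\<close> already beats the error \<epsilon> of
      \<open>tq_close\<close>.\<close>
    have "1/100 \<le> pass_torque \<epsilon> (pi / 4 + pi / 24 - real i * \<epsilon> * pi)" if i: "i < n" for i
    proof -
      have b: "1/10 \<le> pi / 24 - real i * \<epsilon> * pi" "pi / 24 - real i * \<epsilon> * pi \<le> pi / 20"
        using shift[OF i] pi_gt3 by linarith+
      have "2 * pi * ((pi / 4 + pi / 24 - real i * \<epsilon> * pi) - pi / 4)
        \<le> (-1) ^ Suc 1 * (pass_torque \<epsilon> (pi / 4 + pi / 24 - real i * \<epsilon> * pi) - pass_torque \<epsilon> (pi / 4))"
        by (rule pass_torque_mono[where j = 1]) (use \<epsilon>0 \<epsilon>_small(1) b pi_gt_zero in linarith)+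
      moreover have "2 * pi * ((pi / 4 + pi / 24 - real i * \<epsilon> * pi) - pi / 4) = 2 * (pi * (pi / 24 - real i * \<epsilon> * pi))"
        by (simp add: algebra_simps)
      moreover have "(-1) ^ Suc 1 * (pass_torque \<epsilon> (pi / 4 + pi / 24 - real i * \<epsilon> * pi) - pass_torque \<epsilon> (pi / 4))
          = pass_torque \<epsilon> (pi / 4 + pi / 24 - real i * \<epsilon> * pi) - pass_torque \<epsilon> (pi / 4)" by simp
      ultimately show ?thesis using sq[OF b(1)] abs_le_D2[OF q] by linarith
    qed
    then have "(\<Sum>i<n. 1/100) \<le> (\<Sum>i<n. pass_torque \<epsilon> (pi / 4 + pi / 24 - real i * \<epsilon> * pi))"
      by (intro sum_mono) auto
    then have "0 \<le> tq (pi / 4 + pi / 24) (enc (pi / 4 + pi / 24) (2 * n))"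
      using tq_close[of n "pi / 4 + pi / 24"] n\<epsilon>1 by simp
    then show ?thesis unfolding M using em by simp
  qed
  have lo: "M (pi / 4 - pi / 24) \<le> 0"
  proof -
    have "pass_torque \<epsilon> (pi / 4 - pi / 24 - real i * \<epsilon> * pi) \<le> - (1/100)" if i: "i < n" for i
    proof -
      have b: "1/10 \<le> pi / 24 + real i * \<epsilon> * pi" "pi / 24 + real i * \<epsilon> * pi \<le> pi / 20"
        using shift[OF i] pi_gt3 by linarith+
      have "2 * pi * (pi / 4 - (pi / 4 - pi / 24 - real i * \<epsilon> * pi))
        \<le> (-1) ^ Suc 1 * (pass_torque \<epsilon> (pi / 4) - pass_torque \<epsilon> (pi / 4 - pi / 24 - real i * \<epsilon> * pi))"
        by (rule pass_torque_mono[where j = 1]) (use \<epsilon>0 \<epsilon>_small(1) b pi_gt_zero in linarith)+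
      moreover have "2 * pi * (pi / 4 - (pi / 4 - pi / 24 - real i * \<epsilon> * pi)) = 2 * (pi * (pi / 24 + real i * \<epsilon> * pi))"
        by (simp add: algebra_simps)
      moreover have "(-1) ^ Suc 1 * (pass_torque \<epsilon> (pi / 4) - pass_torque \<epsilon> (pi / 4 - pi / 24 - real i * \<epsilon> * pi))
          = pass_torque \<epsilon> (pi / 4) - pass_torque \<epsilon> (pi / 4 - pi / 24 - real i * \<epsilon> * pi)" by simp
      ultimately show ?thesis using sq[OF b(1)] abs_le_D1[OF q] by linarith
    qed
    then have "(\<Sum>i<n. pass_torque \<epsilon> (pi / 4 - pi / 24 - real i * \<epsilon> * pi)) \<le> (\<Sum>i<n. - (1/100))"
      by (intro sum_mono) auto
    then have "tq (pi / 4 - pi / 24) (enc (pi / 4 - pi / 24) (2 * n)) \<le> 0"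
      using tq_close[of n "pi / 4 - pi / 24"] n\<epsilon>1 by simp
    then show ?thesis unfolding M using em by (simp add: mult_nonneg_nonpos)
  qed
  have "\<exists>\<theta>. pi / 4 - pi / 24 \<le> \<theta> \<and> \<theta> \<le> pi / 4 + pi / 24 \<and> M \<theta> = 0"
  proof (rule IVT'[of M, OF lo up])
    have "continuous_on UNIV M"
      unfolding M_def angmom_def by (intro continuous_intros state_continuous) auto
    then show "continuous_on {pi / 4 - pi / 24..pi / 4 + pi / 24} M" by (rule continuous_on_subset) auto
  qed simp
  then obtain \<theta> where \<theta>: "pi / 4 - pi / 24 \<le> \<theta>" "\<theta> \<le> pi / 4 + pi / 24" "M \<theta> = 0" by blast
  then have "\<bar>\<theta> - pi / 4\<bar> \<le> pi / 24" by linarith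
  moreover have "z \<theta> (enc \<theta> (2 * n)) = 0" using collision_iff[of "2 * n" \<theta>] \<theta>(3) by (simp add: M_def)
  ultimately show ?thesis by blast
qed

end

section \<open>Orbits symmetric with respect to the horizontal axis\<close>

lemma sin_ge_half:
  assumes "0 \<le> x" "x \<le> pi / 3"
  shows "x / 2 \<le> sin x"
proof -
  obtain y where y: "y \<in> {0..x}" "sin x - sin 0 = cos y * (x - 0)"
    using mvt_within[of UNIV sin cos 0 x] assms(1) DERIV_sin by auto
  have "cos (pi / 3) \<le> cos y"
    by (rule cos_monotone_0_pi_le) (use y assms pi_gt_zero in auto)
  then have "1 / 2 * x \<le> cos y * x" using assms(1) by (intro mult_right_mono) (auto simp: cos_60)
  then show ?thesis using y by simp
qed

context lc_orbits
begin

lemma zone_phase: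
  assumes "t \<in> zone n"
  shows "\<exists>x\<ge>1/2. (if odd n then sin t else cos t) = (-1) ^ (n div 2) * x"
proof -
  define m where "m = n div 2"
  define y where "y = t - real n * (pi / 2)"
  have "\<bar>y\<bar> \<le> pi / 6" using assms by (simp only: near_sine.zone_def[OF near_sine] mem_Collect_eq y_def)
  then have "cos (pi / 3) \<le> cos \<bar>y\<bar>"
    by (intro cos_monotone_0_pi_le) (use pi_gt_zero in linarith)+
  then have c: "1 / 2 \<le> cos y" by (simp add: cos_60)
  have "(if odd n then sin t else cos t) = (-1) ^ m * cos y"
  proof (cases "odd n")
    case True
    then have "n = 2 * m + 1" unfolding m_def by simp
    then have "t = real m * pi + (pi / 2 + y)" by (simp add: y_def algebra_simps)
    then have "sin t = (-1) ^ m * cos y" by (simp only: sin_add) (simp add: sin_add)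
    then show ?thesis using True by simp
  next
    case False
    then have "n = 2 * m" unfolding m_def by simp
    then have "t = real m * pi + y" by (simp add: y_def algebra_simps)
    then have "cos t = (-1) ^ m * cos y" by (simp only: cos_add) simp
    then show ?thesis using False by simp
  qed
  then show ?thesis using c m_def by blast
qed

text \<open>The component that does not vanish at the middle of the orbit.\<close>

definition mid :: "real \<Rightarrow> complex" where
  "mid \<theta> = (if odd n then z \<theta> (enc \<theta> n) else p \<theta> (enc \<theta> n))"

lemma mid_near:
  "\<exists>x\<ge>1/2. \<exists>\<phi>. 0 \<le> \<phi> \<and> \<phi> \<le> 1/200 \<and>
     cmod (mid \<theta> - (-1) ^ (n div 2) * of_real x * cis (\<theta> - \<phi>)) \<le> 1/1000"
proof -
  define t where "t = enc \<theta> n"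
  have tz: "t \<in> zone n" and tT: "t \<in> {0..T}"
    using enc_tau(1)[of n \<theta>] enc_range[of n \<theta>] by (auto simp: t_def)
  obtain x where x: "1/2 \<le> x" "(if odd n then sin t else cos t) = (-1) ^ (n div 2) * x"
    using zone_phase[OF tz] by blast
  have "\<epsilon> * (t + 1) \<le> \<epsilon> * (T + 1)" using tT \<epsilon>0 by (intro mult_left_mono) auto
  moreover have "0 \<le> psi \<epsilon> t" "psi \<epsilon> t \<le> \<epsilon> * (t + 1)" using psi_bounds[of \<epsilon> t] tT \<epsilon>0 by auto
  ultimately have ps: "0 \<le> psi \<epsilon> t" "psi \<epsilon> t \<le> 1/200" using small(3) by linarith+
  have "cmod (mid \<theta> - cis (\<theta> - psi \<epsilon> t) * of_real (if odd n then sin t else cos t)) \<le> 1/1000"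
  proof (cases "odd n")
    case True
    then show ?thesis
      using near(1)[OF tT, of \<theta>] \<epsilon>_small(4) by (simp add: mid_def t_def Z0_def)
  next
    case False
    have "P0 \<epsilon> \<theta> t - cis (\<theta> - psi \<epsilon> t) * of_real (cos t) = cis (\<theta> - psi \<epsilon> t) * Complex 0 (- 2 * \<epsilon> * sin t ^ 3)"
      unfolding P0_def right_diff_distrib[symmetric] by (simp add: complex_eq_iff)
    then have "cmod (P0 \<epsilon> \<theta> t - cis (\<theta> - psi \<epsilon> t) * of_real (cos t)) = cmod (Complex 0 (- 2 * \<epsilon> * sin t ^ 3))"
      by (simp add: norm_mult)
    also have "\<dots> = 2 * \<epsilon> * \<bar>sin t\<bar> ^ 3" using \<epsilon>0 by (simp add: cmod_def abs_mult power_abs)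
    also have "\<dots> \<le> 2 * \<epsilon> * 1" using \<epsilon>0 by (intro mult_left_mono power_le_one) auto
    also have "\<dots> \<le> 1/10000" using \<epsilon>_small(1) by simp
    finally have 1: "cmod (P0 \<epsilon> \<theta> t - cis (\<theta> - psi \<epsilon> t) * of_real (cos t)) \<le> 1/10000" .
    have "cmod (p \<theta> t - P0 \<epsilon> \<theta> t) \<le> 1/1000000" using near(2)[OF tT, of \<theta>] \<epsilon>_small(4) by linarith
    from norm_diff_triangle_le[OF this 1]
    have "cmod (p \<theta> t - cis (\<theta> - psi \<epsilon> t) * of_real (cos t)) \<le> 1/1000" by simp
    then show ?thesis using False by (simp add: mid_def t_def)
  qed
  then show ?thesis
    unfolding x(2) using x(1) ps
    by (intro exI[of _ x] conjI exI[of _ "psi \<epsilon> t"]) (auto simp: mult_ac)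
qed

lemma mid_large: "1 / 4 \<le> cmod (mid \<theta>)"
  using z_large[OF _ _ enc_tau(1), of n \<theta> \<theta>] p_large[OF _ _ enc_tau(1), of n \<theta> \<theta>] by (auto simp: mid_def)

text \<open>By \<open>mid_near\<close> the direction of \<open>mid\<close> is almost that of
  \<open>cis (\<theta> - \<phi>)\<close> with \<phi> at most \<open>1/200\<close>. Its component
  across \<open>cis \<theta>0\<close> therefore changes sign between the angles
  \<open>\<theta>0 - pi / 24\<close> and \<open>\<theta>0 + pi / 24\<close>.\<close>

lemma mid_real_axis:
  "\<exists>\<theta>. \<bar>\<theta> - \<theta>0\<bar> \<le> pi / 24 \<and> Im (cis (- \<theta>0) * mid \<theta>) = 0"
proof -
  define e :: real where "e = (-1) ^ (n div 2)"
  define h where "h \<theta> = e * Im (cis (- \<theta>0) * mid \<theta>)" for \<theta>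
  have e1: "e * e = 1" "\<bar>e\<bar> = 1" by (simp_all add: e_def power_abs flip: power_mult_distrib)
  have h: "\<exists>x\<ge>1/2. \<exists>\<phi>. 0 \<le> \<phi> \<and> \<phi> \<le> 1/200 \<and> \<bar>h \<theta> - x * sin (\<theta> - \<theta>0 - \<phi>)\<bar> \<le> 1/1000" for \<theta>
  proof -
    obtain x \<phi> where x: "1/2 \<le> x" "0 \<le> \<phi>" "\<phi> \<le> 1/200"
      "cmod (mid \<theta> - (-1) ^ (n div 2) * of_real x * cis (\<theta> - \<phi>)) \<le> 1/1000"
      using mid_near[of \<theta>] by blast
    have e: "(-1) ^ (n div 2) = complex_of_real e" by (simp add: e_def)
    have "h \<theta> - x * sin (\<theta> - \<theta>0 - \<phi>) = e * Im (cis (- \<theta>0) * (mid \<theta> - of_real e * of_real x * cis (\<theta> - \<phi>)))"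
    proof -
      have "cis (- \<theta>0) * (of_real e * of_real x * cis (\<theta> - \<phi>)) = of_real (e * x) * (cis (- \<theta>0) * cis (\<theta> - \<phi>))"
        by simp
      also have "cis (- \<theta>0) * cis (\<theta> - \<phi>) = cis (\<theta> - \<theta>0 - \<phi>)"
        unfolding cis_mult by (simp add: algebra_simps)
      finally have "Im (cis (- \<theta>0) * (of_real e * of_real x * cis (\<theta> - \<phi>))) = Im (of_real (e * x) * cis (\<theta> - \<theta>0 - \<phi>))"
        by (rule arg_cong)
      also have "\<dots> = e * x * sin (\<theta> - \<theta>0 - \<phi>)" by simp
      finally have "Im (cis (- \<theta>0) * (of_real e * of_real x * cis (\<theta> - \<phi>))) = e * x * sin (\<theta> - \<theta>0 - \<phi>)" .
      then have "e * Im (cis (- \<theta>0) * (mid \<theta> - of_real e * of_real x * cis (\<theta> - \<phi>)))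
          = h \<theta> - (e * e) * (x * sin (\<theta> - \<theta>0 - \<phi>))"
        unfolding h_def right_diff_distrib minus_complex.sel by (simp add: mult_ac)
      then show ?thesis by (simp add: e1)
    qed
    then have "\<bar>h \<theta> - x * sin (\<theta> - \<theta>0 - \<phi>)\<bar> \<le> cmod (cis (- \<theta>0) * (mid \<theta> - of_real e * of_real x * cis (\<theta> - \<phi>)))"
      by (simp only: abs_mult e1 mult_1 abs_Im_le_cmod)
    also have "\<dots> \<le> 1/1000" using x(4) by (simp add: norm_mult e)
    finally show ?thesis using x by blast
  qed
  have s: "1/20 \<le> sin y" if "1/10 \<le> y" "y \<le> pi / 3" for y
    using sin_ge_half[of y] that by simp
  have up: "0 \<le> h (\<theta>0 + pi / 24)"
  proof -
    obtain x \<phi> where x: "1/2 \<le> x" "0 \<le> \<phi>" "\<phi> \<le> 1/200"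
      "\<bar>h (\<theta>0 + pi / 24) - x * sin (\<theta>0 + pi / 24 - \<theta>0 - \<phi>)\<bar> \<le> 1/1000" using h by blast
    have "1/20 \<le> sin (\<theta>0 + pi / 24 - \<theta>0 - \<phi>)" by (rule s) (use x pi_gt3 in linarith)+
    then have "1/2 * (1/20) \<le> x * sin (\<theta>0 + pi / 24 - \<theta>0 - \<phi>)" using x(1) by (intro mult_mono) auto
    then show ?thesis using abs_le_D2[OF x(4)] by linarith
  qed
  have lo: "h (\<theta>0 - pi / 24) \<le> 0"
  proof -
    obtain x \<phi> where x: "1/2 \<le> x" "0 \<le> \<phi>" "\<phi> \<le> 1/200"
      "\<bar>h (\<theta>0 - pi / 24) - x * sin (\<theta>0 - pi / 24 - \<theta>0 - \<phi>)\<bar> \<le> 1/1000" using h by blast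
    have "1/20 \<le> sin (- (\<theta>0 - pi / 24 - \<theta>0 - \<phi>))" by (rule s) (use x pi_gt3 in linarith)+
    then have "1/2 * (1/20) \<le> x * - sin (\<theta>0 - pi / 24 - \<theta>0 - \<phi>)"
      using x(1) unfolding sin_minus by (intro mult_mono) auto
    then show ?thesis using abs_le_D1[OF x(4)] by linarith
  qed
  have "\<exists>\<theta>. \<theta>0 - pi / 24 \<le> \<theta> \<and> \<theta> \<le> \<theta>0 + pi / 24 \<and> h \<theta> = 0"
  proof (rule IVT'[of h, OF lo up])
    have "continuous_on UNIV h"
      unfolding h_def mid_def
      by (cases "odd n") (auto intro!: continuous_intros state_continuous)
    then show "continuous_on {\<theta>0 - pi / 24..\<theta>0 + pi / 24} h" by (rule continuous_on_subset) auto
  qed simp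
  then obtain \<theta> where \<theta>: "\<theta>0 - pi / 24 \<le> \<theta>" "\<theta> \<le> \<theta>0 + pi / 24" "h \<theta> = 0" by blast
  then have "\<bar>\<theta> - \<theta>0\<bar> \<le> pi / 24" by linarith
  moreover have "Im (cis (- \<theta>0) * mid \<theta>) = 0" using \<theta>(3) e1 by (auto simp: h_def)
  ultimately show ?thesis by blast
qed

text \<open>Here \<zeta> spans the real or the imaginary axis, \<open>a\<close> lies on that axis
  and \<open>b\<close> across it. The two conclusions say that the reversing symmetry, which maps
  \<open>(a, b)\<close> to \<open>(cnj a, - cnj b)\<close>, fixes the pair up to the sign
  \<open>s\<close>.\<close>

lemma perpendicular:
  assumes c: "cnj \<zeta> = of_real s * \<zeta>" "cmod \<zeta> = 1" "Im (cnj \<zeta> * a) = 0" "a \<noteq> 0" "Re (cnj a * b) = 0"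
  shows "cnj a = of_real s * a" "cnj b = - of_real s * b"
proof -
  have z1: "\<zeta> * cnj \<zeta> = 1" using complex_norm_square[of \<zeta>] c(2) by simp
  obtain w where w: "cnj \<zeta> * a = of_real w" using c(3) by (metis complex_is_Real_iff Reals_cases)
  have aw: "a = \<zeta> * of_real w" using z1 w by (metis mult.assoc mult.commute mult.left_neutral)
  then have w0: "w \<noteq> 0" using c(4) by auto
  show "cnj a = of_real s * a" by (simp add: aw c(1))
  have "Re (of_real w * (cnj \<zeta> * b)) = 0" using c(5) unfolding aw by (simp only: complex_cnj_mult complex_cnj_complex_of_real mult_ac)
  then have "Re (cnj \<zeta> * b) = 0" using w0 by (simp only: times_complex.sel Re_complex_of_real Im_complex_of_real) simp
  then have "cnj \<zeta> * b = \<i> * of_real (Im (cnj \<zeta> * b))" by (simp add: complex_eq_iff)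
  then obtain v where v: "cnj \<zeta> * b = \<i> * of_real v" by blast
  then have bv: "b = \<zeta> * (\<i> * of_real v)" using z1 by (metis mult.assoc mult.commute mult.left_neutral)
  show "cnj b = - of_real s * b" by (simp add: bv c(1))
qed

text \<open>The angle is chosen so that the state at the middle critical time is fixed, up to sign,
  by the reversing symmetry. By uniqueness the second half of the orbit mirrors the first, so an
  orbit that starts at collision also ends there.\<close>

lemma symmetric_collision:
  assumes \<theta>0: "cnj (cis \<theta>0) = of_real s * cis \<theta>0" "s = 1 \<or> s = -1"
  shows "\<exists>\<theta>. \<bar>\<theta> - \<theta>0\<bar> \<le> pi / 24 \<and> z \<theta> (enc \<theta> (2 * n)) = 0 \<and>
    (\<exists>\<sigma>\<in>{1, -1}. \<forall>t\<in>{0..enc \<theta> (2 * n)}. z \<theta> (enc \<theta> (2 * n) - t) = of_real \<sigma> * cnj (z \<theta> t))"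
proof -
  obtain \<theta> where \<theta>: "\<bar>\<theta> - \<theta>0\<bar> \<le> pi / 24" "Im (cis (- \<theta>0) * mid \<theta>) = 0"
    using mid_real_axis by blast
  define \<tau> where "\<tau> = enc \<theta> n"
  have \<tau>: "\<tau> \<in> {0..T}" unfolding \<tau>_def by (intro enc_range) simp
  have \<tau>n: "\<bar>\<tau> - real n * (pi / 2)\<bar> \<le> 1/100000"
    using enc_near[of n \<theta>] \<epsilon>_small(4) unfolding \<tau>_def by simp
  have "2 * \<tau> - real (2 * n) * (pi / 2) = 2 * (\<tau> - real n * (pi / 2))"
    by (simp add: algebra_simps)
  then have "\<bar>2 * \<tau> - real (2 * n) * (pi / 2)\<bar> = 2 * \<bar>\<tau> - real n * (pi / 2)\<bar>"
    by (simp only: abs_mult abs_numeral)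
  then have \<tau>2n: "\<bar>2 * \<tau> - real (2 * n) * (pi / 2)\<bar> \<le> pi / 6" using \<tau>n pi_gt3 by linarith
  then have \<tau>2z: "2 * \<tau> \<in> zone (2 * n)"
    using \<tau> unfolding near_sine.zone_def[OF near_sine] by simp
  then have \<tau>2: "2 * \<tau> \<le> T" using zone_sub[of "2 * n"] by auto
  have rad: "Re (cnj (z \<theta> \<tau>) * p \<theta> \<tau>) = 0"
    using enc_tau(2)[of n \<theta>] by (simp add: radial_def \<tau>_def)
  have "\<exists>\<sigma>\<in>{1, -1}. of_real \<sigma> * cnj (z \<theta> \<tau>) = z \<theta> \<tau> \<and> - (of_real \<sigma> * cnj (p \<theta> \<tau>)) = p \<theta> \<tau>"
  proof -
    have ss: "complex_of_real s * complex_of_real s = 1" using \<theta>0(2) by auto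
    have m0: "mid \<theta> \<noteq> 0" using mid_large[of \<theta>] by auto
    have im: "Im (cnj (cis \<theta>0) * mid \<theta>) = 0" using \<theta>(2) by (simp add: cis_cnj)
    show ?thesis
    proof (cases "odd n")
      case True
      then have m: "mid \<theta> = z \<theta> \<tau>" by (simp add: mid_def \<tau>_def)
      from perpendicular[OF \<theta>0(1) _ im m0, of "p \<theta> \<tau>"] rad m
      have "cnj (z \<theta> \<tau>) = of_real s * z \<theta> \<tau>" "cnj (p \<theta> \<tau>) = - of_real s * p \<theta> \<tau>" by auto
      then show ?thesis using \<theta>0(2) ss by (intro bexI[of _ s]) (auto simp flip: mult.assoc)
    next
      case False
      then have m: "mid \<theta> = p \<theta> \<tau>" by (simp add: mid_def \<tau>_def)
      have "Re (cnj (p \<theta> \<tau>) * z \<theta> \<tau>) = 0" using rad by (simp add: algebra_simps)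
      from perpendicular[OF \<theta>0(1) _ im m0, of "z \<theta> \<tau>"] this m
      have "cnj (p \<theta> \<tau>) = of_real s * p \<theta> \<tau>" "cnj (z \<theta> \<tau>) = - of_real s * z \<theta> \<tau>" by auto
      then show ?thesis using \<theta>0(2) ss by (intro bexI[of _ "- s"]) (auto simp flip: mult.assoc)
    qed
  qed
  then obtain \<sigma> :: real where "\<sigma> \<in> {1, -1}"
    and \<sigma>': "of_real \<sigma> * cnj (z \<theta> \<tau>) = z \<theta> \<tau>" "- (of_real \<sigma> * cnj (p \<theta> \<tau>)) = p \<theta> \<tau>"
    by blast
  then have "\<sigma> = 1 \<or> \<sigma> = -1" by simp
  note \<sigma> = this \<sigma>'
  define V where "V t = (of_real \<sigma> * cnj (z \<theta> (2 * \<tau> - t)), - (of_real \<sigma> * cnj (p \<theta> (2 * \<tau> - t))))" for t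
  have Y\<tau>: "lc_sol \<epsilon> \<nu> \<mu> (2 * \<tau>) (Y \<theta>)" by (rule lc_sol_subset[OF sol \<tau>2])
  have V: "lc_sol \<epsilon> \<nu> \<mu> (2 * \<tau>) V"
  proof -
    note r = lc_sol_reverse[OF Y\<tau>]
    from \<sigma>(1) show ?thesis
    proof
      assume "\<sigma> = 1"
      then show ?thesis using r by (simp add: V_def[abs_def])
    next
      assume "\<sigma> = -1"
      then show ?thesis using lc_sol_minus[OF r] by (simp add: V_def[abs_def])
    qed
  qed
  \<comment> \<open>\<open>lc_sol_unique\<close> runs forward in time only; the first half follows
    from the second because the reflection about the middle is an involution.\<close>
  have later: "z \<theta> t = of_real \<sigma> * cnj (z \<theta> (2 * \<tau> - t))" if t: "\<tau> \<le> t" "t \<le> 2 * \<tau>" for t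
  proof -
    have "V t = Y \<theta> t"
    proof (rule lc_sol_unique[OF _ _ _ V Y\<tau> _ t])
      show "V \<tau> = Y \<theta> \<tau>" using \<sigma>(2,3) by (simp add: V_def prod_eq_iff)
    qed (use \<epsilon>0 \<epsilon>_small(1) \<nu> \<mu> \<tau> in auto)
    then show ?thesis unfolding V_def by (metis fst_conv)
  qed
  have sym: "z \<theta> (2 * \<tau> - t) = of_real \<sigma> * cnj (z \<theta> t)" if t: "t \<in> {0..2 * \<tau>}" for t
  proof (cases "\<tau> \<le> t")
    case True
    then have "z \<theta> t = of_real \<sigma> * cnj (z \<theta> (2 * \<tau> - t))" using later t by auto
    then show ?thesis using \<sigma>(1) by auto
  next
    case False
    then show ?thesis using later[of "2 * \<tau> - t"] t by auto
  qed
  have z2: "z \<theta> (2 * \<tau>) = 0" using sym[of 0] \<tau> by (simp add: Y_0)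
  \<comment> \<open>The mirrored collision time is a zero of \<open>radial\<close> in zone
    \<open>2 * n\<close>, and that zone contains only one.\<close>
  have "2 * \<tau> = enc \<theta> (2 * n)" by (rule enc_tau(3)[OF _ \<tau>2z]) (simp_all add: radial_def z2)
  then show ?thesis using \<theta>(1) z2 sym \<sigma>(1) by auto
qed

end

section \<open>Existence and symmetries of the rescaled orbits\<close>

text \<open>The threshold \<open>e\<close> depends on \<open>n\<close> alone, and \<epsilon> and
  \<nu> range below it independently of each other. The reflection of the diagonal orbit is produced
  later by \<open>ec_solution_reverse\<close>.\<close>

lemma scaled_orbits_exist:
  assumes n: "1 \<le> n"
  shows "\<exists>e>0. \<forall>\<epsilon>\<in>{0<..e}. \<forall>\<nu>\<in>{0<..e}. \<forall>\<mu>\<in>{0<..<1}. \<nu> \<le> 1/100 \<and>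
    (\<forall>d\<in>{1, -1}. \<exists>T Y. ec_solution \<epsilon> \<nu> \<mu> n T Y \<and> along d T Y \<and>
        (\<forall>t\<in>{0..T}. (fst (Y (T - t)))\<^sup>2 = cnj ((fst (Y t))\<^sup>2))) \<and>
    (\<exists>T Y. ec_solution \<epsilon> \<nu> \<mu> n T Y \<and> along \<i> T Y)"
proof -
  define T where "T = real n * pi + pi / 6"
  have T0: "0 < T" by (auto simp: T_def intro: add_nonneg_pos)
  obtain C E \<epsilon>1 where C: "C > 0" "E > 0" "\<epsilon>1 > 0"
    and Y: "\<forall>\<epsilon>\<in>{0<..\<epsilon>1}. \<forall>\<nu>\<in>{0<..1/100}. \<forall>\<mu>\<in>{0..1}.
      \<exists>Y :: real \<Rightarrow> real \<Rightarrow> complex \<times> complex. (\<forall>\<theta>. Y \<theta> 0 = (0, cis \<theta>) \<and> lc_sol \<epsilon> \<nu> \<mu> T (Y \<theta>)) \<and>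
        (\<forall>\<theta>. \<forall>t\<in>{0..T}. norm (Y \<theta> t - (Z0 \<epsilon> \<theta> t, P0 \<epsilon> \<theta> t)) \<le> C * \<epsilon>\<^sup>2) \<and>
        (\<forall>\<theta> \<theta>'. \<forall>t\<in>{0..T}. norm (Y \<theta> t - Y \<theta>' t) \<le> E * \<bar>\<theta> - \<theta>'\<bar>)"
    using lc_solutions_near_kepler[OF T0] by blast
  obtain A where A: "A > 0"
    "\<And>\<nu> z. 0 < \<nu> \<Longrightarrow> \<nu> \<le> 1/100 \<Longrightarrow> cmod z \<le> 3 \<Longrightarrow> \<bar>gf \<nu> z - 3 * Re (z\<^sup>2)\<bar> \<le> A * \<nu>"
    "\<And>\<nu> z. 0 < \<nu> \<Longrightarrow> \<nu> \<le> 1/100 \<Longrightarrow> cmod z \<le> 3 \<Longrightarrow> \<bar>inverse (qf \<nu> z) ^ 5 - 1\<bar> \<le> A * \<nu>"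
    using torque_constants by metis
  obtain B1 where B1: "B1 > 0"
    "\<And>i z. i \<in> params \<Longrightarrow> z \<in> cball 0 3 \<Longrightarrow> norm (torque (fst (snd i)) z) \<le> B1"
    "\<And>i z w. i \<in> params \<Longrightarrow> z \<in> cball 0 3 \<Longrightarrow> w \<in> cball 0 3 \<Longrightarrow>
       norm (torque (fst (snd i)) z - torque (fst (snd i)) w) \<le> B1 * norm (z - w)"
    using ublip_torque by (rule ublipE) blast
  obtain B2 where B2: "B2 > 0"
    "\<And>i z. i \<in> params \<Longrightarrow> z \<in> cball 0 3 \<Longrightarrow> cmod (Gf (snd (snd i)) (fst (snd i)) z) \<le> B2"
    using ublip_Gf by (rule ublipE) blast
  define B where "B = B1 + B2"
  have B0: "B > 0" using B1 B2 by (simp add: B_def)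
  define e where "e = Min {\<epsilon>1, 1/100, 1 / (1000 * A), 1 / (20000 * (1000 + 10 * C + 3 * B)),
      1 / (B * C * (T + 10)), 1 / (200 * (T + 1))}"
  have pos: "0 < 1000 + 10 * C + 3 * B" "0 < B * C * (T + 10)" "0 < T + 1"
    using C B0 T0 by (auto intro!: mult_pos_pos add_pos_pos)
  have e: "0 < e" "e \<le> \<epsilon>1" "e \<le> 1/100" "e \<le> 1 / (1000 * A)"
    "e \<le> 1 / (20000 * (1000 + 10 * C + 3 * B))" "e \<le> 1 / (B * C * (T + 10))" "e \<le> 1 / (200 * (T + 1))"
    unfolding e_def using C A(1) pos by auto
  have "\<nu> \<le> 1/100 \<and>
    (\<forall>d\<in>{1, -1}. \<exists>T Y. ec_solution \<epsilon> \<nu> \<mu> n T Y \<and> along d T Y \<and>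
        (\<forall>t\<in>{0..T}. (fst (Y (T - t)))\<^sup>2 = cnj ((fst (Y t))\<^sup>2))) \<and>
    (\<exists>T Y. ec_solution \<epsilon> \<nu> \<mu> n T Y \<and> along \<i> T Y)"
    if \<epsilon>: "\<epsilon> \<in> {0<..e}" and \<nu>: "\<nu> \<in> {0<..e}" and \<mu>: "\<mu> \<in> {0<..<1}" for \<epsilon> \<nu> \<mu>
  proof -
    have \<epsilon>1: "\<epsilon> \<in> {0<..\<epsilon>1}" "\<nu> \<in> {0<..1/100}" "\<mu> \<in> {0..1}" "(\<epsilon>, \<nu>, \<mu>) \<in> params"
      using \<epsilon> \<nu> \<mu> e by (auto simp: params_def)
    obtain Y where Y: "\<And>\<theta>. Y \<theta> 0 = (0, cis \<theta>)" "\<And>\<theta>. lc_sol \<epsilon> \<nu> \<mu> T (Y \<theta>)"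
      "\<And>\<theta> t. t \<in> {0..T} \<Longrightarrow> norm (Y \<theta> t - (Z0 \<epsilon> \<theta> t, P0 \<epsilon> \<theta> t)) \<le> C * \<epsilon>\<^sup>2"
      "\<And>\<theta> \<theta>' t. t \<in> {0..T} \<Longrightarrow> norm (Y \<theta> t - Y \<theta>' t) \<le> E * \<bar>\<theta> - \<theta>'\<bar>"
      using Y \<epsilon>1 by metis
    interpret lc_orbits \<nu> A n \<epsilon> \<mu> T C E B Y
    proof
      show "A * \<nu> \<le> 1/1000"
      proof -
        have "\<nu> \<le> 1 / (1000 * A)" using \<nu> e(4) by auto
        then show ?thesis using A(1) by (simp add: field_simps)
      qed
      show "\<epsilon> * (1000 + 10 * C + 3 * B) \<le> 1/20000"
      proof -
        have "\<epsilon> \<le> 1 / (20000 * (1000 + 10 * C + 3 * B))" using \<epsilon> e(5) by auto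
        then show ?thesis using pos(1) by (simp add: pos_le_divide_eq algebra_simps)
      qed
      show "\<epsilon> * (B * C * (T + 10)) \<le> 1"
      proof -
        have "\<epsilon> \<le> 1 / (B * C * (T + 10))" using \<epsilon> e(6) by auto
        then show ?thesis using pos(2) by (simp add: pos_le_divide_eq)
      qed
      show "\<epsilon> * (T + 1) \<le> 1/200"
      proof -
        have "\<epsilon> \<le> 1 / (200 * (T + 1))" using \<epsilon> e(7) by auto
        then show ?thesis using pos(3) by (simp add: pos_le_divide_eq algebra_simps)
      qed
      show "\<bar>gf \<nu> z - 3 * Re (z\<^sup>2)\<bar> \<le> A * \<nu>" "\<bar>inverse (qf \<nu> z) ^ 5 - 1\<bar> \<le> A * \<nu>"
        if "cmod z \<le> 3" for z using A(2,3) that \<epsilon>1 by auto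
      show "\<bar>torque \<nu> z\<bar> \<le> B" if "cmod z \<le> 3" for z
        using B1(2)[OF \<epsilon>1(4), of z] that B2(1) by (simp add: B_def)
      show "cmod (Gf \<mu> \<nu> z) \<le> B" if "cmod z \<le> 3" for z
        using B2(2)[OF \<epsilon>1(4), of z] that B1(1) by (simp add: B_def)
      show "\<bar>torque \<nu> z - torque \<nu> w\<bar> \<le> B * cmod (z - w)" if "cmod z \<le> 3" "cmod w \<le> 3" for z w
      proof -
        have "\<bar>torque \<nu> z - torque \<nu> w\<bar> \<le> B1 * cmod (z - w)"
          using B1(3)[OF \<epsilon>1(4), of z w] that by simp
        also have "\<dots> \<le> B * cmod (z - w)"
          using B2(1) by (intro mult_right_mono) (auto simp: B_def)
        finally show ?thesis .
      qed
    qed (use n \<epsilon> \<mu> \<epsilon>1 Y C B0 in \<open>auto simp: T_def\<close>)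
    have sym: "\<exists>T Y. ec_solution \<epsilon> \<nu> \<mu> n T Y \<and> along (\<i> ^ j) T Y \<and>
        (\<forall>t\<in>{0..T}. (fst (Y (T - t)))\<^sup>2 = cnj ((fst (Y t))\<^sup>2))"
      if j: "cnj (cis (real j * (pi / 4))) = of_real s * cis (real j * (pi / 4))" "s = 1 \<or> s = -1" for j s
    proof -
      obtain \<theta> \<sigma> where \<theta>: "\<bar>\<theta> - real j * (pi / 4)\<bar> \<le> pi / 24" "fst (Y \<theta> (enc \<theta> (2 * n))) = 0"
        "\<sigma> \<in> {1, -1 :: real}"
        "\<forall>t\<in>{0..enc \<theta> (2 * n)}. fst (Y \<theta> (enc \<theta> (2 * n) - t)) = of_real \<sigma> * cnj (fst (Y \<theta> t))"
        using symmetric_collision[OF j] by blast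
      have "(fst (Y \<theta> (enc \<theta> (2 * n) - t)))\<^sup>2 = cnj ((fst (Y \<theta> t))\<^sup>2)" if "t \<in> {0..enc \<theta> (2 * n)}" for t
        using \<theta>(3,4) that by (auto simp: power_mult_distrib)
      then show ?thesis using ec_solution[OF \<theta>(1,2)] along_direction[OF \<theta>(1)] by blast
    qed
    have "\<exists>T Y. ec_solution \<epsilon> \<nu> \<mu> n T Y \<and> along 1 T Y \<and>
        (\<forall>t\<in>{0..T}. (fst (Y (T - t)))\<^sup>2 = cnj ((fst (Y t))\<^sup>2))"
      using sym[of 0 1] by simp
    moreover have "\<exists>T Y. ec_solution \<epsilon> \<nu> \<mu> n T Y \<and> along (-1) T Y \<and>
        (\<forall>t\<in>{0..T}. (fst (Y (T - t)))\<^sup>2 = cnj ((fst (Y t))\<^sup>2))"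
      using sym[of 2 "-1"] by simp
    moreover have "\<exists>T Y. ec_solution \<epsilon> \<nu> \<mu> n T Y \<and> along \<i> T Y"
    proof -
      obtain \<theta> where \<theta>: "\<bar>\<theta> - real 1 * (pi / 4)\<bar> \<le> pi / 24" "fst (Y \<theta> (enc \<theta> (2 * n))) = 0"
        using diagonal_collision by auto
      show ?thesis using ec_solution[OF \<theta>] along_direction[OF \<theta>(1)] by auto
    qed
    ultimately show ?thesis using \<epsilon>1(2) by auto
  qed
  then show ?thesis using e(1) by blast
qed

section \<open>Changes of time, direction and sign for scaled orbits\<close>

lemma rel_max_at_affine:
  assumes "A \<noteq> 0"
  shows "rel_max_at (\<lambda>t. f (A * t + B)) s \<longleftrightarrow> rel_max_at f (A * s + B)"
proof
  assume "rel_max_at (\<lambda>t. f (A * t + B)) s"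
  then obtain d where d: "d > 0" "\<And>t. t \<noteq> s \<Longrightarrow> \<bar>t - s\<bar> < d \<Longrightarrow> f (A * t + B) \<le> f (A * s + B)"
    unfolding rel_max_at_def eventually_at dist_real_def by blast
  have "f x \<le> f (A * s + B)" if "x \<noteq> A * s + B" "\<bar>x - (A * s + B)\<bar> < \<bar>A\<bar> * d" for x
  proof -
    have x: "A * ((x - B) / A) + B = x" using assms by simp
    have "(x - B) / A - s = (x - (A * s + B)) / A" using assms by (simp add: field_simps)
    then have "\<bar>(x - B) / A - s\<bar> < d" using that(2) assms by (simp add: abs_divide field_simps)
    moreover have "(x - B) / A \<noteq> s" using that(1) x by auto
    ultimately show ?thesis using d(2)[of "(x - B) / A"] x by simp
  qed
  moreover have "\<bar>A\<bar> * d > 0" using assms d by simp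
  ultimately show "rel_max_at f (A * s + B)"
    unfolding rel_max_at_def eventually_at dist_real_def by blast
next
  assume "rel_max_at f (A * s + B)"
  then obtain d where d: "d > 0" "\<And>x. x \<noteq> A * s + B \<Longrightarrow> \<bar>x - (A * s + B)\<bar> < d \<Longrightarrow> f x \<le> f (A * s + B)"
    unfolding rel_max_at_def eventually_at dist_real_def by blast
  have "f (A * t + B) \<le> f (A * s + B)" if "t \<noteq> s" "\<bar>t - s\<bar> < d / \<bar>A\<bar>" for t
  proof (rule d(2))
    show "A * t + B \<noteq> A * s + B" using that assms by simp
    have "A * t + B - (A * s + B) = A * (t - s)" by (simp add: algebra_simps)
    then have "\<bar>A * t + B - (A * s + B)\<bar> = \<bar>A\<bar> * \<bar>t - s\<bar>" by (simp only: abs_mult)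
    then show "\<bar>A * t + B - (A * s + B)\<bar> < d" using that assms by (simp add: field_simps)
  qed
  moreover have "d / \<bar>A\<bar> > 0" using assms d by simp
  ultimately show "rel_max_at (\<lambda>t. f (A * t + B)) s"
    unfolding rel_max_at_def eventually_at dist_real_def by blast
qed

lemma rel_max_at_scale: "0 < k \<Longrightarrow> rel_max_at (\<lambda>t. k * f t) s \<longleftrightarrow> rel_max_at f s"
  by (simp add: rel_max_at_def)

text \<open>Applied with factor \<open>-1\<close> for the reversal of time and with factor
  \<open>om\<close> for the return to the regularized time.\<close>

lemma card_rel_max_affine:
  assumes A: "A \<noteq> 0" and I: "\<And>t. t \<in> I \<longleftrightarrow> A * t + B \<in> J"
  shows "card {t \<in> I. rel_max_at (\<lambda>t. f (A * t + B)) t} = card {t \<in> J. rel_max_at f t}"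
proof (rule bij_betw_same_card)
  show "bij_betw (\<lambda>t. A * t + B) {t \<in> I. rel_max_at (\<lambda>t. f (A * t + B)) t} {t \<in> J. rel_max_at f t}"
  proof (rule bij_betw_byWitness[where f' = "\<lambda>x. (x - B) / A"])
    show "(\<lambda>x. (x - B) / A) ` {t \<in> J. rel_max_at f t} \<subseteq> {t \<in> I. rel_max_at (\<lambda>t. f (A * t + B)) t}"
      using A by (auto simp: rel_max_at_affine I)
  qed (use A I in \<open>auto simp: rel_max_at_affine\<close>)
qed

lemma ec_solution_minus:
  assumes "ec_solution \<epsilon> \<nu> \<mu> n T Y"
  shows "ec_solution \<epsilon> \<nu> \<mu> n T (\<lambda>t. - Y t)"
  using assms lc_sol_minus unfolding ec_solution_def by simp

text \<open>The reversed orbit is ejected with the collision velocity of the original one. Its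
  modulus is 1 by the energy integral, because \<open>Phi\<close> vanishes at the collision.\<close>

lemma ec_solution_reverse:
  assumes ec: "ec_solution \<epsilon> \<nu> \<mu> n T Y" and \<nu>: "0 < \<nu>" "\<nu> \<le> 1/100"
  shows "ec_solution \<epsilon> \<nu> \<mu> n T (\<lambda>t. (cnj (fst (Y (T - t))), - cnj (snd (Y (T - t)))))"
proof -
  have T: "0 < T" and s: "lc_sol \<epsilon> \<nu> \<mu> T Y" using ec by (auto simp: ec_solution_def)
  have "(cmod (snd (Y T)))\<^sup>2 = 1 - (cmod (fst (Y T)))\<^sup>2 + 2 * \<epsilon>\<^sup>2 * Phi \<mu> \<nu> (fst (Y T))"
    by (rule lc_sol_energy[OF s \<nu>]) (use ec in \<open>auto simp: ec_solution_def\<close>)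
  then have "(cmod (snd (Y T)))\<^sup>2 = 1" using ec by (simp add: ec_solution_def Phi_def)
  then have p: "cmod (snd (Y T)) = 1" by (simp add: power2_eq_1_iff) (smt (verit) norm_ge_zero)
  have "card {t \<in> {0<..<T}. rel_max_at (\<lambda>t. (cmod (fst (Y ((-1) * t + T))))\<^sup>2) t}
      = card {t \<in> {0<..<T}. rel_max_at (\<lambda>t. (cmod (fst (Y t)))\<^sup>2) t}"
    by (rule card_rel_max_affine) auto
  then show ?thesis
    using ec p lc_sol_reverse[OF s] unfolding ec_solution_def by auto
qed

lemma along_reverse:
  assumes "along d T Y"
  shows "along (cnj d) T (\<lambda>t. (cnj (fst (Y (T - t))), - cnj (snd (Y (T - t)))))"
proof -
  have c: "cmod ((cnj a)\<^sup>2 - cnj b) = cmod (a\<^sup>2 - b)" for a b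
    by (metis complex_cnj_diff complex_cnj_power complex_mod_cnj)
  have c': "cmod ((cnj a)\<^sup>2 - cnj d * of_real y) = cmod (a\<^sup>2 - d * of_real y)" for a y
    using c[of a "d * of_real y"] by simp
  obtain t where t: "t \<in> {0..T}" "cmod ((fst (Y t))\<^sup>2 - d) \<le> 9/20"
    using assms by (auto simp: along_def)
  have "T - t \<in> {0..T}" using t by auto
  then have "\<exists>t\<in>{0..T}. cmod ((cnj (fst (Y (T - t))))\<^sup>2 - cnj d) \<le> 9/20"
    using t(2) c by (intro bexI[of _ "T - t"]) auto
  moreover have "\<exists>y\<in>{0..1}. cmod ((cnj (fst (Y (T - t))))\<^sup>2 - cnj d * of_real y) \<le> 9/20"
    if "t \<in> {0..T}" for t
  proof -
    have "T - t \<in> {0..T}" using that by auto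
    then show ?thesis using assms unfolding along_def c' by blast
  qed
  ultimately show ?thesis unfolding along_def fst_conv by blast
qed

lemma along_minus: "along d T Y \<Longrightarrow> along d T (\<lambda>t. - Y t)"
  by (simp add: along_def)

text \<open>The half-open interval meets every antipodal pair of unit vectors. The boundary value
  \<open>Arg p = pi\<close> passes to angle 0 after the change of sign.\<close>

lemma unit_angle_cases:
  assumes "cmod p = 1"
  shows "(\<exists>\<theta>\<in>{0..<pi}. p = cis \<theta>) \<or> (\<exists>\<theta>\<in>{0..<pi}. - p = cis \<theta>)"
proof -
  have "p \<noteq> 0" using assms by auto
  then have p: "p = cis (Arg p)" using cis_Arg[of p] assms by (simp add: sgn_div_norm)
  have "- pi < Arg p" "Arg p \<le> pi" using Arg_bounded[of p] by auto
  then consider "Arg p \<in> {0..<pi}" | "Arg p = pi" | "Arg p + pi \<in> {0..<pi}" by fastforce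
  then show ?thesis
  proof cases
    case 2
    then have "- p = cis 0" using p by simp
    then show ?thesis by (intro disjI2 bexI[of _ 0]) auto
  next
    case 3
    then show ?thesis using minus_cis[of "Arg p"] p by metis
  qed (use p in blast)
qed

lemma ec_solution_normalize:
  assumes "ec_solution \<epsilon> \<nu> \<mu> n T Y" "along d T Y"
  obtains Y' where "ec_solution \<epsilon> \<nu> \<mu> n T Y'" "along d T Y'"
    "\<exists>\<theta>\<in>{0..<pi}. snd (Y' 0) = cis \<theta>" "\<And>t. (fst (Y' t))\<^sup>2 = (fst (Y t))\<^sup>2"
proof -
  have "cmod (snd (Y 0)) = 1" using assms(1) by (simp add: ec_solution_def)
  from unit_angle_cases[OF this] show thesis
  proof
    assume "\<exists>\<theta>\<in>{0..<pi}. snd (Y 0) = cis \<theta>"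
    then show thesis using that[of Y] assms by simp
  next
    assume "\<exists>\<theta>\<in>{0..<pi}. - snd (Y 0) = cis \<theta>"
    then show thesis
      using that[of "\<lambda>t. - Y t"] ec_solution_minus[OF assms(1)] along_minus[OF assms(2)] by simp
  qed
qed

lemma quarter_turns_separated:
  assumes "d \<in> {1, -1, \<i>, - \<i>}" "d' \<in> {1, -1, \<i>, - \<i>}" "d \<noteq> d'" "0 \<le> y"
  shows "1 \<le> cmod (d - d' * of_real y)"
proof -
  have "1 \<le> \<bar>Re (d - d' * of_real y)\<bar> \<or> 1 \<le> \<bar>Im (d - d' * of_real y)\<bar>"
    using assms by auto
  then show ?thesis
    using abs_Re_le_cmod[of "d - d' * of_real y"] abs_Im_le_cmod[of "d - d' * of_real y"] by linarith
qed

section \<open>Return to the original variables\<close>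

text \<open>The substitution \<open>u + \<i> * v = lam * z (om * s)\<close>, where \<open>c\<close> is the cube root of the mass
  \<open>1 - \<mu>\<close>, turns the regularized equations into \<open>lc_field\<close>.\<close>

locale levi_civita_scaling =
  fixes K \<mu> C c lam om \<nu> \<epsilon> :: real
  assumes \<mu>: "0 < \<mu>" "\<mu> < 1" and c: "c ^ 3 = 1 - \<mu>" "0 < c" and C: "C = 3 * \<mu> + K * c\<^sup>2"
    and lam: "0 < lam" "lam\<^sup>2 = \<nu>" and om: "0 < om" "om\<^sup>2 = 4 * K * c\<^sup>2" and K\<nu>: "K * \<nu> = 2 * c"
    and \<epsilon>: "\<epsilon> * om = \<nu>" "0 < \<epsilon>" and \<nu>: "0 < \<nu>" "\<nu> \<le> 1/100"
begin

text \<open>The product \<open>lam * om\<close> is the ejection speed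
  \<open>2 * sqrt (2 * (1 - \<mu>))\<close>, so that the scaled ejection speed becomes 1.\<close>

lemma lam_om: "(lam * om)\<^sup>2 = 8 * c ^ 3"
proof -
  have "(lam * om)\<^sup>2 = K * \<nu> * 4 * c\<^sup>2" unfolding power_mult_distrib lam(2) om(2) by simp
  then show ?thesis unfolding K\<nu> by (simp add: power2_eq_square power3_eq_cube)
qed

text \<open>The part \<open>3 * \<mu>\<close> of \<open>C\<close> cancels the constant part of the
  potential at the first primary. The summand \<open>\<mu> * (u\<^sup>2 - v\<^sup>2)\<close> cancels
  the first-order term of the inverse distance to the second primary, which thus acts only through a
  tidal term of second order.\<close>

lemma reg_potential_explicit:
  "reg_potential \<mu> C u v = 4 * (1 - \<mu>) + 4 * (u\<^sup>2 + v\<^sup>2) * ((u\<^sup>2 + v\<^sup>2)\<^sup>2 / 2 - K * c\<^sup>2 / 2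
     + \<mu> * (u\<^sup>2 - v\<^sup>2 + inverse (sqrt (1 + 2 * (u\<^sup>2 - v\<^sup>2) + (u\<^sup>2 + v\<^sup>2)\<^sup>2)) - 1))"
proof -
  have "(u\<^sup>2 - v\<^sup>2 + 1)\<^sup>2 + (2 * u * v)\<^sup>2 = 1 + 2 * (u\<^sup>2 - v\<^sup>2) + (u\<^sup>2 + v\<^sup>2)\<^sup>2" by algebra
  then have r: "r2 \<mu> (LC \<mu> u v) = sqrt (1 + 2 * (u\<^sup>2 - v\<^sup>2) + (u\<^sup>2 + v\<^sup>2)\<^sup>2)"
    unfolding r2_def LC_def by simp
  have key: "((\<mu> + u\<^sup>2 - v\<^sup>2)\<^sup>2 + (2 * u * v)\<^sup>2) / 2 + \<mu> * w + \<mu> * (1 - \<mu>) / 2 - C / 2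
      = (u\<^sup>2 + v\<^sup>2)\<^sup>2 / 2 - K * c\<^sup>2 / 2 + \<mu> * (u\<^sup>2 - v\<^sup>2 + w - 1)" for w
    unfolding C by (simp add: field_simps power2_eq_square)
  have "reg_potential \<mu> C u v = 4 * (1 - \<mu>) + 4 * (u\<^sup>2 + v\<^sup>2) * (((\<mu> + u\<^sup>2 - v\<^sup>2)\<^sup>2 + (2 * u * v)\<^sup>2) / 2
      + \<mu> * inverse (sqrt (1 + 2 * (u\<^sup>2 - v\<^sup>2) + (u\<^sup>2 + v\<^sup>2)\<^sup>2)) + \<mu> * (1 - \<mu>) / 2 - C / 2)"
    unfolding reg_potential_def r by (simp only: LC_def fst_conv snd_conv divide_inverse[of \<mu>])
  then show ?thesis unfolding key .
qed

lemma dist_P2: "1 + 2 * ((lam * a)\<^sup>2 - (lam * b)\<^sup>2) + ((lam * a)\<^sup>2 + (lam * b)\<^sup>2)\<^sup>2 = (qf \<nu> (Complex a b))\<^sup>2"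
proof -
  have "cmod (Complex a b) ^ 4 = (a\<^sup>2 + b\<^sup>2)\<^sup>2"
    using cmod_power2[of "Complex a b"] by (metis complex.sel mult_2 numeral_Bit0 power2_eq_square power_add)
  then show ?thesis
    unfolding qf_sq lam(2)[symmetric] by (simp add: Re_power2 algebra_simps power2_eq_square)
qed

context
  fixes a b :: real
  assumes ab: "cmod (Complex a b) \<le> 3"
begin

definition "q = qf \<nu> (Complex a b)"

lemma q: "0 < q" "sqrt (1 + 2 * ((lam * a)\<^sup>2 - (lam * b)\<^sup>2) + ((lam * a)\<^sup>2 + (lam * b)\<^sup>2)\<^sup>2) = q"
proof -
  show "0 < q" using qf_ge[of \<nu> "Complex a b"] \<nu> ab by (simp add: q_def)
  then show "sqrt (1 + 2 * ((lam * a)\<^sup>2 - (lam * b)\<^sup>2) + ((lam * a)\<^sup>2 + (lam * b)\<^sup>2)\<^sup>2) = q"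
    unfolding dist_P2 q_def[symmetric] by simp
qed

lemma cmod_ab: "(cmod (Complex a b))\<^sup>2 = a\<^sup>2 + b\<^sup>2" "cmod (Complex a b) ^ 4 = (a\<^sup>2 + b\<^sup>2)\<^sup>2"
  "cmod (Complex a b) ^ 6 = (a\<^sup>2 + b\<^sup>2) ^ 3"
proof -
  show 1: "(cmod (Complex a b))\<^sup>2 = a\<^sup>2 + b\<^sup>2" by (simp add: cmod_power2)
  show "cmod (Complex a b) ^ 4 = (a\<^sup>2 + b\<^sup>2)\<^sup>2" "cmod (Complex a b) ^ 6 = (a\<^sup>2 + b\<^sup>2) ^ 3"
    unfolding 1[symmetric] by (simp_all flip: power_mult)
qed

lemma \<nu>g: "\<nu> * gf \<nu> (Complex a b) = 1 - inverse q ^ 3"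
  using gf_eq[OF \<nu> ab] \<nu> by (simp add: q_def)

lemma \<nu>k: "\<nu>\<^sup>2 * kf \<nu> (Complex a b) = inverse q - 1 + \<nu> * (a\<^sup>2 - b\<^sup>2)"
  using kf_eq[OF \<nu> ab] \<nu> by (simp add: q_def Re_power2)

text \<open>The factor \<open>\<nu>\<^sup>2\<close> clears the denominators of \<open>gf\<close> and
  \<open>kf\<close> and leaves an expression in the unscaled quantities, ready to be matched with
  the derivative of \<open>reg_potential\<close>.\<close>

lemma Re_Gf: "\<nu>\<^sup>2 * Re (Gf \<mu> \<nu> (Complex a b)) = (12 * (\<nu> * (a\<^sup>2 + b\<^sup>2))\<^sup>2
    + 8 * \<mu> * (inverse q - 1 + \<nu> * (a\<^sup>2 - b\<^sup>2) - (\<nu> * (a\<^sup>2 + b\<^sup>2))\<^sup>2 * inverse q ^ 3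
      + \<nu> * (a\<^sup>2 + b\<^sup>2) * (1 - inverse q ^ 3))) * a"
proof -
  have G: "Re (Gf \<mu> \<nu> (Complex a b)) = (12 * (a\<^sup>2 + b\<^sup>2)\<^sup>2 + 8 * \<mu> * (kf \<nu> (Complex a b) - (a\<^sup>2 + b\<^sup>2)\<^sup>2 * inverse q ^ 3
      + (a\<^sup>2 + b\<^sup>2) * gf \<nu> (Complex a b))) * a"
    unfolding Gf_def cmod_ab q_def[symmetric] plus_complex.sel times_complex.sel
      Re_complex_of_real Im_complex_of_real complex_cnj complex.sel by (simp add: algebra_simps)
  show ?thesis
    unfolding G \<nu>g[symmetric] \<nu>k[symmetric] by (simp add: algebra_simps power2_eq_square)
qed

lemma Im_Gf: "\<nu>\<^sup>2 * Im (Gf \<mu> \<nu> (Complex a b)) = (12 * (\<nu> * (a\<^sup>2 + b\<^sup>2))\<^sup>2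
    + 8 * \<mu> * (inverse q - 1 + \<nu> * (a\<^sup>2 - b\<^sup>2) - (\<nu> * (a\<^sup>2 + b\<^sup>2))\<^sup>2 * inverse q ^ 3
      - \<nu> * (a\<^sup>2 + b\<^sup>2) * (1 - inverse q ^ 3))) * b"
proof -
  have G: "Im (Gf \<mu> \<nu> (Complex a b)) = (12 * (a\<^sup>2 + b\<^sup>2)\<^sup>2 + 8 * \<mu> * (kf \<nu> (Complex a b) - (a\<^sup>2 + b\<^sup>2)\<^sup>2 * inverse q ^ 3
      - (a\<^sup>2 + b\<^sup>2) * gf \<nu> (Complex a b))) * b"
    unfolding Gf_def cmod_ab q_def[symmetric] plus_complex.sel times_complex.sel
      Re_complex_of_real Im_complex_of_real complex_cnj complex.sel by (simp add: algebra_simps)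
  show ?thesis
    unfolding G \<nu>g[symmetric] \<nu>k[symmetric] by (simp add: algebra_simps power2_eq_square)
qed

lemma om_eps: "om\<^sup>2 * \<epsilon>\<^sup>2 = \<nu>\<^sup>2"
  using \<epsilon>(1) by (simp add: power_mult_distrib[symmetric] mult.commute)

lemma lam_sq: "(lam * a)\<^sup>2 = \<nu> * a\<^sup>2" "(lam * b)\<^sup>2 = \<nu> * b\<^sup>2"
  by (simp_all add: power_mult_distrib lam(2))

lemma reg_deriv_u: "deriv (\<lambda>x. reg_potential \<mu> C x (lam * b)) (lam * a)
    = lam * om\<^sup>2 * (- a + \<epsilon>\<^sup>2 * Re (Gf \<mu> \<nu> (Complex a b)))"
proof -
  define v where "v = lam * b"
  define u where "u = lam * a"
  define \<rho> where "\<rho> = u\<^sup>2 + v\<^sup>2"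
  define D where "D x = 1 + 2 * (x\<^sup>2 - v\<^sup>2) + (x\<^sup>2 + v\<^sup>2)\<^sup>2" for x
  define S where "S x = inverse (sqrt (D x))" for x
  have sD: "sqrt (D u) = q" using q(2) by (simp add: D_def u_def v_def)
  then have Sq: "S u = inverse q" by (simp add: S_def)
  from sD have D0: "D u > 0" using q(1) by (metis real_sqrt_gt_0_iff)
  have dD: "(D has_real_derivative 4 * u * (1 + \<rho>)) (at u)"
    unfolding D_def \<rho>_def by (auto intro!: derivative_eq_intros simp: algebra_simps)
  have "((\<lambda>x. sqrt (D x)) has_real_derivative inverse q / 2 * (4 * u * (1 + \<rho>))) (at u)"
    using DERIV_chain2[where f = sqrt and g = D, OF DERIV_real_sqrt[OF D0] dD] by (simp add: sD)
  then have dS: "(S has_real_derivative - (2 * u * (1 + \<rho>) * inverse q ^ 3)) (at u)"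
    unfolding S_def
    by (rule DERIV_cong[OF DERIV_inverse_fun]) (use q(1) in \<open>simp_all add: sD power3_eq_cube power2_eq_square field_simps\<close>)
  have "((\<lambda>x. 4 * (1 - \<mu>) + 4 * (x\<^sup>2 + v\<^sup>2) * ((x\<^sup>2 + v\<^sup>2)\<^sup>2 / 2 - K * c\<^sup>2 / 2 + \<mu> * (x\<^sup>2 - v\<^sup>2 + S x - 1)))
      has_real_derivative 8 * u * (\<rho>\<^sup>2 / 2 - K * c\<^sup>2 / 2 + \<mu> * (u\<^sup>2 - v\<^sup>2 + inverse q - 1))
        + 4 * \<rho> * (2 * u * \<rho> + \<mu> * (2 * u - 2 * u * (1 + \<rho>) * inverse q ^ 3))) (at u)"
    using dS Sq unfolding \<rho>_def by (auto intro!: derivative_eq_intros)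
  moreover have "8 * u * (\<rho>\<^sup>2 / 2 - K * c\<^sup>2 / 2 + \<mu> * (u\<^sup>2 - v\<^sup>2 + inverse q - 1))
        + 4 * \<rho> * (2 * u * \<rho> + \<mu> * (2 * u - 2 * u * (1 + \<rho>) * inverse q ^ 3))
     = - (4 * K * c\<^sup>2) * u + lam * ((12 * \<rho>\<^sup>2 + 8 * \<mu> * (inverse q - 1 + (u\<^sup>2 - v\<^sup>2) - \<rho>\<^sup>2 * inverse q ^ 3
         + \<rho> * (1 - inverse q ^ 3))) * a)"
    by (simp add: u_def algebra_simps power2_eq_square)
  moreover have "\<rho> = \<nu> * (a\<^sup>2 + b\<^sup>2)" "u\<^sup>2 - v\<^sup>2 = \<nu> * (a\<^sup>2 - b\<^sup>2)"
    unfolding \<rho>_def u_def v_def lam_sq by (simp_all add: algebra_simps)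
  ultimately have "((\<lambda>x. reg_potential \<mu> C x v) has_real_derivative
      - (4 * K * c\<^sup>2) * u + lam * (\<nu>\<^sup>2 * Re (Gf \<mu> \<nu> (Complex a b)))) (at u)"
    unfolding reg_potential_explicit D_def[symmetric] S_def[symmetric] Re_Gf by simp
  then show ?thesis
    unfolding om(2)[symmetric] om_eps[symmetric] u_def v_def
    by (intro DERIV_imp_deriv) (simp add: algebra_simps)
qed

lemma reg_deriv_v: "deriv (\<lambda>x. reg_potential \<mu> C (lam * a) x) (lam * b)
    = lam * om\<^sup>2 * (- b + \<epsilon>\<^sup>2 * Im (Gf \<mu> \<nu> (Complex a b)))"
proof -
  define v where "v = lam * b"
  define u where "u = lam * a"
  define \<rho> where "\<rho> = u\<^sup>2 + v\<^sup>2"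
  define D where "D x = 1 + 2 * (u\<^sup>2 - x\<^sup>2) + (u\<^sup>2 + x\<^sup>2)\<^sup>2" for x
  define S where "S x = inverse (sqrt (D x))" for x
  have sD: "sqrt (D v) = q" using q(2) by (simp add: D_def u_def v_def)
  then have Sq: "S v = inverse q" by (simp add: S_def)
  from sD have D0: "D v > 0" using q(1) by (metis real_sqrt_gt_0_iff)
  have dD: "(D has_real_derivative 4 * v * (\<rho> - 1)) (at v)"
    unfolding D_def \<rho>_def by (auto intro!: derivative_eq_intros simp: algebra_simps)
  have "((\<lambda>x. sqrt (D x)) has_real_derivative inverse q / 2 * (4 * v * (\<rho> - 1))) (at v)"
    using DERIV_chain2[where f = sqrt and g = D, OF DERIV_real_sqrt[OF D0] dD] by (simp add: sD)
  then have dS: "(S has_real_derivative - (2 * v * (\<rho> - 1) * inverse q ^ 3)) (at v)"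
    unfolding S_def
    by (rule DERIV_cong[OF DERIV_inverse_fun]) (use q(1) in \<open>simp_all add: sD power3_eq_cube power2_eq_square field_simps\<close>)
  have "((\<lambda>x. 4 * (1 - \<mu>) + 4 * (u\<^sup>2 + x\<^sup>2) * ((u\<^sup>2 + x\<^sup>2)\<^sup>2 / 2 - K * c\<^sup>2 / 2 + \<mu> * (u\<^sup>2 - x\<^sup>2 + S x - 1)))
      has_real_derivative 8 * v * (\<rho>\<^sup>2 / 2 - K * c\<^sup>2 / 2 + \<mu> * (u\<^sup>2 - v\<^sup>2 + inverse q - 1))
        + 4 * \<rho> * (2 * v * \<rho> + \<mu> * (- 2 * v - 2 * v * (\<rho> - 1) * inverse q ^ 3))) (at v)"
    using dS Sq unfolding \<rho>_def by (auto intro!: derivative_eq_intros)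
  moreover have "8 * v * (\<rho>\<^sup>2 / 2 - K * c\<^sup>2 / 2 + \<mu> * (u\<^sup>2 - v\<^sup>2 + inverse q - 1))
        + 4 * \<rho> * (2 * v * \<rho> + \<mu> * (- 2 * v - 2 * v * (\<rho> - 1) * inverse q ^ 3))
     = - (4 * K * c\<^sup>2) * v + lam * ((12 * \<rho>\<^sup>2 + 8 * \<mu> * (inverse q - 1 + (u\<^sup>2 - v\<^sup>2) - \<rho>\<^sup>2 * inverse q ^ 3
         - \<rho> * (1 - inverse q ^ 3))) * b)"
    by (simp add: v_def algebra_simps power2_eq_square)
  moreover have "\<rho> = \<nu> * (a\<^sup>2 + b\<^sup>2)" "u\<^sup>2 - v\<^sup>2 = \<nu> * (a\<^sup>2 - b\<^sup>2)"
    unfolding \<rho>_def u_def v_def lam_sq by (simp_all add: algebra_simps)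
  ultimately have "((\<lambda>x. reg_potential \<mu> C u x) has_real_derivative
      - (4 * K * c\<^sup>2) * v + lam * (\<nu>\<^sup>2 * Im (Gf \<mu> \<nu> (Complex a b)))) (at v)"
    unfolding reg_potential_explicit D_def[symmetric] S_def[symmetric] Im_Gf by simp
  then show ?thesis
    unfolding om(2)[symmetric] om_eps[symmetric] u_def v_def
    by (intro DERIV_imp_deriv) (simp add: algebra_simps)
qed

lemma reg_potential_scaled:
  "2 * reg_potential \<mu> C (lam * a) (lam * b)
    = (lam * om)\<^sup>2 * (1 - (cmod (Complex a b))\<^sup>2 + 2 * \<epsilon>\<^sup>2 * Phi \<mu> \<nu> (Complex a b))"
proof -
  define r where "r = a\<^sup>2 + b\<^sup>2"
  define k where "k = kf \<nu> (Complex a b)"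
  have lo2: "(lam * om)\<^sup>2 * \<epsilon>\<^sup>2 = \<nu> ^ 3"
    unfolding power_mult_distrib mult.assoc om_eps lam(2) by (simp add: power2_eq_square power3_eq_cube)
  have "2 * reg_potential \<mu> C (lam * a) (lam * b) = 8 * c ^ 3 + 8 * (\<nu> * r) * ((\<nu> * r)\<^sup>2 / 2 - K * c\<^sup>2 / 2 + \<mu> * (\<nu>\<^sup>2 * k))"
  proof -
    have "\<nu> * a\<^sup>2 + \<nu> * b\<^sup>2 = \<nu> * r" "\<nu> * a\<^sup>2 - \<nu> * b\<^sup>2 = \<nu> * (a\<^sup>2 - b\<^sup>2)"
      by (simp_all add: r_def algebra_simps)
    then show ?thesis
      unfolding reg_potential_explicit q(2) k_def \<nu>k c(1)
      unfolding lam_sq by (simp add: algebra_simps)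
  qed
  also have "\<dots> = 8 * c ^ 3 - 4 * c\<^sup>2 * (K * \<nu>) * r + \<nu> ^ 3 * (4 * r ^ 3 + 8 * \<mu> * r * k)"
    by (simp add: algebra_simps power2_eq_square power3_eq_cube)
  also have "\<dots> = 8 * c ^ 3 * (1 - r) + (lam * om)\<^sup>2 * \<epsilon>\<^sup>2 * (4 * r ^ 3 + 8 * \<mu> * r * k)"
    unfolding K\<nu> lo2 by (simp add: algebra_simps power2_eq_square power3_eq_cube)
  also have "\<dots> = (lam * om)\<^sup>2 * (1 - r + 2 * \<epsilon>\<^sup>2 * (2 * r ^ 3 + 4 * \<mu> * r * k))"
    unfolding lam_om by (simp add: algebra_simps)
  finally show ?thesis by (simp add: Phi_def cmod_ab r_def k_def)
qed

end

definition arc_of :: "real \<Rightarrow> (real \<Rightarrow> complex \<times> complex) \<Rightarrow> lc_arc" where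
  "arc_of T Y = \<lparr>duration = T / om,
     pos_u = \<lambda>s. lam * Re (fst (Y (om * s))), pos_v = \<lambda>s. lam * Im (fst (Y (om * s))),
     vel_u = \<lambda>s. lam * om * Re (snd (Y (om * s))), vel_v = \<lambda>s. lam * om * Im (snd (Y (om * s)))\<rparr>"

lemma arc_of_simps [simp]:
  "duration (arc_of T Y) = T / om"
  "pos_u (arc_of T Y) s = lam * Re (fst (Y (om * s)))" "pos_v (arc_of T Y) s = lam * Im (fst (Y (om * s)))"
  "vel_u (arc_of T Y) s = lam * om * Re (snd (Y (om * s)))" "vel_v (arc_of T Y) s = lam * om * Im (snd (Y (om * s)))"
  by (simp_all add: arc_of_def)

lemma image_om: "(\<lambda>s. om * s) ` {0..T / om} = {0..T}"
proof (intro equalityI subsetI)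
  fix t assume "t \<in> {0..T}"
  then show "t \<in> (\<lambda>s. om * s) ` {0..T / om}"
    using om(1) by (intro image_eqI[of _ _ "t / om"]) (auto simp: field_simps)
qed (use om(1) in \<open>auto simp: field_simps\<close>)

lemma scaled_time_deriv:
  assumes "(f has_real_derivative D) (at (om * s) within {0..T})"
  shows "((\<lambda>s. k * f (om * s)) has_real_derivative k * om * D) (at s within {0..T / om})"
proof -
  have "((\<lambda>s. om * s) has_real_derivative om) (at s within {0..T / om})"
    by (auto intro!: derivative_eq_intros)
  then have "(f \<circ> (\<lambda>s. om * s) has_real_derivative D * om) (at s within {0..T / om})"
    by (rule DERIV_image_chain[rotated]) (unfold image_om, rule assms)
  then have "((\<lambda>s. f (om * s)) has_real_derivative D * om) (at s within {0..T / om})"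
    by (simp add: o_def)
  from DERIV_cmult[OF this, of k] show ?thesis by (simp add: mult_ac)
qed

lemma arc_of_regular:
  assumes ec: "ec_solution \<epsilon> \<nu> \<mu> n T Y"
  shows "reg_solution \<mu> C (arc_of T Y)"
  unfolding reg_solution_def Let_def arc_of_simps
proof (intro conjI ballI)
  have T: "0 < T" and sol: "lc_sol \<epsilon> \<nu> \<mu> T Y" and Y0: "fst (Y 0) = 0" "cmod (snd (Y 0)) = 1"
    using ec by (auto simp: ec_solution_def)
  show "0 < T / om" using T om by simp
  fix s assume s: "s \<in> {0..T / om}"
  define t where "t = om * s"
  have t: "t \<in> {0..T}" using s image_om[of T] unfolding t_def by blast
  define a where "a = Re (fst (Y t))"
  define b where "b = Im (fst (Y t))"
  have zab: "fst (Y t) = Complex a b" by (simp add: a_def b_def complex_eq_iff)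
  have ab: "cmod (Complex a b) \<le> 3" using lc_solD(4)[OF sol t] by (simp add: zab)
  have r: "(lam * a)\<^sup>2 + (lam * b)\<^sup>2 = \<nu> * (cmod (fst (Y t)))\<^sup>2"
    unfolding zab cmod_power2 by (simp add: power_mult_distrib lam(2) algebra_simps)
  note zd = lc_solD(1)[OF sol t] and pd = lc_solD(2)[OF sol t]
  show "LC \<mu> (lam * Re (fst (Y (om * s)))) (lam * Im (fst (Y (om * s)))) \<noteq> (\<mu> - 1, 0)"
  proof
    assume "LC \<mu> (lam * Re (fst (Y (om * s)))) (lam * Im (fst (Y (om * s)))) = (\<mu> - 1, 0)"
    then have e: "(lam * a)\<^sup>2 - (lam * b)\<^sup>2 = -1" "2 * (lam * a) * (lam * b) = 0"
      by (auto simp: LC_def a_def b_def t_def)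
    have "((lam * a)\<^sup>2 + (lam * b)\<^sup>2)\<^sup>2 = ((lam * a)\<^sup>2 - (lam * b)\<^sup>2)\<^sup>2 + (2 * (lam * a) * (lam * b))\<^sup>2"
      by algebra
    \<comment> \<open>Meeting the second primary means \<open>1 + \<nu> * z\<^sup>2 = 0\<close>,
      which contradicts the lower bound \<open>9/10\<close> for \<open>qf\<close>.\<close>
    then have "(qf \<nu> (Complex a b))\<^sup>2 = 0"
      unfolding dist_P2[symmetric] e by simp
    then show False using qf_ge[of \<nu> "Complex a b"] \<nu> ab by simp
  qed
  show "((\<lambda>s. lam * Re (fst (Y (om * s)))) has_real_derivative lam * om * Re (snd (Y (om * s)))) (at s within {0..T / om})"
    using scaled_time_deriv[OF has_field_derivative_Re[OF zd[unfolded t_def]], of lam] .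
  show "((\<lambda>s. lam * Im (fst (Y (om * s)))) has_real_derivative lam * om * Im (snd (Y (om * s)))) (at s within {0..T / om})"
    using scaled_time_deriv[OF has_field_derivative_Im[OF zd[unfolded t_def]], of lam] .
  have Rf: "lam * om * om * Re (snd (lc_field \<epsilon> \<nu> \<mu> (Y t)))
    = 8 * ((lam * a)\<^sup>2 + (lam * b)\<^sup>2) * (lam * om * Im (snd (Y t))) + deriv (\<lambda>z. reg_potential \<mu> C z (lam * b)) (lam * a)"
    unfolding reg_deriv_u[OF ab] r unfolding zab[symmetric] lc_field_def snd_conv \<epsilon>(1)[symmetric] unfolding a_def
    by (simp add: algebra_simps power2_eq_square)
  have If: "lam * om * om * Im (snd (lc_field \<epsilon> \<nu> \<mu> (Y t)))
    = - 8 * ((lam * a)\<^sup>2 + (lam * b)\<^sup>2) * (lam * om * Re (snd (Y t))) + deriv (\<lambda>z. reg_potential \<mu> C (lam * a) z) (lam * b)"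
    unfolding reg_deriv_v[OF ab] r unfolding zab[symmetric] lc_field_def snd_conv \<epsilon>(1)[symmetric] unfolding b_def
    by (simp add: algebra_simps power2_eq_square)
  show "((\<lambda>s. lam * om * Re (snd (Y (om * s)))) has_real_derivative
      8 * ((lam * Re (fst (Y (om * s))))\<^sup>2 + (lam * Im (fst (Y (om * s))))\<^sup>2) * (lam * om * Im (snd (Y (om * s))))
      + deriv (\<lambda>z. reg_potential \<mu> C z (lam * Im (fst (Y (om * s))))) (lam * Re (fst (Y (om * s)))))
     (at s within {0..T / om})"
    using scaled_time_deriv[OF has_field_derivative_Re[OF pd[unfolded t_def]], of "lam * om"]
    unfolding Rf[unfolded a_def b_def t_def] .
  show "((\<lambda>s. lam * om * Im (snd (Y (om * s)))) has_real_derivative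
      - 8 * ((lam * Re (fst (Y (om * s))))\<^sup>2 + (lam * Im (fst (Y (om * s))))\<^sup>2) * (lam * om * Re (snd (Y (om * s))))
      + deriv (\<lambda>z. reg_potential \<mu> C (lam * Re (fst (Y (om * s)))) z) (lam * Im (fst (Y (om * s)))))
     (at s within {0..T / om})"
    using scaled_time_deriv[OF has_field_derivative_Im[OF pd[unfolded t_def]], of "lam * om"]
    unfolding If[unfolded a_def b_def t_def] .
  have "(lam * om * Re (snd (Y t)))\<^sup>2 + (lam * om * Im (snd (Y t)))\<^sup>2 = (lam * om)\<^sup>2 * (cmod (snd (Y t)))\<^sup>2"
    unfolding cmod_power2 by (simp add: power_mult_distrib algebra_simps)
  also have "\<dots> = 2 * reg_potential \<mu> C (lam * a) (lam * b)"
    unfolding reg_potential_scaled[OF ab] lc_sol_energy[OF sol \<nu> Y0 t] zab ..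
  finally show "(lam * om * Re (snd (Y (om * s))))\<^sup>2 + (lam * om * Im (snd (Y (om * s))))\<^sup>2
      = 2 * reg_potential \<mu> C (lam * Re (fst (Y (om * s)))) (lam * Im (fst (Y (om * s))))"
    by (simp only: a_def b_def t_def)
qed

lemma synodic_arc_of:
  "synodic \<mu> (arc_of T Y) s = (\<mu> + \<nu> * Re ((fst (Y (om * s)))\<^sup>2), \<nu> * Im ((fst (Y (om * s)))\<^sup>2))"
  unfolding synodic_def LC_def arc_of_simps power_mult_distrib lam(2)[symmetric] Re_power2 Im_power2
  by (simp add: algebra_simps power2_eq_square)

lemma synodic_collision_iff: "synodic \<mu> (arc_of T Y) s = (\<mu>, 0) \<longleftrightarrow> fst (Y (om * s)) = 0"
proof -
  have "synodic \<mu> (arc_of T Y) s = (\<mu>, 0) \<longleftrightarrow> (fst (Y (om * s)))\<^sup>2 = 0"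
    unfolding synodic_arc_of using \<nu> by (simp add: complex_eq_iff del: zero_eq_power2)
  then show ?thesis by simp
qed

lemma arc_of_n_EC:
  assumes ec: "ec_solution \<epsilon> \<nu> \<mu> n T Y" and \<theta>: "\<exists>\<theta>\<in>{0..<pi}. snd (Y 0) = cis \<theta>"
  shows "n_EC_orbit \<mu> C n (arc_of T Y)"
  unfolding n_EC_orbit_def ejection_orbit_def
proof (intro conjI ballI)
  have lo: "lam * om = 2 * sqrt (2 * (1 - \<mu>))"
  proof (rule power2_eq_imp_eq)
    show "(lam * om)\<^sup>2 = (2 * sqrt (2 * (1 - \<mu>)))\<^sup>2"
      unfolding lam_om c(1) using \<mu> by (simp add: power_mult_distrib)
  qed (use lam om \<mu> in auto)
  show "reg_solution \<mu> C (arc_of T Y)" by (rule arc_of_regular[OF ec])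
  have z: "fst (Y 0) = 0" "fst (Y T) = 0" "\<forall>t\<in>{0<..<T}. fst (Y t) \<noteq> 0"
    "card {t \<in> {0<..<T}. rel_max_at (\<lambda>t. (cmod (fst (Y t)))\<^sup>2) t} = n"
    using ec by (auto simp: ec_solution_def)
  show "pos_u (arc_of T Y) 0 = 0" "pos_v (arc_of T Y) 0 = 0" using z(1) by auto
  show "\<exists>\<theta>\<in>{0..<pi}. vel_u (arc_of T Y) 0 = 2 * sqrt (2 * (1 - \<mu>)) * cos \<theta> \<and>
      vel_v (arc_of T Y) 0 = 2 * sqrt (2 * (1 - \<mu>)) * sin \<theta>"
    using \<theta> by (auto simp: lo)
  show "synodic \<mu> (arc_of T Y) (duration (arc_of T Y)) = (\<mu>, 0)"
    unfolding synodic_collision_iff using z(2) om by simp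
  have range: "s \<in> {0<..<T / om} \<longleftrightarrow> om * s + 0 \<in> {0<..<T}" for s
    using om(1) by (auto simp: field_simps zero_less_mult_iff)
  show "synodic \<mu> (arc_of T Y) s \<noteq> (\<mu>, 0)" if "s \<in> {0<..<duration (arc_of T Y)}" for s
    unfolding synodic_collision_iff using z(3) that range[of s] by auto
  have "r1 \<mu> (synodic \<mu> (arc_of T Y) s) = \<nu> * (cmod (fst (Y (om * s + 0))))\<^sup>2" for s
    unfolding synodic_def r1_LC cmod_power2 by (simp add: power_mult_distrib lam(2) algebra_simps)
  then show "card {s \<in> {0<..<duration (arc_of T Y)}. rel_max_at (\<lambda>t. r1 \<mu> (synodic \<mu> (arc_of T Y) t)) s} = n"
    using card_rel_max_affine[of om "{0<..<T / om}" 0 "{0<..<T}" "\<lambda>t. (cmod (fst (Y t)))\<^sup>2", OF _ range] om(1) z(4)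
    by (simp add: rel_max_at_scale[OF \<nu>(1)])
qed

definition to_plane :: "complex \<Rightarrow> real \<times> real" where
  "to_plane w = (\<mu> + \<nu> * Re w, \<nu> * Im w)"

lemma inj_to_plane: "inj to_plane"
  using \<nu> by (intro injI) (simp add: to_plane_def complex_eq_iff)

lemma projection_arc_of: "projection \<mu> (arc_of T Y) = (\<lambda>t. to_plane ((fst (Y t))\<^sup>2)) ` {0..T}"
  unfolding projection_def image_om[of T, symmetric] image_image synodic_arc_of[abs_def] to_plane_def
  by simp

lemma x_symmetric_arc_of:
  assumes "\<And>t. t \<in> {0..T} \<Longrightarrow> (fst (Y' (T - t)))\<^sup>2 = cnj ((fst (Y t))\<^sup>2)"
  shows "x_symmetric_to \<mu> (arc_of T Y) (arc_of T Y')"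
proof -
  have "(\<lambda>t. to_plane ((fst (Y' t))\<^sup>2)) ` {0..T} = (\<lambda>t. to_plane ((fst (Y' (T - t)))\<^sup>2)) ` {0..T}"
  proof (intro equalityI subsetI)
    fix x assume "x \<in> (\<lambda>t. to_plane ((fst (Y' t))\<^sup>2)) ` {0..T}"
    then obtain t where "t \<in> {0..T}" "x = to_plane ((fst (Y' t))\<^sup>2)" by auto
    then show "x \<in> (\<lambda>t. to_plane ((fst (Y' (T - t)))\<^sup>2)) ` {0..T}"
      by (intro image_eqI[of _ _ "T - t"]) auto
  qed auto
  also have "\<dots> = (\<lambda>t. to_plane (cnj ((fst (Y t))\<^sup>2))) ` {0..T}"
    using assms by (intro image_cong) auto
  also have "\<dots> = (\<lambda>(x, y). (x, - y)) ` projection \<mu> (arc_of T Y)"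
    unfolding projection_arc_of image_image by (simp add: to_plane_def Re_power2 Im_power2)
  finally show ?thesis unfolding x_symmetric_to_def projection_arc_of .
qed

text \<open>A point near the tip \<open>d\<close> of one projection would lie near the segment
  towards \<open>d'\<close>, so \<open>d\<close> would be within \<open>9/10\<close> of that
  segment, while quarter turns are at distance at least 1.\<close>

lemma projections_distinct:
  assumes al: "along d T Y" "along d' T' Y'"
    and d: "d \<in> {1, -1, \<i>, - \<i>}" "d' \<in> {1, -1, \<i>, - \<i>}" "d \<noteq> d'"
  shows "projection \<mu> (arc_of T Y) \<noteq> projection \<mu> (arc_of T' Y')"
proof
  assume eq: "projection \<mu> (arc_of T Y) = projection \<mu> (arc_of T' Y')"
  obtain t where t: "t \<in> {0..T}" "cmod ((fst (Y t))\<^sup>2 - d) \<le> 9/20"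
    using al(1) by (auto simp: along_def)
  then have "to_plane ((fst (Y t))\<^sup>2) \<in> projection \<mu> (arc_of T Y)"
    unfolding projection_arc_of by blast
  then have "to_plane ((fst (Y t))\<^sup>2) \<in> projection \<mu> (arc_of T' Y')"
    by (simp only: eq)
  then obtain t' where t': "t' \<in> {0..T'}" "(fst (Y t))\<^sup>2 = (fst (Y' t'))\<^sup>2"
    unfolding projection_arc_of using inj_to_plane by (auto dest: injD)
  obtain y where "y \<in> {0..1}" and y': "cmod ((fst (Y' t'))\<^sup>2 - d' * of_real y) \<le> 9/20"
    using al(2) t'(1) unfolding along_def by blast
  then have "0 \<le> y" by simp
  note y = this y'
  have "cmod (d - (fst (Y t))\<^sup>2) \<le> 9/20" using t(2) by (simp add: norm_minus_commute)
  from norm_diff_triangle_le[OF this y(2)[folded t'(2)]]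
  have "cmod (d - d' * of_real y) \<le> 9/10" by simp
  with quarter_turns_separated[OF d y(1)] show False by simp
qed

lemma four_arcs:
  assumes sc: "\<And>d. d \<in> {1, -1} \<Longrightarrow> \<exists>T Y. ec_solution \<epsilon> \<nu> \<mu> n T Y \<and> along d T Y \<and>
        (\<forall>t\<in>{0..T}. (fst (Y (T - t)))\<^sup>2 = cnj ((fst (Y t))\<^sup>2))"
    and diag: "\<exists>T Y. ec_solution \<epsilon> \<nu> \<mu> n T Y \<and> along \<i> T Y"
  shows "\<exists>\<alpha> \<gamma> \<beta> \<delta>. (\<forall>a\<in>{\<alpha>, \<gamma>, \<beta>, \<delta>}. n_EC_orbit \<mu> C n a) \<and>
          distinct (map (projection \<mu>) [\<alpha>, \<gamma>, \<beta>, \<delta>]) \<and>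
          x_symmetric_to \<mu> \<alpha> \<alpha> \<and> x_symmetric_to \<mu> \<gamma> \<gamma> \<and> x_symmetric_to \<mu> \<beta> \<delta>"
proof -
  have s: "\<exists>T Y. n_EC_orbit \<mu> C n (arc_of T Y) \<and> along d T Y \<and> x_symmetric_to \<mu> (arc_of T Y) (arc_of T Y)"
    if d: "d \<in> {1, -1}" for d
  proof -
    obtain T Y where Y: "ec_solution \<epsilon> \<nu> \<mu> n T Y" "along d T Y"
      "\<forall>t\<in>{0..T}. (fst (Y (T - t)))\<^sup>2 = cnj ((fst (Y t))\<^sup>2)"
      using sc[OF d] by blast
    obtain Y' where Y': "ec_solution \<epsilon> \<nu> \<mu> n T Y'" "along d T Y'"
      "\<exists>\<theta>\<in>{0..<pi}. snd (Y' 0) = cis \<theta>" "\<And>t. (fst (Y' t))\<^sup>2 = (fst (Y t))\<^sup>2"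
      using ec_solution_normalize[OF Y(1,2)] by metis
    show ?thesis
      using arc_of_n_EC[OF Y'(1,3)] Y'(2) x_symmetric_arc_of[of T Y' Y'] Y(3) unfolding Y'(4) by blast
  qed
  obtain T1 Y1 where 1: "n_EC_orbit \<mu> C n (arc_of T1 Y1)" "along 1 T1 Y1"
    "x_symmetric_to \<mu> (arc_of T1 Y1) (arc_of T1 Y1)" using s[of 1] by blast
  obtain T2 Y2 where 2: "n_EC_orbit \<mu> C n (arc_of T2 Y2)" "along (-1) T2 Y2"
    "x_symmetric_to \<mu> (arc_of T2 Y2) (arc_of T2 Y2)" using s[of "-1"] by blast
  obtain T3 Y where Y: "ec_solution \<epsilon> \<nu> \<mu> n T3 Y" "along \<i> T3 Y" using diag by blast
  obtain Y3 where 3: "ec_solution \<epsilon> \<nu> \<mu> n T3 Y3" "along \<i> T3 Y3"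
    "\<exists>\<theta>\<in>{0..<pi}. snd (Y3 0) = cis \<theta>" using ec_solution_normalize[OF Y] by metis
  \<comment> \<open>The orbit \<delta> is the reflection of \<beta> traversed backwards, normalized
    by a sign; it points along \<open>- \<i>\<close>.\<close>
  obtain Y4 where 4: "ec_solution \<epsilon> \<nu> \<mu> n T3 Y4" "along (cnj \<i>) T3 Y4"
    "\<exists>\<theta>\<in>{0..<pi}. snd (Y4 0) = cis \<theta>"
    "\<And>t. (fst (Y4 t))\<^sup>2 = (fst (cnj (fst (Y3 (T3 - t))), - cnj (snd (Y3 (T3 - t)))))\<^sup>2"
    using ec_solution_normalize[OF ec_solution_reverse[OF 3(1) \<nu>] along_reverse[OF 3(2)]] by metis
  have along4: "along (- \<i>) T3 Y4" using 4(2) by simp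
  have sym: "x_symmetric_to \<mu> (arc_of T3 Y3) (arc_of T3 Y4)"
    by (rule x_symmetric_arc_of) (simp add: 4(4))
  have dist: "distinct (map (projection \<mu>) [arc_of T1 Y1, arc_of T2 Y2, arc_of T3 Y3, arc_of T3 Y4])"
    using projections_distinct[OF 1(2) 2(2)] projections_distinct[OF 1(2) 3(2)] projections_distinct[OF 1(2) along4]
      projections_distinct[OF 2(2) 3(2)] projections_distinct[OF 2(2) along4] projections_distinct[OF 3(2) along4]
    by (simp add: complex_eq_iff)
  have "\<forall>a\<in>{arc_of T1 Y1, arc_of T2 Y2, arc_of T3 Y3, arc_of T3 Y4}. n_EC_orbit \<mu> C n a"
    using 1(1) 2(1) arc_of_n_EC[OF 3(1,3)] arc_of_n_EC[OF 4(1,3)] by blast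
  then show ?thesis
    using dist 1(3) 2(3) sym by (intro exI conjI)
qed

end

theorem theorem2:
  "\<forall>n::nat. 1 \<le> n \<longrightarrow>
    (\<exists>Khat::real. 0 < Khat \<and>
      (\<forall>K \<mu> C :: real. Khat \<le> K \<longrightarrow> 0 < \<mu> \<longrightarrow> \<mu> < 1 \<longrightarrow>
        C = 3 * \<mu> + K * (1 - \<mu>) powr (2 / 3) \<longrightarrow>
        (\<exists>\<alpha> \<gamma> \<beta> \<delta> :: lc_arc.
          (\<forall>a\<in>{\<alpha>, \<gamma>, \<beta>, \<delta>}. n_EC_orbit \<mu> C n a) \<and>
          distinct (map (projection \<mu>) [\<alpha>, \<gamma>, \<beta>, \<delta>]) \<and>
          x_symmetric_to \<mu> \<alpha> \<alpha> \<and> x_symmetric_to \<mu> \<gamma> \<gamma> \<and>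
          x_symmetric_to \<mu> \<beta> \<delta>)))"
proof (intro allI impI)
  fix n :: nat assume "1 \<le> n"
  from scaled_orbits_exist[OF this] obtain e where e: "e > 0"
    "\<And>\<epsilon> \<nu> \<mu>. \<epsilon> \<in> {0<..e} \<Longrightarrow> \<nu> \<in> {0<..e} \<Longrightarrow> \<mu> \<in> {0<..<1} \<Longrightarrow> \<nu> \<le> 1/100 \<and>
    (\<forall>d\<in>{1, -1}. \<exists>T Y. ec_solution \<epsilon> \<nu> \<mu> n T Y \<and> along d T Y \<and>
        (\<forall>t\<in>{0..T}. (fst (Y (T - t)))\<^sup>2 = cnj ((fst (Y t))\<^sup>2))) \<and>
    (\<exists>T Y. ec_solution \<epsilon> \<nu> \<mu> n T Y \<and> along \<i> T Y)"
    by blast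
  \<comment> \<open>For \<open>K \<ge> 1\<close> both \<epsilon> and \<nu> are at most
    \<open>2 / K\<close>, since \<open>c \<le> 1\<close>; the second entry brings this below
    \<open>e\<close>.\<close>
  define Khat where "Khat = max 1 (2 / e)"
  have "\<exists>\<alpha> \<gamma> \<beta> \<delta> :: lc_arc. (\<forall>a\<in>{\<alpha>, \<gamma>, \<beta>, \<delta>}. n_EC_orbit \<mu> C n a) \<and>
          distinct (map (projection \<mu>) [\<alpha>, \<gamma>, \<beta>, \<delta>]) \<and>
          x_symmetric_to \<mu> \<alpha> \<alpha> \<and> x_symmetric_to \<mu> \<gamma> \<gamma> \<and> x_symmetric_to \<mu> \<beta> \<delta>"
    if K: "Khat \<le> K" and \<mu>: "0 < \<mu>" "\<mu> < 1" and C: "C = 3 * \<mu> + K * (1 - \<mu>) powr (2 / 3)" for K \<mu> C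
  proof -
    define c where "c = (1 - \<mu>) powr (1 / 3)"
    define \<nu> where "\<nu> = 2 * c / K"
    \<comment> \<open>The time unit makes the oscillator frequency 1, that is
      \<open>om = 2 * sqrt K * c\<close>, and then \<open>\<epsilon> = \<nu> / om\<close>. The cube
      root \<open>c\<close> cancels, so \<epsilon> does not depend on \<mu>.\<close>
    define \<epsilon> where "\<epsilon> = 1 / (K * sqrt K)"
    have K1: "1 \<le> K" "2 / e \<le> K" using K by (auto simp: Khat_def)
    then have eK: "2 / K \<le> e" using e(1) by (simp add: field_simps)
    have c: "c ^ 3 = 1 - \<mu>" "0 < c" "c \<le> 1" "c\<^sup>2 = (1 - \<mu>) powr (2 / 3)"
      using \<mu> by (auto simp: c_def powr_power powr_le1)
    have sK: "1 \<le> sqrt K" using K1(1) by simp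
    have "1 / (K * sqrt K) \<le> 2 / K"
    proof -
      have "1 / (K * sqrt K) \<le> 1 / (K * 1)" using K1(1) sK by (intro divide_left_mono mult_left_mono) auto
      also have "\<dots> \<le> 2 / K" using K1(1) by (simp add: field_simps)
      finally show ?thesis .
    qed
    then have \<epsilon>: "\<epsilon> \<in> {0<..e}" using eK K1(1) by (auto simp: \<epsilon>_def)
    have "2 * c / K \<le> 2 / K" using c K1(1) by (intro divide_right_mono) auto
    then have \<nu>: "\<nu> \<in> {0<..e}" using eK K1(1) c by (auto simp: \<nu>_def)
    note sc = e(2)[OF \<epsilon> \<nu>, of \<mu>]
    interpret levi_civita_scaling K \<mu> C c "sqrt \<nu>" "2 * sqrt K * c" \<nu> \<epsilon>
    proof
      show "C = 3 * \<mu> + K * c\<^sup>2" using C c by simp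
      show "(2 * sqrt K * c)\<^sup>2 = 4 * K * c\<^sup>2" using K1(1) by (simp add: power_mult_distrib)
      show "K * \<nu> = 2 * c" using K1(1) by (simp add: \<nu>_def)
      show "\<epsilon> * (2 * sqrt K * c) = \<nu>" using K1(1) by (simp add: \<epsilon>_def \<nu>_def field_simps)
    qed (use \<mu> c \<epsilon> \<nu> sc K1(1) in auto)
    show ?thesis using sc \<mu> by (intro four_arcs) auto
  qed
  moreover have "0 < Khat" by (simp add: Khat_def)
  ultimately show "\<exists>Khat::real. 0 < Khat \<and>
      (\<forall>K \<mu> C :: real. Khat \<le> K \<longrightarrow> 0 < \<mu> \<longrightarrow> \<mu> < 1 \<longrightarrow>
        C = 3 * \<mu> + K * (1 - \<mu>) powr (2 / 3) \<longrightarrow>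
        (\<exists>\<alpha> \<gamma> \<beta> \<delta> :: lc_arc.
          (\<forall>a\<in>{\<alpha>, \<gamma>, \<beta>, \<delta>}. n_EC_orbit \<mu> C n a) \<and>
          distinct (map (projection \<mu>) [\<alpha>, \<gamma>, \<beta>, \<delta>]) \<and>
          x_symmetric_to \<mu> \<alpha> \<alpha> \<and> x_symmetric_to \<mu> \<gamma> \<gamma> \<and>
          x_symmetric_to \<mu> \<beta> \<delta>))"
    by blast
qed

end
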